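(* Let $X$ be a reflexive Banach space with finite cotype and let $T:X\to X$ be an $\mathcal R$-Ritt$_E$ operator. Then for any $\alpha,\beta>0$ the square functions $\|\cdot\|_{T,\alpha}$ and $\|\cdot\|_{T,\beta}$ are equivalent: there exists a constant $C\ge1$ such that $$C^{-1}\|x\|_{T,\beta}\le\|x\|_{T,\alpha}\le C\|x\|_{T,\beta},\qquad x\in X$$ (as elements of $[0,\infty]$).
   Context: $X$ is a complex Banach space, $B(X)$ the algebra of bounded operators on $X$, $R(z,T)=(z-T)^{-1}$, $\mathbb D$ the open unit disc, $\mathbb T$ the unit circle. $E=\{\xi_1,\dots,\xi_N\}\subset\mathbb T$ is a fixed finite set of $N\ge1$ distinct points. $(\varepsilon_k)_{k\ge1}$ are independent Rademacher variables on a probability space $(\Omega,\mathbb P)$ and $\|\sum_k\varepsilon_k\otimes x_k\|_{\mathrm{Rad}(X)}=\big(\int_\Omega\|\sum_k\varepsilon_k(u)x_k\|_X^2\,d\mathbb P(u)\big)^{1/2}$. A set $F\subset B(X)$ is $\mathcal R$-bounded if there is $C>0$ with $\|\sum_{k}\varepsilon_k\otimes T_kx_k\|_{\mathrm{Rad}(X)}\le C\|\sum_{k}\varepsilon_k\otimes x_k\|_{\mathrm{Rad}(X)}$ for all finite sequences $(T_k)$ in $F$, $(x_k)$ in $X$. $T\in B(X)$ is a Ritt$_E$ (resp. $\mathcal R$-Ritt$_E$) operator if $\sigma(T)\subset\overline{\mathbb D}$, $\sigma(T)\cap\mathbb T\subset E$ and for every $C>1$ the set $\{\prod_{j=1}^N(1-\overline{\xi_j}z)R(z,T):1<|z|<C\}$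 is bounded (resp. $\mathcal R$-bounded). For such $T$ each $I-\overline{\xi_j}T$ is a bounded sectorial operator, and $(I-\overline{\xi_j}T)^\alpha$ ($\alpha>0$) is the usual fractional power, a bounded operator. For $\alpha>0$ and $x\in X$ the square function is $$\|x\|_{T,\alpha}=\lim_{n\to\infty}\Big\|\sum_{k=1}^nk^{\alpha-1/2}\varepsilon_k\otimes T^{k-1}\prod_{j=1}^N(I-\overline{\xi_j}T)^\alpha x\Big\|_{\mathrm{Rad}(X)}\in[0,\infty]$$ (nondecreasing limit). *)

theory Defs
  imports "HOL-Probability.Probability"
begin

section \<open>Complex normed spaces and bounded complex-linear operators\<close>

class complex_normed_vector = real_normed_vector +
  fixes scaleC :: "complex \<Rightarrow> 'a \<Rightarrow> 'a"  (infixr "*\<^sub>C" 75)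
  assumes scaleC_add_right: "c *\<^sub>C (x + y) = c *\<^sub>C x + c *\<^sub>C y"
    and scaleC_add_left: "(c + d) *\<^sub>C x = c *\<^sub>C x + d *\<^sub>C x"
    and scaleC_scaleC: "c *\<^sub>C d *\<^sub>C x = (c * d) *\<^sub>C x"
    and scaleR_scaleC: "r *\<^sub>R x = complex_of_real r *\<^sub>C x"
    and norm_scaleC: "norm (c *\<^sub>C x) = cmod c * norm x"

instantiation complex :: complex_normed_vector
begin
definition scaleC_complex :: "complex \<Rightarrow> complex \<Rightarrow> complex"
  where "scaleC_complex c z = c * z"
instance
  by standard (simp_all add: scaleC_complex_def algebra_simps norm_mult scaleR_conv_of_real)
end

lemma bounded_linear_scaleC:
  "bounded_linear (\<lambda>x::'a::complex_normed_vector. c *\<^sub>C x)"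
proof (rule bounded_linear_intro[where K = "cmod c"])
  fix r :: real and x :: 'a
  show "c *\<^sub>C (r *\<^sub>R x) = r *\<^sub>R (c *\<^sub>C x)"
    by (simp add: scaleR_scaleC scaleC_scaleC mult.commute)
qed (simp_all add: scaleC_add_right norm_scaleC mult.commute)

instantiation blinfun :: (real_normed_vector, complex_normed_vector) complex_normed_vector
begin
lift_definition scaleC_blinfun :: "complex \<Rightarrow> ('a, 'b) blinfun \<Rightarrow> ('a, 'b) blinfun"
  is "\<lambda>c T x. c *\<^sub>C T x"
  by (rule bounded_linear_compose[OF bounded_linear_scaleC])
instance
proof
  fix c d :: complex and r :: real and S T :: "('a, 'b) blinfun"
  show "c *\<^sub>C (S + T) = c *\<^sub>C S + c *\<^sub>C T"
    by transfer (simp add: scaleC_add_right)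
  show "(c + d) *\<^sub>C T = c *\<^sub>C T + d *\<^sub>C T"
    by transfer (simp add: scaleC_add_left)
  show "c *\<^sub>C d *\<^sub>C T = (c * d) *\<^sub>C T"
    by transfer (simp add: scaleC_scaleC)
  show "r *\<^sub>R T = complex_of_real r *\<^sub>C T"
    by transfer (simp add: scaleR_scaleC)
  show "norm (c *\<^sub>C T) = cmod c * norm T"
  proof transfer
    fix c :: complex and T :: "'a \<Rightarrow> 'b"
    assume "bounded_linear T"
    then have "onorm (\<lambda>x. cmod c *\<^sub>R T x) = \<bar>cmod c\<bar> * onorm T"
      by (rule onorm_scaleR)
    then show "onorm (\<lambda>x. c *\<^sub>C T x) = cmod c * onorm T"
      by (simp add: onorm_def norm_scaleC)
  qed
qed
end

text \<open>The type \<open>'a \<Rightarrow>\<^sub>L 'b\<close> consists of the bounded \<^emph>\<open>real\<close>-linear maps; the space $B(X,Y)$ of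
  the complex theory is the following subset, with the same norm.\<close>

definition bounded_clinear_ops ::
  "('a::complex_normed_vector \<Rightarrow>\<^sub>L 'b::complex_normed_vector) set"
  where "bounded_clinear_ops = {T :: 'a \<Rightarrow>\<^sub>L 'b. \<forall>c x. T (c *\<^sub>C x) = c *\<^sub>C T x}"

definition is_op_inverse ::
  "('a::complex_normed_vector \<Rightarrow>\<^sub>L 'a) \<Rightarrow> ('a \<Rightarrow>\<^sub>L 'a) \<Rightarrow> bool"
  where "is_op_inverse A S \<longleftrightarrow>
    S \<in> bounded_clinear_ops \<and> A o\<^sub>L S = id_blinfun \<and> S o\<^sub>L A = id_blinfun"

lemma is_op_inverse_unique:
  assumes "is_op_inverse A S" "is_op_inverse A S'"
  shows "S = S'"
proof -
  have "S = S o\<^sub>L (A o\<^sub>L S')"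
    using assms by (simp add: is_op_inverse_def blinfun_eqI)
  also have "\<dots> = (S o\<^sub>L A) o\<^sub>L S'"
    by (simp add: blinfun_eqI)
  finally show ?thesis
    using assms by (simp add: is_op_inverse_def blinfun_eqI)
qed

definition op_inverse :: "('a::complex_normed_vector \<Rightarrow>\<^sub>L 'a) \<Rightarrow> ('a \<Rightarrow>\<^sub>L 'a)"
  where "op_inverse A = (THE S. is_op_inverse A S)"

lemma op_inverse_eqI: "is_op_inverse A S \<Longrightarrow> op_inverse A = S"
  unfolding op_inverse_def by (blast intro: the_equality is_op_inverse_unique)

definition spectrum :: "('a::complex_normed_vector \<Rightarrow>\<^sub>L 'a) \<Rightarrow> complex set"
  where "spectrum T = {z. \<not> (\<exists>S. is_op_inverse (z *\<^sub>C id_blinfun - T) S)}"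

definition resolvent :: "complex \<Rightarrow> ('a::complex_normed_vector \<Rightarrow>\<^sub>L 'a) \<Rightarrow> ('a \<Rightarrow>\<^sub>L 'a)"
  where "resolvent z T = op_inverse (z *\<^sub>C id_blinfun - T)"

definition op_power :: "('a::complex_normed_vector \<Rightarrow>\<^sub>L 'a) \<Rightarrow> nat \<Rightarrow> ('a \<Rightarrow>\<^sub>L 'a)"
  where "op_power T n = (((o\<^sub>L) T) ^^ n) id_blinfun"

text \<open>The ordered product $A_1 A_2 \cdots A_N$; it is used below for commuting operators only.\<close>

definition op_prod :: "(nat \<Rightarrow> 'a::complex_normed_vector \<Rightarrow>\<^sub>L 'a) \<Rightarrow> nat \<Rightarrow> ('a \<Rightarrow>\<^sub>L 'a)"
  where "op_prod A N = foldr (\<lambda>j S. A j o\<^sub>L S) [1..<Suc N] id_blinfun"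


section \<open>Fractional powers of bounded sectorial operators\<close>

text \<open>Balakrishnan's formula: for a bounded sectorial operator $A$ and $0 < s < 1$,
  \[ A^s = \frac{\sin \pi s}{\pi} \int_0^\infty t^{s-1} (t + A)^{-1} A \, dt , \]
  an absolutely convergent integral in operator norm, as $(t+A)^{-1}A$ is bounded near $0$ and
  $O(1/t)$ at infinity.  The gauge integral is used because the Bochner integral of the library
  is restricted to second-countable spaces.\<close>

definition balakrishnan_power ::
  "('a::complex_normed_vector \<Rightarrow>\<^sub>L 'a) \<Rightarrow> real \<Rightarrow> ('a \<Rightarrow>\<^sub>L 'a)"
  where "balakrishnan_power A s =
    (sin (pi * s) / pi) *\<^sub>R
      integral {0<..} (\<lambda>t::real. t powr (s - 1) *\<^sub>R (op_inverse (t *\<^sub>R id_blinfun + A) o\<^sub>L A))"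

text \<open>For general $\alpha > 0$: $A^\alpha = A^{\lfloor\alpha\rfloor} A^{\alpha - \lfloor\alpha\rfloor}$,
  with $A^0 = I$.\<close>

definition frac_power :: "('a::complex_normed_vector \<Rightarrow>\<^sub>L 'a) \<Rightarrow> real \<Rightarrow> ('a \<Rightarrow>\<^sub>L 'a)"
  where "frac_power A \<alpha> =
    op_power A (nat \<lfloor>\<alpha>\<rfloor>) o\<^sub>L
      (if frac \<alpha> = 0 then id_blinfun else balakrishnan_power A (frac \<alpha>))"

lemma frac_power_of_nat: "frac_power A (real n) = op_power A n"
  by (simp add: frac_power_def blinfun_eqI)


section \<open>Rademacher averages\<close>

definition rademacher_sequence :: "'w measure \<Rightarrow> (nat \<Rightarrow> 'w \<Rightarrow> real) \<Rightarrow> bool"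
  where "rademacher_sequence M \<epsilon> \<longleftrightarrow>
    prob_space M \<and>
    prob_space.indep_vars M (\<lambda>_. borel) \<epsilon> {1..} \<and>
    (\<forall>k\<ge>1. measure M {u \<in> space M. \<epsilon> k u = 1} = 1 / 2 \<and>
            measure M {u \<in> space M. \<epsilon> k u = - 1} = 1 / 2)"

definition rad_norm ::
  "'w measure \<Rightarrow> (nat \<Rightarrow> 'w \<Rightarrow> real) \<Rightarrow> nat \<Rightarrow> (nat \<Rightarrow> 'a::real_normed_vector) \<Rightarrow> real"
  where "rad_norm M \<epsilon> n x = sqrt (\<integral>u. (norm (\<Sum>k=1..n. \<epsilon> k u *\<^sub>R x k))\<^sup>2 \<partial>M)"

definition R_bounded ::
  "'w measure \<Rightarrow> (nat \<Rightarrow> 'w \<Rightarrow> real) \<Rightarrow> ('a::complex_normed_vector \<Rightarrow>\<^sub>L 'a) set \<Rightarrow> bool"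
  where "R_bounded M \<epsilon> F \<longleftrightarrow>
    (\<exists>C>0. \<forall>n (T :: nat \<Rightarrow> 'a \<Rightarrow>\<^sub>L 'a) x. (\<forall>k\<in>{1..n}. T k \<in> F) \<longrightarrow>
       rad_norm M \<epsilon> n (\<lambda>k. T k (x k)) \<le> C * rad_norm M \<epsilon> n x)"


section \<open>Geometry of the space\<close>

text \<open>Every bounded complex-linear functional on the dual is evaluation at a point. A functional on
  the dual is a function on the type \<open>'a \<Rightarrow>\<^sub>L complex\<close> of which only the restriction to the
  complex dual \<open>bounded_clinear_ops\<close> matters.\<close>

definition reflexive_space :: "'a::complex_normed_vector itself \<Rightarrow> bool"
  where "reflexive_space _ \<longleftrightarrow>
    (let dual = (bounded_clinear_ops :: ('a \<Rightarrow>\<^sub>L complex) set) in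
      \<forall>\<phi> :: ('a \<Rightarrow>\<^sub>L complex) \<Rightarrow> complex.
        (\<forall>f\<in>dual. \<forall>g\<in>dual. \<phi> (f + g) = \<phi> f + \<phi> g) \<and>
        (\<forall>f\<in>dual. \<forall>c. \<phi> (c *\<^sub>C f) = c * \<phi> f) \<and>
        (\<exists>K. \<forall>f\<in>dual. cmod (\<phi> f) \<le> K * norm f) \<longrightarrow>
        (\<exists>x. \<forall>f\<in>dual. \<phi> f = blinfun_apply f x))"

definition has_cotype ::
  "'w measure \<Rightarrow> (nat \<Rightarrow> 'w \<Rightarrow> real) \<Rightarrow> real \<Rightarrow> 'a::real_normed_vector itself \<Rightarrow> bool"
  where "has_cotype M \<epsilon> q _ \<longleftrightarrow>
    (\<exists>C>0. \<forall>n (x :: nat \<Rightarrow> 'a).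
       (\<Sum>k=1..n. norm (x k) powr q) powr (1 / q) \<le> C * rad_norm M \<epsilon> n x)"

definition finite_cotype ::
  "'w measure \<Rightarrow> (nat \<Rightarrow> 'w \<Rightarrow> real) \<Rightarrow> 'a::real_normed_vector itself \<Rightarrow> bool"
  where "finite_cotype M \<epsilon> X \<longleftrightarrow> (\<exists>q\<ge>2. has_cotype M \<epsilon> q X)"


section \<open>R-Ritt operators with respect to a finite set, and their square functions\<close>

text \<open>Here $E = \{\xi_1, \dots, \xi_N\}$.\<close>

definition R_Ritt ::
  "'w measure \<Rightarrow> (nat \<Rightarrow> 'w \<Rightarrow> real) \<Rightarrow> nat \<Rightarrow> (nat \<Rightarrow> complex) \<Rightarrow>
    ('a::complex_normed_vector \<Rightarrow>\<^sub>L 'a) \<Rightarrow> bool"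
  where "R_Ritt M \<epsilon> N \<xi> T \<longleftrightarrow>
    T \<in> bounded_clinear_ops \<and>
    spectrum T \<subseteq> cball 0 1 \<and>
    spectrum T \<inter> sphere 0 1 \<subseteq> \<xi> ` {1..N} \<and>
    (\<forall>C>1. R_bounded M \<epsilon>
       {(\<Prod>j=1..N. 1 - cnj (\<xi> j) * z) *\<^sub>C resolvent z T | z. 1 < cmod z \<and> cmod z < C})"

definition square_function ::
  "'w measure \<Rightarrow> (nat \<Rightarrow> 'w \<Rightarrow> real) \<Rightarrow> nat \<Rightarrow> (nat \<Rightarrow> complex) \<Rightarrow>
    ('a::complex_normed_vector \<Rightarrow>\<^sub>L 'a) \<Rightarrow> real \<Rightarrow> 'a \<Rightarrow> ennreal"
  where "square_function M \<epsilon> N \<xi> T \<alpha> x =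
    lim (\<lambda>n. ennreal (rad_norm M \<epsilon> n (\<lambda>k.
      (real k powr (\<alpha> - 1 / 2)) *\<^sub>R
        (op_power T (k - 1) o\<^sub>L
          op_prod (\<lambda>j. frac_power (id_blinfun - cnj (\<xi> j) *\<^sub>C T) \<alpha>) N) x)))"

end

theory Submission
  imports Defs "HOL-Computational_Algebra.Fundamental_Theorem_Algebra"
begin

text \<open>Let \<open>P = \<Prod>(I - cnj \<xi>\<^sub>j T)\<close> and \<open>B\<^sub>\<alpha> = \<Prod>(I - cnj \<xi>\<^sub>j T)\<^sup>\<alpha>\<close>. Averaging powers of the resolvent over the circle
  of radius \<open>1 + 1/m\<close> shows that the operators \<open>T\<^sup>m\<close> and \<open>m T\<^sup>m P\<close> form R-bounded sets; the binomial series of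
  the fractional powers then gives the same for \<open>m\<^sup>\<delta> T\<^sup>m B\<^sub>\<delta>\<close>, \<open>0 < \<delta> \<le> 1\<close>. Splitting \<open>T\<^sup>m\<close> into two halves, this
  bounds the square function of exponent \<open>\<alpha> + \<delta>\<close> by that of exponent \<open>\<alpha>\<close> whenever \<open>B\<^sub>\<alpha>\<^sub>+\<^sub>\<delta> = B\<^sub>\<delta> B\<^sub>\<alpha>\<close>.
  Conversely, partial fractions of \<open>1/P\<close> expand \<open>T\<^sup>m\<close> in the operators \<open>T\<^sup>k P\<close>, \<open>k \<ge> m\<close>, with bounded scalar coefficients,
  so that the sequence defining the exponent \<open>\<alpha>\<close> is the image of the one for \<open>\<alpha> + 1\<close> under a kernel of size
  \<open>m\<^sup>\<alpha>\<^sup>-\<^sup>1\<^sup>/\<^sup>2 k\<^sup>-\<^sup>\<alpha>\<^sup>-\<^sup>1\<^sup>/\<^sup>2\<close>, which is bounded on Rademacher sums in any Banach space. With \<open>B\<^sub>s B\<^sub>1\<^sub>-\<^sub>s = B\<^sub>1\<close>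
  for \<open>0 < s < 1\<close>, every exponent is comparable to \<open>1\<close>.\<close>

section \<open>Rademacher averages as finite means over signs\<close>

text \<open>R-boundedness survives products, sums and limits of absolutely convex combinations, so
  each operator is sought as such a combination with uniformly bounded total weight. The weight is
  the obstacle. The mean of |1 - cnj \<xi> z|^-1 over |z| = 1 + 1/m grows like log m, so a single
  resolvent loses a logarithm. Its square has mean of order m, and the m-th coefficient of (z
  R(z))^2 is (m + 1) T^m, which makes up for that growth. For m T^m P the cube serves, with P
  cancelling one of the three denominators. Means over roots of unity stand for contour integrals
  because they are finite combinations. The second obstacle is the return from \<alpha> + 1 to
  \<alpha>: boundedness of the kernel on l^2 alone does not settle its action on Rademacher sums.
  Hence it is averaged from matrices with one nonzero entry per column, which
  \<open>rad_fiber_sum\<close> controls. Composition of fractional powers enters only for the pairs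
  (\<alpha>, 1) and (s, 1 - s).\<close>

definition sg :: "'i set \<Rightarrow> 'i \<Rightarrow> real"
  where "sg A i = (if i \<in> A then 1 else - 1)"

lemma sg_simps [simp]: "i \<in> A \<Longrightarrow> sg A i = 1" "i \<notin> A \<Longrightarrow> sg A i = - 1"
  by (simp_all add: sg_def)

lemma abs_sg [simp]: "\<bar>sg A i\<bar> = 1"
  by (simp add: sg_def)

text \<open>The second moment of a Rademacher sum, where the set \<open>A\<close> of indices with
  sign +1 takes the place of a sample point. Arbitrary index sets are allowed, so that sums can be
  restricted, split and reindexed.\<close>

definition rad :: "'i set \<Rightarrow> ('i \<Rightarrow> 'a::real_normed_vector) \<Rightarrow> real"
  where "rad I x = L2_set (\<lambda>A. norm (\<Sum>i\<in>I. sg A i *\<^sub>R x i)) (Pow I) / sqrt (2 ^ card I)"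

lemma rad_nonneg [simp]: "0 \<le> rad I x"
  by (simp add: rad_def)

lemma rad_cong: "(\<And>i. i \<in> I \<Longrightarrow> x i = y i) \<Longrightarrow> rad I x = rad I y"
  by (simp add: rad_def)

lemma rad_square:
  "(rad I x)\<^sup>2 = (\<Sum>A\<in>Pow I. (norm (\<Sum>i\<in>I. sg A i *\<^sub>R x i))\<^sup>2) / 2 ^ card I"
  by (simp add: rad_def L2_set_def power_divide sum_nonneg)

lemma rad_empty [simp]: "rad {} x = 0"
  by (simp add: rad_def)

lemma rad_singleton [simp]: "rad {i} x = norm (x i)"
proof -
  have "(rad {i} x)\<^sup>2 = (norm (x i))\<^sup>2"
    by (simp add: rad_square Pow_insert)
  then show ?thesis
    by simp
qed

lemma rad_zero [simp]: "rad I (\<lambda>i. 0) = 0"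
  by (simp add: rad_def L2_set_def)

lemma rad_add: "rad I (\<lambda>i. x i + y i) \<le> rad I x + rad I y"
proof -
  have "L2_set (\<lambda>A. norm (\<Sum>i\<in>I. sg A i *\<^sub>R (x i + y i))) (Pow I)
      \<le> L2_set (\<lambda>A. norm (\<Sum>i\<in>I. sg A i *\<^sub>R x i) + norm (\<Sum>i\<in>I. sg A i *\<^sub>R y i)) (Pow I)"
    by (rule L2_set_mono) (auto simp: scaleR_add_right sum.distrib norm_triangle_ineq)
  also have "\<dots> \<le> L2_set (\<lambda>A. norm (\<Sum>i\<in>I. sg A i *\<^sub>R x i)) (Pow I)
      + L2_set (\<lambda>A. norm (\<Sum>i\<in>I. sg A i *\<^sub>R y i)) (Pow I)"
    by (rule L2_set_triangle_ineq)
  finally show ?thesis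
    unfolding rad_def add_divide_distrib[symmetric] by (rule divide_right_mono) simp
qed

lemma rad_sum: "rad I (\<lambda>i. \<Sum>j\<in>J. x j i) \<le> (\<Sum>j\<in>J. rad I (x j))"
proof (induction J rule: infinite_finite_induct)
  case (insert j J)
  then show ?case
    using rad_add[of I "x j" "\<lambda>i. \<Sum>j\<in>J. x j i"] by simp
qed simp_all

lemma rad_scaleR: "rad I (\<lambda>i. c *\<^sub>R x i) = \<bar>c\<bar> * rad I x"
proof -
  have "(\<Sum>i\<in>I. sg A i *\<^sub>R c *\<^sub>R x i) = c *\<^sub>R (\<Sum>i\<in>I. sg A i *\<^sub>R x i)" for A
    by (simp add: scaleR_sum_right mult.commute)
  then show ?thesis
    by (simp add: rad_def L2_set_right_distrib)
qed

lemma rad_scaleC: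
  fixes x :: "'i \<Rightarrow> 'a::complex_normed_vector"
  shows "rad I (\<lambda>i. c *\<^sub>C x i) = cmod c * rad I x"
proof -
  interpret bounded_linear "\<lambda>x::'a. c *\<^sub>C x"
    by (rule bounded_linear_scaleC)
  have "(\<lambda>A. norm (\<Sum>i\<in>I. sg A i *\<^sub>R c *\<^sub>C x i)) = (\<lambda>A. cmod c * norm (\<Sum>i\<in>I. sg A i *\<^sub>R x i))"
    by (simp add: norm_scaleC flip: scaleR sum)
  then show ?thesis
    by (simp add: rad_def L2_set_right_distrib)
qed

lemma rad_le_sum_norm:
  assumes "finite I"
  shows "rad I x \<le> (\<Sum>i\<in>I. norm (x i))"
proof -
  have "L2_set (\<lambda>A. norm (\<Sum>i\<in>I. sg A i *\<^sub>R x i)) (Pow I) \<le> L2_set (\<lambda>A. (\<Sum>i\<in>I. norm (x i))) (Pow I)"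
  proof (rule L2_set_mono)
    fix A
    show "norm (\<Sum>i\<in>I. sg A i *\<^sub>R x i) \<le> (\<Sum>i\<in>I. norm (x i))"
      by (rule order_trans[OF norm_sum]) simp
  qed simp
  also have "\<dots> = (\<Sum>i\<in>I. norm (x i)) * sqrt (2 ^ card I)"
    by (simp add: L2_set_constant card_Pow assms sum_nonneg mult.commute)
  finally show ?thesis
    unfolding rad_def by (simp add: divide_le_eq)
qed

lemma rad_reindex:
  assumes "inj_on f J" "finite J"
  shows "rad (f ` J) x = rad J (\<lambda>j. x (f j))"
proof -
  have sg_image: "sg (f ` A) (f j) = sg A j" if "A \<subseteq> J" "j \<in> J" for A j
    using inj_on_image_mem_iff[OF assms(1) that(2,1)] by (simp add: sg_def)
  have "(rad (f ` J) x)\<^sup>2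
      = (\<Sum>A\<in>Pow J. (norm (\<Sum>i\<in>f ` J. sg (f ` A) i *\<^sub>R x i))\<^sup>2) / 2 ^ card J"
    unfolding rad_square image_Pow_surj[OF refl, of f J, symmetric]
    by (subst sum.reindex) (auto simp: card_image assms inj_on_image_Pow)
  also have "(\<Sum>A\<in>Pow J. (norm (\<Sum>i\<in>f ` J. sg (f ` A) i *\<^sub>R x i))\<^sup>2)
      = (\<Sum>A\<in>Pow J. (norm (\<Sum>j\<in>J. sg A j *\<^sub>R x (f j)))\<^sup>2)"
    by (rule sum.cong) (auto simp: sum.reindex assms sg_image intro!: arg_cong[where f = norm] sum.cong)
  finally have "(rad (f ` J) x)\<^sup>2 = (rad J (\<lambda>j. x (f j)))\<^sup>2"
    by (simp add: rad_square)
  then show ?thesis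
    by simp
qed

text \<open>The sign vectors form a group, so multiplication by the fixed vector \<open>sg B\<close>
  permutes the patterns over which the mean is taken.\<close>

lemma rad_sign_change:
  assumes "finite I"
  shows "rad I (\<lambda>i. sg B i *\<^sub>R x i) = rad I x"
proof -
  define flip where "flip A = {i \<in> I. sg A i * sg B i = 1}" for A
  have flip_sg: "sg (flip A) i = sg A i * sg B i" if "i \<in> I" for A i
    using that by (auto simp: flip_def sg_def split: if_splits)
  have invol: "flip (flip A) = A" if "A \<subseteq> I" for A
    using that by (auto simp: flip_def sg_def split: if_splits)
  have bij: "bij_betw flip (Pow I) (Pow I)"
    by (rule bij_betw_byWitness[where f' = flip]) (auto simp: invol, auto simp: flip_def)
  have "(rad I x)\<^sup>2 = (\<Sum>A\<in>Pow I. (norm (\<Sum>i\<in>I. sg (flip A) i *\<^sub>R x i))\<^sup>2) / 2 ^ card I"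
    unfolding rad_square sum.reindex_bij_betw[OF bij, symmetric, where g = "\<lambda>A. (norm (\<Sum>i\<in>I. sg A i *\<^sub>R x i))\<^sup>2"] ..
  also have "\<dots> = (rad I (\<lambda>i. sg B i *\<^sub>R x i))\<^sup>2"
    by (simp add: rad_square flip_sg)
  finally show ?thesis
    by simp
qed

section \<open>Contraction principle, restriction and union of index sets\<close>

lemma rad_contraction_coordinate:
  assumes "finite I" "\<bar>a\<bar> \<le> 1"
  shows "rad I (\<lambda>i. if i = k then a *\<^sub>R x i else x i) \<le> rad I x"
proof -
  \<comment> \<open>\<open>a\<close> is the convex combination of 1 and - 1 with weights
    \<open>(1 + a) / 2\<close> and \<open>(1 - a) / 2\<close>; the sign - 1 at the single index
    \<open>k\<close> leaves \<open>rad\<close> unchanged.\<close>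
  have eq: "(\<lambda>i. if i = k then a *\<^sub>R x i else x i)
      = (\<lambda>i. ((1 + a) / 2) *\<^sub>R x i + ((1 - a) / 2) *\<^sub>R (sg (- {k}) i *\<^sub>R x i))"
    by (auto simp: fun_eq_iff scaleR_left.add[symmetric] field_simps simp flip: scaleR_add_left scaleR_diff_left)
  have "rad I (\<lambda>i. if i = k then a *\<^sub>R x i else x i)
      \<le> rad I (\<lambda>i. ((1 + a) / 2) *\<^sub>R x i) + rad I (\<lambda>i. ((1 - a) / 2) *\<^sub>R (sg (- {k}) i *\<^sub>R x i))"
    unfolding eq by (rule rad_add)
  also have "\<dots> = (1 + a) / 2 * rad I x + (1 - a) / 2 * rad I x"
    using assms by (simp only: rad_scaleR rad_sign_change[OF assms(1)]) simp
  also have "\<dots> = rad I x"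
    by (simp add: field_simps)
  finally show ?thesis .
qed

lemma rad_contraction:
  assumes "finite I" "\<And>i. i \<in> I \<Longrightarrow> \<bar>a i\<bar> \<le> 1"
  shows "rad I (\<lambda>i. a i *\<^sub>R x i) \<le> rad I x"
proof -
  have "rad I (\<lambda>i. if i \<in> J then a i *\<^sub>R x i else x i) \<le> rad I x" if "finite J" "J \<subseteq> I" for J
    using that
  proof (induction J rule: finite_induct)
    case (insert k J)
    have "rad I (\<lambda>i. if i \<in> insert k J then a i *\<^sub>R x i else x i)
        = rad I (\<lambda>i. if i = k then a k *\<^sub>R (if i \<in> J then a i *\<^sub>R x i else x i)
                     else (if i \<in> J then a i *\<^sub>R x i else x i))"
      using insert.hyps by (intro rad_cong) auto
    also have "\<dots> \<le> rad I (\<lambda>i. if i \<in> J then a i *\<^sub>R x i else x i)"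
      using insert.prems assms by (intro rad_contraction_coordinate) auto
    finally show ?case
      using insert by simp
  qed simp
  from this[of I] have "rad I (\<lambda>i. if i \<in> I then a i *\<^sub>R x i else x i) \<le> rad I x"
    using assms(1) by simp
  then show ?thesis
    by (simp cong: rad_cong)
qed

text \<open>Real and imaginary parts are contracted separately. This is the origin of the factor 2
  in \<open>Rbd_scaleC\<close> and in the bounds derived from it.\<close>

lemma rad_contraction_complex:
  fixes x :: "'i \<Rightarrow> 'a::complex_normed_vector"
  assumes "finite I" "\<And>i. i \<in> I \<Longrightarrow> cmod (c i) \<le> 1"
  shows "rad I (\<lambda>i. c i *\<^sub>C x i) \<le> 2 * rad I x"
proof -
  have eq: "c i *\<^sub>C x i = Re (c i) *\<^sub>R x i + Im (c i) *\<^sub>R (\<i> *\<^sub>C x i)" for i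
    by (simp add: scaleR_scaleC scaleC_scaleC mult.commute[of _ \<i>] flip: scaleC_add_left complex_eq)
  have "rad I (\<lambda>i. c i *\<^sub>C x i)
      \<le> rad I (\<lambda>i. Re (c i) *\<^sub>R x i) + rad I (\<lambda>i. Im (c i) *\<^sub>R (\<i> *\<^sub>C x i))"
    unfolding eq by (rule rad_add)
  also have "\<dots> \<le> rad I x + rad I (\<lambda>i. \<i> *\<^sub>C x i)"
    using assms abs_Re_le_cmod abs_Im_le_cmod
    by (intro add_mono rad_contraction) (meson order_trans)+
  finally show ?thesis
    by (simp add: rad_scaleC)
qed

lemma sum_Pow_insert:
  assumes "finite J" "k \<notin> J"
  shows "(\<Sum>A\<in>Pow (insert k J). g A) = (\<Sum>A\<in>Pow J. g A + g (insert k A))"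
proof -
  have inj: "inj_on (insert k) (Pow J)"
    using assms(2) by (auto intro!: inj_onI)
  have "Pow J \<inter> insert k ` Pow J = {}"
    using assms(2) by auto
  then show ?thesis
    using assms(1) by (simp add: Pow_insert sum.union_disjoint sum.reindex[OF inj] sum.distrib)
qed

text \<open>Every pattern on \<open>J\<close> is counted twice, with and without \<open>k\<close>,
  and the normalisation by \<open>2 ^ card\<close> absorbs the repetition.\<close>

lemma rad_insert_zero:
  assumes "finite J" "k \<notin> J" "x k = 0"
  shows "rad (insert k J) x = rad J x"
proof -
  have sg: "(\<Sum>i\<in>J. sg (insert k A) i *\<^sub>R x i) = (\<Sum>i\<in>J. sg A i *\<^sub>R x i)" for A
    using assms by (intro sum.cong) (auto simp: sg_def)
  have "(rad (insert k J) x)\<^sup>2 = (rad J x)\<^sup>2"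
    using assms by (simp add: rad_square sum_Pow_insert sg mult_2[symmetric] flip: sum_distrib_left)
  then show ?thesis
    by simp
qed

lemma rad_restrict:
  assumes "finite I" "J \<subseteq> I"
  shows "rad I (\<lambda>i. if i \<in> J then x i else 0) = rad J x"
proof -
  have "rad (J \<union> K) (\<lambda>i. if i \<in> J then x i else 0) = rad J x" if "finite K" "K \<inter> J = {}" for K
    using that
  proof (induction K rule: finite_induct)
    case (insert k K)
    then have "rad (insert k (J \<union> K)) (\<lambda>i. if i \<in> J then x i else 0)
        = rad (J \<union> K) (\<lambda>i. if i \<in> J then x i else 0)"
      using finite_subset[OF assms(2,1)] by (intro rad_insert_zero) auto
    with insert show ?case
      by simp
  next
    case empty
    show ?case
      unfolding Un_empty_right by (rule rad_cong) simp
  qed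
  from this[of "I - J"] show ?thesis
    using assms by (simp add: Un_absorb1 Int_commute)
qed

lemma rad_mono:
  assumes "finite I" "J \<subseteq> I"
  shows "rad J x \<le> rad I x"
proof -
  have "rad J x = rad I (\<lambda>i. (if i \<in> J then 1 else 0) *\<^sub>R x i)"
    unfolding rad_restrict[OF assms, symmetric] by (rule rad_cong) auto
  also have "\<dots> \<le> rad I x"
    using assms by (intro rad_contraction) auto
  finally show ?thesis .
qed

lemma rad_Un:
  assumes "finite I" "finite J"
  shows "rad (I \<union> J) x \<le> rad I x + rad J x"
proof -
  have "rad (I \<union> J) x = rad (I \<union> J) (\<lambda>i. (if i \<in> I then x i else 0) + (if i \<in> J - I then x i else 0))"
    by (rule rad_cong) auto
  also have "\<dots> \<le> rad (I \<union> J) (\<lambda>i. if i \<in> I then x i else 0) + rad (I \<union> J) (\<lambda>i. if i \<in> J - I then x i else 0)"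
    by (rule rad_add)
  also have "\<dots> = rad I x + rad (J - I) x"
    using assms by (subst (1 2) rad_restrict) auto
  also have "rad (J - I) x \<le> rad J x"
    using assms by (intro rad_mono) auto
  finally show ?thesis
    by simp
qed

section \<open>Riesz products and sums over fibres\<close>

lemma mean_power2_ge:
  fixes f :: "'b \<Rightarrow> real"
  assumes "finite S"
  shows "(\<Sum>s\<in>S. f s)\<^sup>2 \<le> real (card S) * (\<Sum>s\<in>S. (f s)\<^sup>2)"
  using Cauchy_Schwarz_ineq_sum[of "\<lambda>s. 1" f S] by simp

text \<open>Independence of the signs in unnormalised form: the right side, multiplied out, has one
  term for each choice of signs.\<close>

lemma sum_Pow_prod_sg:
  fixes h :: "'i \<Rightarrow> real \<Rightarrow> 'c::comm_ring_1"
  assumes "finite J"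
  shows "(\<Sum>A\<in>Pow J. \<Prod>i\<in>J. h i (sg A i)) = (\<Prod>i\<in>J. h i 1 + h i (- 1))"
proof -
  have "(\<Prod>i\<in>J. h i (sg A i)) = (\<Prod>i\<in>A. h i 1) * (\<Prod>i\<in>J - A. h i (- 1))" if "A \<subseteq> J" for A
  proof -
    have "(\<Prod>i\<in>J. h i (sg A i)) = (\<Prod>i\<in>J - A. h i (sg A i)) * (\<Prod>i\<in>A. h i (sg A i))"
      using assms that by (rule prod.subset_diff[rotated])
    then show ?thesis
      by (simp add: mult.commute)
  qed
  then show ?thesis
    by (simp add: prod_add[OF assms])
qed

text \<open>Averaging the signs against a bounded Riesz product extracts the coefficients \<open>\<theta>\<^sub>k\<close>. In \<open>rad_fiber_sum\<close>
  this takes the place of the covariance domination available for Gaussian sums.\<close>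

lemma riesz_product_mean:
  fixes \<theta> :: "'i \<Rightarrow> real"
  assumes "finite J" "k \<in> J"
  shows "(\<Sum>A\<in>Pow J. sg A k * Im (\<Prod>i\<in>J. 1 + \<i> * (\<theta> i * sg A i))) = 2 ^ card J * \<theta> k"
proof -
  define h :: "'i \<Rightarrow> real \<Rightarrow> complex"
    where "h i s = (1 + \<i> * (\<theta> i * s)) * (if i = k then of_real s else 1)" for i s
  have "(\<Sum>A\<in>Pow J. sg A k * Im (\<Prod>i\<in>J. 1 + \<i> * (\<theta> i * sg A i)))
      = Im (\<Sum>A\<in>Pow J. \<Prod>i\<in>J. h i (sg A i))"
    using assms by (simp add: h_def prod.distrib prod.delta mult.commute[of "Im _"])
  also have "(\<Sum>A\<in>Pow J. \<Prod>i\<in>J. h i (sg A i)) = (\<Prod>i\<in>J. 2 * (if i = k then \<i> * \<theta> i else 1))"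
    by (subst sum_Pow_prod_sg[OF assms(1)]) (auto intro!: prod.cong simp: h_def algebra_simps)
  also have "\<dots> = of_real (2 ^ card J * \<theta> k) * \<i>"
    using assms by (simp add: prod.distrib prod.delta)
  also have "Im \<dots> = 2 ^ card J * \<theta> k"
    by (simp only: Im_complex_of_real Re_complex_of_real times_complex.simps imaginary_unit.simps)
  finally show ?thesis .
qed

text \<open>A factor has squared modulus 1 + \<theta>^2 \<le> exp (\<theta>^2), so the squared
  product is at most e < 4. The imaginary unit is essential: the real product of 1 + \<theta> s can
  be as large as the exponential of a multiple of the l^1 norm of \<theta>, while only the l^2 norm
  is controlled.\<close>

lemma riesz_product_bound:
  fixes \<theta> :: "'i \<Rightarrow> real"
  assumes "finite J" "(\<Sum>i\<in>J. (\<theta> i)\<^sup>2) \<le> 1"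
  shows "\<bar>Im (\<Prod>i\<in>J. 1 + \<i> * (\<theta> i * sg A i))\<bar> \<le> 2"
proof -
  have "(cmod (\<Prod>i\<in>J. 1 + \<i> * (\<theta> i * sg A i)))\<^sup>2 = (\<Prod>i\<in>J. 1 + (\<theta> i)\<^sup>2)"
    by (simp add: prod_norm[symmetric] prod_power_distrib cmod_power2 power_mult_distrib
        sg_def if_distrib[of power2] cong: if_cong)
  also have "\<dots> \<le> (\<Prod>i\<in>J. exp ((\<theta> i)\<^sup>2))"
    by (rule prod_mono) (auto intro: exp_ge_add_one_self add_nonneg_nonneg)
  also have "\<dots> = exp (\<Sum>i\<in>J. (\<theta> i)\<^sup>2)"
    by (simp add: exp_sum assms)
  also have "\<dots> \<le> 3"
    using exp_le assms(2) by (meson exp_le_cancel_iff order_trans)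
  finally have "(cmod (\<Prod>i\<in>J. 1 + \<i> * (\<theta> i * sg A i)))\<^sup>2 \<le> 2\<^sup>2"
    by simp
  then have "cmod (\<Prod>i\<in>J. 1 + \<i> * (\<theta> i * sg A i)) \<le> 2"
    by (rule power2_le_imp_le) simp
  then show ?thesis
    using abs_Im_le_cmod order_trans by blast
qed

text \<open>On each fibre the function \<open>\<Phi> m\<close> of the signs is bounded by 2 and has
  the correlations \<theta> with them, so the fibre sum is the mean over \<open>A\<close> of
  \<open>\<Phi> m A\<close> times the signed block \<open>v A m\<close>. For fixed \<open>A\<close>
  the contraction principle removes \<open>\<Phi>\<close>. What remains is a sum with independent
  signs on \<open>I\<close> and on \<open>K\<close>, whose products are again independent signs on
  \<open>K\<close>.\<close>

lemma rad_fiber_sum: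
  fixes x :: "'k \<Rightarrow> 'a::real_normed_vector" and \<pi> :: "'k \<Rightarrow> 'i" and \<theta> :: "'k \<Rightarrow> real"
  assumes K: "finite K" and I: "finite I" and \<pi>: "\<pi> ` K \<subseteq> I"
    and \<theta>: "\<And>m. m \<in> I \<Longrightarrow> (\<Sum>k | k \<in> K \<and> \<pi> k = m. (\<theta> k)\<^sup>2) \<le> 1"
  shows "rad I (\<lambda>m. \<Sum>k | k \<in> K \<and> \<pi> k = m. \<theta> k *\<^sub>R x k) \<le> 2 * rad K x"
proof -
  define fib where "fib m = {k \<in> K. \<pi> k = m}" for m
  have fin: "finite (fib m)" for m
    using K by (simp add: fib_def)
  \<comment> \<open>\<theta> is cut off to the fibre of \<open>m\<close>, so that the product over
    all of \<open>K\<close> is a Riesz product of that fibre only.\<close>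
  define \<theta>' where "\<theta>' m k = (if \<pi> k = m then \<theta> k else 0)" for m k
  define \<Phi> where "\<Phi> m A = Im (\<Prod>i\<in>K. 1 + \<i> * (\<theta>' m i * sg A i))" for m A
  define v where "v A m = (\<Sum>k\<in>fib m. sg A k *\<^sub>R x k)" for A m
  define c :: real where "c = 2 ^ card K"
  have c: "c > 0"
    by (simp add: c_def)
  have bound: "\<bar>\<Phi> m A\<bar> \<le> 2" if "m \<in> I" for m A
  proof -
    have "(\<Sum>i\<in>K. (\<theta>' m i)\<^sup>2) = (\<Sum>k | k \<in> K \<and> \<pi> k = m. (\<theta> k)\<^sup>2)"
      using K by (simp add: \<theta>'_def sum.If_cases if_distrib[of power2] Int_def cong: if_cong)
    with \<theta>[OF that] show ?thesis
      unfolding \<Phi>_def using K by (intro riesz_product_bound) simp_all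
  qed
  have mean: "(\<Sum>k\<in>fib m. \<theta> k *\<^sub>R x k) = (\<Sum>A\<in>Pow K. (1 / c) *\<^sub>R \<Phi> m A *\<^sub>R v A m)" for m
  proof -
    have "(\<Sum>A\<in>Pow K. (1 / c) *\<^sub>R \<Phi> m A *\<^sub>R v A m)
        = (\<Sum>k\<in>fib m. (1 / c) *\<^sub>R (\<Sum>A\<in>Pow K. sg A k * \<Phi> m A) *\<^sub>R x k)"
      unfolding v_def scaleR_sum_right scaleR_sum_left
      by (subst sum.swap) (simp add: mult.commute mult.left_commute)
    also have "\<dots> = (\<Sum>k\<in>fib m. \<theta> k *\<^sub>R x k)"
    proof (rule sum.cong)
      fix k assume "k \<in> fib m"
      then have "(\<Sum>A\<in>Pow K. sg A k * \<Phi> m A) = c * \<theta> k"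
        unfolding \<Phi>_def c_def by (subst riesz_product_mean) (auto simp: K fib_def \<theta>'_def)
      then show "(1 / c) *\<^sub>R (\<Sum>A\<in>Pow K. sg A k * \<Phi> m A) *\<^sub>R x k = \<theta> k *\<^sub>R x k"
        using c by simp
    qed simp
    finally show ?thesis by (rule sym)
  qed
  have total: "(\<Sum>A\<in>Pow K. (rad I (v A))\<^sup>2) = c * (rad K x)\<^sup>2"
  proof -
    \<comment> \<open>For fixed \<open>B\<close> the block signs act on the fibres as one sign
      change of \<open>x\<close>; by \<open>rad_sign_change\<close> the sum over \<open>A\<close> is
      then the same for every \<open>B\<close>.\<close>
    have eq: "(\<Sum>m\<in>I. sg B m *\<^sub>R v A m) = (\<Sum>k\<in>K. sg A k *\<^sub>R sg (\<pi> -` B) k *\<^sub>R x k)" for A B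
    proof -
      have "(\<Sum>m\<in>I. sg B m *\<^sub>R v A m) = (\<Sum>m\<in>I. \<Sum>k\<in>fib m. sg A k *\<^sub>R sg (\<pi> -` B) k *\<^sub>R x k)"
        unfolding v_def scaleR_sum_right
        by (intro sum.cong) (auto simp: fib_def sg_def)
      then show ?thesis
        unfolding fib_def using sum.group[OF K I \<pi>] by simp
    qed
    have "(\<Sum>A\<in>Pow K. (rad I (v A))\<^sup>2)
        = (\<Sum>B\<in>Pow I. \<Sum>A\<in>Pow K. (norm (\<Sum>m\<in>I. sg B m *\<^sub>R v A m))\<^sup>2) / 2 ^ card I"
      unfolding rad_square sum_divide_distrib by (subst sum.swap) simp
    also have "\<dots> = (\<Sum>B\<in>Pow I. c * (rad K (\<lambda>k. sg (\<pi> -` B) k *\<^sub>R x k))\<^sup>2) / 2 ^ card I"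
      by (simp only: rad_square eq) (simp add: c_def)
    also have "\<dots> = c * (rad K x)\<^sup>2"
      unfolding rad_sign_change[OF K] using I by (simp add: card_Pow)
    finally show ?thesis .
  qed
  have "rad I (\<lambda>m. \<Sum>k\<in>fib m. \<theta> k *\<^sub>R x k) \<le> (\<Sum>A\<in>Pow K. rad I (\<lambda>m. (1 / c) *\<^sub>R \<Phi> m A *\<^sub>R v A m))"
    unfolding mean by (rule rad_sum)
  also have "\<dots> \<le> (\<Sum>A\<in>Pow K. 2 / c * rad I (v A))"
  proof (rule sum_mono)
    fix A
    have "rad I (\<lambda>m. (1 / c) *\<^sub>R \<Phi> m A *\<^sub>R v A m) = rad I (\<lambda>m. (2 / c) *\<^sub>R (\<Phi> m A / 2) *\<^sub>R v A m)"
      by simp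
    also have "\<dots> = 2 / c * rad I (\<lambda>m. (\<Phi> m A / 2) *\<^sub>R v A m)"
      using c by (simp only: rad_scaleR) simp
    also have "\<dots> \<le> 2 / c * rad I (v A)"
      using c bound[of _ A] I by (intro mult_left_mono rad_contraction) auto
    finally show "rad I (\<lambda>m. (1 / c) *\<^sub>R \<Phi> m A *\<^sub>R v A m) \<le> 2 / c * rad I (v A)" .
  qed
  also have "\<dots> = 2 / c * (\<Sum>A\<in>Pow K. rad I (v A))"
    by (simp add: sum_distrib_left)
  also have "\<dots> \<le> 2 / c * (c * rad K x)"
  proof (rule mult_left_mono, rule power2_le_imp_le)
    show "(\<Sum>A\<in>Pow K. rad I (v A))\<^sup>2 \<le> (c * rad K x)\<^sup>2"
      using mean_power2_ge[of "Pow K" "\<lambda>A. rad I (v A)"] K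
      unfolding total by (simp add: card_Pow c_def power_mult_distrib power2_eq_square[of "2 ^ card K"] mult.assoc)
  qed (use c in simp_all)
  finally show ?thesis
    using c by (simp add: fib_def)
qed

section \<open>Kernels of Hilbert type on Rademacher sums\<close>

lemma sum_powr_le:
  fixes \<eta> :: real
  assumes "0 < \<eta>" "\<eta> \<le> 1"
  shows "(\<Sum>i=1..n. real i powr (\<eta> - 1)) \<le> real n powr \<eta> / \<eta>"
proof (induction n)
  case (Suc n)
  \<comment> \<open>By the mean value theorem the increment of \<open>t powr \<eta>\<close> from
    \<open>n\<close> to \<open>n + 1\<close> is at least \<eta> times the value of the decreasing
    function \<open>t powr (\<eta> - 1)\<close> at the right end, so the sum telescopes.\<close>
  have "real (Suc n) powr (\<eta> - 1) * \<eta> \<le> real (Suc n) powr \<eta> - real n powr \<eta>"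
  proof (cases "n = 0")
    case False
    have "\<exists>z>real n. z < real (Suc n) \<and>
        real (Suc n) powr \<eta> - real n powr \<eta> = (real (Suc n) - real n) * (\<eta> * z powr (\<eta> - 1))"
      using False by (intro MVT2) (auto intro!: has_real_derivative_powr)
    then obtain z where z: "real n < z" "z < real (Suc n)"
      "real (Suc n) powr \<eta> - real n powr \<eta> = \<eta> * z powr (\<eta> - 1)"
      by auto
    have "real (Suc n) powr (\<eta> - 1) \<le> z powr (\<eta> - 1)"
      using z False assms by (intro powr_mono2') auto
    then show ?thesis
      using z(3) assms by (simp add: mult.commute)
  qed (use assms in simp)
  then have "real (Suc n) powr (\<eta> - 1) \<le> (real (Suc n) powr \<eta> - real n powr \<eta>) / \<eta>"
    using assms by (simp add: pos_le_divide_eq)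
  with Suc show ?case
    by (simp add: diff_divide_distrib)
qed simp

lemma card_nats_in_interval_le:
  fixes p q :: real
  assumes "0 \<le> p" "p \<le> q" "S \<subseteq> {k. p < real k \<and> real k \<le> q}"
  shows "real (card S) \<le> q - p + 1"
proof -
  have "S \<subseteq> {nat \<lfloor>p\<rfloor><..nat \<lfloor>q\<rfloor>}"
  proof
    fix k assume "k \<in> S"
    then have "p < real k" "real k \<le> q"
      using assms(3) by auto
    then show "k \<in> {nat \<lfloor>p\<rfloor><..nat \<lfloor>q\<rfloor>}"
      using assms(1) by (auto simp: le_nat_floor nat_less_iff floor_less_iff)
  qed
  then have "card S \<le> nat \<lfloor>q\<rfloor> - nat \<lfloor>p\<rfloor>"
    using card_mono[of "{nat \<lfloor>p\<rfloor><..nat \<lfloor>q\<rfloor>}"] by simp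
  moreover have "real (nat \<lfloor>q\<rfloor>) \<le> q" "p - 1 < real (nat \<lfloor>p\<rfloor>)"
    using assms by linarith+
  ultimately show ?thesis
    using assms(2) by linarith
qed

text \<open>With \<open>q = D div k\<close> the condition says that \<open>i / q\<close> lies in the
  half-open interval from \<open>m - 1\<close> to \<open>m\<close>, that is, \<open>i\<close> is one
  of \<open>q\<close> consecutive integers. The bound \<open>m \<le> k\<close> keeps all of them
  below \<open>D\<close>.\<close>

lemma card_ceiling_fiber:
  fixes D k m :: nat
  assumes "0 < D" "k dvd D" "1 \<le> m" "m \<le> k"
  shows "card {i \<in> {1..D}. nat \<lceil>real (i * k) / real D\<rceil> = m} = D div k"
proof -
  define q where "q = D div k"
  have D: "D = q * k" and q: "q > 0" and k: "k > 0"
    using assms by (auto simp: q_def dvd_div_eq_0_iff)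
  have iff: "nat \<lceil>real (i * k) / real D\<rceil> = m \<longleftrightarrow> (m - 1) * q < i \<and> i \<le> m * q" for i
  proof -
    have "real (i * k) / real D = real i / real q"
      using k by (simp add: D)
    then have "nat \<lceil>real (i * k) / real D\<rceil> = m \<longleftrightarrow> \<lceil>real i / real q\<rceil> = int m"
      using assms(3) by auto
    also have "\<lceil>real i / real q\<rceil> = int m \<longleftrightarrow> real m - 1 < real i / real q \<and> real i / real q \<le> real m"
      by (simp add: ceiling_eq_iff)
    also have "\<dots> \<longleftrightarrow> (real m - 1) * real q < real i \<and> real i \<le> real m * real q"
      using q by (simp add: pos_less_divide_eq pos_divide_le_eq)
    also have "(real m - 1) * real q = real ((m - 1) * q)"
      using assms(3) by (simp add: of_nat_diff)
    also have "real m * real q = real (m * q)"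
      by simp
    finally show ?thesis
      by (simp only: of_nat_less_iff of_nat_le_iff)
  qed
  have "m * q \<le> D"
    using assms(4) by (simp add: D mult.commute)
  then have "{i \<in> {1..D}. nat \<lceil>real (i * k) / real D\<rceil> = m} = {(m - 1) * q<..m * q}"
    unfolding iff by auto
  moreover have "m * q - (m - 1) * q = q"
    using assms(3) by (cases m) auto
  ultimately show ?thesis
    by (simp add: q_def)
qed

text \<open>Hilbert type kernels of size \<open>m\<^sup>a k\<^sup>-\<^sup>a\<^sup>-\<^sup>1\<close> on \<open>m \<le> k\<close>. For \<open>D\<close> divisible by \<open>k\<close>, the
  fraction of those \<open>i \<le> D\<close> with \<open>\<lceil>i k / D\<rceil> = m\<close> is \<open>1/k\<close>; this writes the kernel as an average over \<open>i\<close>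
  of operators that collect each \<open>x\<^sub>k\<close> in the single row \<open>m = \<lceil>i k / D\<rceil>\<close>.\<close>

lemma rad_kernel_le:
  fixes \<tau> :: "nat \<Rightarrow> nat \<Rightarrow> complex" and x :: "nat \<Rightarrow> 'a::complex_normed_vector"
  assumes a: "- 1 / 2 < a" "a \<le> 0" and B: "0 \<le> B"
    and \<tau>: "\<And>m k. 1 \<le> m \<Longrightarrow> m \<le> k \<Longrightarrow> cmod (\<tau> m k) \<le> B * (real m powr a * real k powr (- a - 1))"
  shows "rad {1..n} (\<lambda>m. \<Sum>k=m..K. \<tau> m k *\<^sub>C x k) \<le> 8 * B / (a + 1 / 2) * rad {1..K} x"
proof -
  \<comment> \<open>Any common multiple of all \<open>k \<le> K\<close> would do; the final constant
    does not depend on \<open>D\<close>.\<close>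
  define D :: nat where "D = fact K"
  have D: "D > 0" and dvd: "k dvd D" if "k \<in> {1..K}" for k
    using that by (auto simp: D_def dvd_fact)
  have D0: "D > 0"
    by (simp add: D_def)
  define \<eta> where "\<eta> = a + 1 / 2"
  have \<eta>: "0 < \<eta>" "\<eta> \<le> 1"
    using a by (auto simp: \<eta>_def)
  define \<pi> where "\<pi> i k = nat \<lceil>real (i * k) / real D\<rceil>" for i k
  \<comment> \<open>Large enough to contain both the rows wanted, up to \<open>n\<close>, and all
    rows \<open>\<pi> i k \<le> K\<close> that occur.\<close>
  define N where "N = n + K"
  have \<pi>_le: "\<pi> i k \<le> k" if "i \<le> D" for i k
  proof -
    have "real (i * k) / real D \<le> real k"
      using that D0 by (simp add: divide_le_eq mult_mono mult.commute)
    then show ?thesis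
      unfolding \<pi>_def by (simp add: ceiling_le_iff nat_le_iff)
  qed
  have \<pi>_ge: "real (i * k) / real D \<le> real (\<pi> i k)" for i k
    unfolding \<pi>_def by linarith
  have \<pi>_pos: "1 \<le> \<pi> i k" if "1 \<le> i" "1 \<le> k" for i k
  proof -
    have "0 < real (i * k) / real D"
      using that D0 by simp
    then show ?thesis
      using \<pi>_ge[of i k] by linarith
  qed
  \<comment> \<open>The weight \<open>k / D\<close> cancels the number \<open>D / k\<close> of
    indices \<open>i\<close> that send \<open>k\<close> to a given row
    \<open>m \<le> k\<close>.\<close>
  define y where "y i k = ((real k / real D) *\<^sub>R (\<tau> (\<pi> i k) k *\<^sub>C x k))" for i k
  have split: "(\<Sum>k=m..K. \<tau> m k *\<^sub>C x k) = (\<Sum>i=1..D. \<Sum>k | k \<in> {1..K} \<and> \<pi> i k = m. y i k)"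
    if "1 \<le> m" for m
  proof -
    have "(\<Sum>i=1..D. \<Sum>k | k \<in> {1..K} \<and> \<pi> i k = m. y i k)
        = (\<Sum>i=1..D. \<Sum>k=1..K. if \<pi> i k = m then (real k / real D) *\<^sub>R (\<tau> m k *\<^sub>C x k) else 0)"
      unfolding sum.inter_filter[OF finite_atLeastAtMost] by (intro sum.cong refl) (simp add: y_def)
    also have "\<dots> = (\<Sum>k=1..K. \<Sum>i=1..D. if \<pi> i k = m then (real k / real D) *\<^sub>R (\<tau> m k *\<^sub>C x k) else 0)"
      by (rule sum.swap)
    also have "\<dots> = (\<Sum>k=1..K. real (card {i \<in> {1..D}. \<pi> i k = m}) *\<^sub>R (real k / real D) *\<^sub>R (\<tau> m k *\<^sub>C x k))"
      by (intro sum.cong refl) (simp add: sum.If_cases Int_def conj_commute sum_constant_scaleR)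
    also have "\<dots> = (\<Sum>k=1..K. if m \<le> k then \<tau> m k *\<^sub>C x k else 0)"
    proof (intro sum.cong refl)
      fix k assume k: "k \<in> {1..K}"
      show "real (card {i \<in> {1..D}. \<pi> i k = m}) *\<^sub>R (real k / real D) *\<^sub>R (\<tau> m k *\<^sub>C x k)
          = (if m \<le> k then \<tau> m k *\<^sub>C x k else 0)"
      proof (cases "m \<le> k")
        case True
        have "card {i \<in> {1..D}. \<pi> i k = m} = D div k"
          unfolding \<pi>_def using card_ceiling_fiber[OF D0 dvd[OF k] that True] .
        moreover have "real (D div k) * (real k / real D) = 1"
          using dvd[OF k] k D0 by (simp add: real_of_nat_div)
        ultimately show ?thesis
          using True by (simp only: scaleR_scaleR if_True scaleR_one)
      next
        case False
        then have "{i \<in> {1..D}. \<pi> i k = m} = {}"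
          using \<pi>_le[of _ k] by fastforce
        then show ?thesis
          using False by simp
      qed
    qed
    also have "\<dots> = (\<Sum>k=m..K. \<tau> m k *\<^sub>C x k)"
      using that by (subst sum.inter_filter[symmetric]) (auto intro!: sum.cong)
    finally show ?thesis
      by (rule sym)
  qed
  have single: "rad {1..N} (\<lambda>m. \<Sum>k | k \<in> {1..K} \<and> \<pi> i k = m. y i k)
      \<le> 8 * B * (real i powr (\<eta> - 1) / real D powr \<eta>) * rad {1..K} x" if i: "i \<in> {1..D}" for i
  proof -
    \<comment> \<open>A fibre of \<open>\<pi> i\<close> has at most
      \<open>D / i + 1 \<le> 2 * D / i\<close> elements, so with this constant the squares over a
      fibre sum to at most 1.\<close>
    define \<theta> where "\<theta> = sqrt (real i / (2 * real D))"
    have \<theta>: "\<theta> > 0" "\<theta>\<^sup>2 = real i / (2 * real D)"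
      using i D0 by (auto simp: \<theta>_def)
    \<comment> \<open>A bound for the coefficient of \<open>x k\<close> in \<open>y i k\<close>:
      since \<open>a \<le> 0\<close> and \<open>\<pi> i k \<ge> i k / D\<close>, the row index may
      be replaced by \<open>i k / D\<close>, after which all powers of \<open>k\<close>
      cancel.\<close>
    define \<rho> where "\<rho> = B * (real i / real D) powr a / real D"
    have \<rho>: "\<rho> \<ge> 0"
      using B by (simp add: \<rho>_def)
    define z where "z k = (1 / \<theta>) *\<^sub>R y i k" for k
    have fiber: "(\<Sum>k | k \<in> {1..K} \<and> \<pi> i k = m. \<theta>\<^sup>2) \<le> 1" for m
    proof -
      have sub: "{k. k \<in> {1..K} \<and> \<pi> i k = m} \<subseteq> {k. (real m - 1) * (real D / real i) < real k \<and> real k \<le> real m * (real D / real i)} "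
      proof safe
        fix k assume k: "k \<in> {1..K}" "m = \<pi> i k"
        have "- 1 < real (i * k) / real D"
          by (rule less_le_trans[of _ 0]) simp_all
        then have "\<lceil>real (i * k) / real D\<rceil> = int (\<pi> i k)"
          unfolding \<pi>_def by (simp only: zero_le_ceiling int_nat_eq if_True)
        then have "real (\<pi> i k) - 1 < real (i * k) / real D" "real (i * k) / real D \<le> real (\<pi> i k)"
          by (simp_all add: ceiling_eq_iff)
        then show "(real (\<pi> i k) - 1) * (real D / real i) < real k"
          "real k \<le> real (\<pi> i k) * (real D / real i)"
          using i D0 by (simp_all add: field_simps)
      qed
      have "card {k. k \<in> {1..K} \<and> \<pi> i k = m} \<le> real D / real i + 1"
      proof (cases "m = 0")
        case True
        then have "{k. k \<in> {1..K} \<and> \<pi> i k = m} = {}"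
          using \<pi>_pos[of i] i by fastforce
        then show ?thesis
          by (simp only: card.empty of_nat_0) simp
      next
        case False
        then have nn: "0 \<le> (real m - 1) * (real D / real i)"
          by simp
        have "p * d - (p - 1) * d = d" for p d :: real
          by (simp add: left_diff_distrib)
        from this[of "real m" "real D / real i"]
        have "real m * (real D / real i) - (real m - 1) * (real D / real i) = real D / real i" .
        moreover have "(real m - 1) * (real D / real i) \<le> real m * (real D / real i)"
          by (rule mult_right_mono) simp_all
        ultimately show ?thesis
          using card_nats_in_interval_le[OF nn _ sub] by simp
      qed
      also have "\<dots> \<le> 2 * real D / real i"
        using i D0 by (simp add: field_simps)
      finally show ?thesis
        using i D0 by (simp add: \<theta>(2) field_simps)
    qed
    have "rad {1..N} (\<lambda>m. \<Sum>k | k \<in> {1..K} \<and> \<pi> i k = m. y i k)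
        = rad {1..N} (\<lambda>m. \<Sum>k | k \<in> {1..K} \<and> \<pi> i k = m. \<theta> *\<^sub>R z k)"
      using \<theta> by (simp add: z_def)
    also have "\<dots> \<le> 2 * rad {1..K} z"
    proof (rule rad_fiber_sum)
      show "\<pi> i ` {1..K} \<subseteq> {1..N}"
      proof
        fix m assume "m \<in> \<pi> i ` {1..K}"
        then obtain k where "k \<in> {1..K}" "m = \<pi> i k"
          by blast
        then show "m \<in> {1..N}"
          using \<pi>_pos[of i k] \<pi>_le[of i k] i by (simp add: N_def)
      qed
    qed (use fiber in auto)
    also have "\<dots> = 2 * (1 / \<theta> * rad {1..K} (y i))"
      unfolding z_def rad_scaleR using \<theta> by simp
    finally have outer: "rad {1..N} (\<lambda>m. \<Sum>k | k \<in> {1..K} \<and> \<pi> i k = m. y i k)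
        \<le> 2 * (1 / \<theta> * rad {1..K} (y i))" .
    have inner: "rad {1..K} (y i) \<le> \<rho> * (2 * rad {1..K} x)"
    proof -
      define c where "c k = (real k / real D) * \<tau> (\<pi> i k) k" for k
      have yc: "y i k = c k *\<^sub>C x k" for k
        by (simp add: y_def c_def scaleR_scaleC scaleC_scaleC)
      have le: "cmod (c k) \<le> \<rho>" if k: "k \<in> {1..K}" for k
      proof -
        have "cmod (c k) = real k / real D * cmod (\<tau> (\<pi> i k) k)"
          by (simp add: c_def norm_mult norm_divide)
        also have "\<dots> \<le> real k / real D * (B * (real (\<pi> i k) powr a * real k powr (- a - 1)))"
          using i k by (intro mult_left_mono \<tau> \<pi>_pos \<pi>_le) auto
        also have "\<dots> \<le> real k / real D * (B * ((real (i * k) / real D) powr a * real k powr (- a - 1)))"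
          using i k a B D0 \<pi>_ge by (intro mult_left_mono mult_right_mono powr_mono2') auto
        also have "real (i * k) / real D = (real i / real D) * real k"
          by simp
        also have "(real i / real D * real k) powr a = (real i / real D) powr a * real k powr a"
          by (rule powr_mult)
        also have "(real i / real D) powr a * real k powr a * real k powr (- a - 1)
            = (real i / real D) powr a * real k powr - 1"
          by (simp add: mult.assoc flip: powr_add)
        also have "real k powr - 1 = 1 / real k"
          using k by (simp add: powr_minus_divide)
        also have "real k / real D * (B * ((real i / real D) powr a * (1 / real k))) = \<rho>"
          using k by (simp add: \<rho>_def)
        finally show ?thesis .
      qed
      show ?thesis
      proof (cases "\<rho> = 0")
        case True
        have "norm (y i k) = 0" if "k \<in> {1..K}" for k
          using le[OF that] True by (simp add: yc norm_scaleC)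
        then have "rad {1..K} (y i) = rad {1..K} (\<lambda>k. 0 :: 'a)"
          by (intro rad_cong) simp
        with True show ?thesis
          by simp
      next
        case False
        with \<rho> have pos: "\<rho> > 0"
          by simp
        have "rad {1..K} (y i) = rad {1..K} (\<lambda>k. \<rho> *\<^sub>R ((c k / \<rho>) *\<^sub>C x k))"
          using False by (intro rad_cong) (simp add: yc scaleR_scaleC scaleC_scaleC)
        also have "\<dots> = \<rho> * rad {1..K} (\<lambda>k. (c k / \<rho>) *\<^sub>C x k)"
          using pos by (simp add: rad_scaleR)
        also have "\<dots> \<le> \<rho> * (2 * rad {1..K} x)"
          using pos le by (intro mult_left_mono rad_contraction_complex) (auto simp: norm_divide)
        finally show ?thesis .
      qed
    qed
    note outer
    also have "2 * (1 / \<theta> * rad {1..K} (y i)) \<le> 2 * (1 / \<theta> * (\<rho> * (2 * rad {1..K} x)))"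
      using inner \<theta> by (intro mult_left_mono) auto
    also have "\<dots> = 4 * (\<rho> / \<theta>) * rad {1..K} x"
      by simp
    also have "\<dots> \<le> 8 * B * (real i powr (\<eta> - 1) / real D powr \<eta>) * rad {1..K} x"
    proof (rule mult_right_mono)
      have "\<rho> / \<theta> = sqrt 2 * (B * ((real i / real D) powr a / sqrt (real i / real D) / real D))"
        by (simp add: \<rho>_def \<theta>_def real_sqrt_divide real_sqrt_mult mult_ac)
      also have "(real i / real D) powr a / sqrt (real i / real D) = (real i / real D) powr (\<eta> - 1)"
        by (simp add: \<eta>_def flip: powr_half_sqrt powr_diff)
      also have "(real i / real D) powr (\<eta> - 1) / real D = real i powr (\<eta> - 1) / real D powr \<eta>"
        using D0 by (simp add: powr_divide powr_diff)
      also have "sqrt 2 * (B * (real i powr (\<eta> - 1) / real D powr \<eta>)) \<le> 2 * (B * (real i powr (\<eta> - 1) / real D powr \<eta>))"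
        using B sqrt2_less_2 by (intro mult_right_mono) auto
      finally show "4 * (\<rho> / \<theta>) \<le> 8 * B * (real i powr (\<eta> - 1) / real D powr \<eta>)"
        by simp
    qed simp
    finally show ?thesis .
  qed
  have "rad {1..n} (\<lambda>m. \<Sum>k=m..K. \<tau> m k *\<^sub>C x k) \<le> rad {1..N} (\<lambda>m. \<Sum>k=m..K. \<tau> m k *\<^sub>C x k)"
    by (rule rad_mono) (auto simp: N_def)
  also have "\<dots> = rad {1..N} (\<lambda>m. \<Sum>i=1..D. \<Sum>k | k \<in> {1..K} \<and> \<pi> i k = m. y i k)"
    by (rule rad_cong, subst split) auto
  also have "\<dots> \<le> (\<Sum>i=1..D. rad {1..N} (\<lambda>m. \<Sum>k | k \<in> {1..K} \<and> \<pi> i k = m. y i k))"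
    by (rule rad_sum)
  also have "\<dots> \<le> (\<Sum>i=1..D. 8 * B * (real i powr (\<eta> - 1) / real D powr \<eta>) * rad {1..K} x)"
    by (rule sum_mono) (rule single)
  also have "\<dots> = 8 * B * ((\<Sum>i=1..D. real i powr (\<eta> - 1)) / real D powr \<eta>) * rad {1..K} x"
    by (simp add: sum_distrib_left sum_distrib_right sum_divide_distrib)
  also have "\<dots> \<le> 8 * B * (1 / \<eta>) * rad {1..K} x"
  \<comment> \<open>Divided by \<open>D powr \<eta>\<close>, the sum is a Riemann sum for the
    integral of \<open>t powr (\<eta> - 1)\<close> over the unit interval; its finiteness is what
    \<open>a > - 1 / 2\<close> provides.\<close>
  proof (intro mult_right_mono mult_left_mono)
    show "(\<Sum>i=1..D. real i powr (\<eta> - 1)) / real D powr \<eta> \<le> 1 / \<eta>"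
      using sum_powr_le[OF \<eta>, of D] D0 by (simp add: divide_le_eq mult.commute)
  qed (use B in auto)
  finally show ?thesis
    by (simp add: \<eta>_def)
qed

section \<open>Rademacher sequences on a probability space\<close>

lemma rad_norm_eq_rad:
  assumes "rademacher_sequence M \<epsilon>"
  shows "rad_norm M \<epsilon> n x = rad {1..n} x"
proof -
  interpret prob_space M
    using assms by (simp add: rademacher_sequence_def)
  have indep: "indep_vars (\<lambda>_. borel) \<epsilon> {1..}"
    and half: "prob {u \<in> space M. \<epsilon> k u = 1} = 1 / 2" "prob {u \<in> space M. \<epsilon> k u = - 1} = 1 / 2" if "k \<ge> 1" for k
    using assms that by (auto simp: rademacher_sequence_def)
  have rv [measurable]: "\<epsilon> k \<in> borel_measurable M" if "k \<ge> 1" for k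
    using indep[OF that] that by (auto simp: indep_vars_def2)
  \<comment> \<open>The event that the first \<open>n\<close> signs follow the pattern
    \<open>A\<close>. These events are disjoint, equally likely and cover almost everything, so the
    integral turns into the finite mean that defines \<open>rad\<close>.\<close>
  define E where "E A = {u \<in> space M. \<forall>k\<in>{1..n}. \<epsilon> k u = sg A k}" for A
  have E_meas: "E A \<in> events" for A
    unfolding E_def by (intro sets.sets_Collect_finite_All) auto
  have prob_sg: "prob {u \<in> space M. \<epsilon> k u = sg A k} = 1 / 2" if "k \<ge> 1" for A k
    using half[OF that] by (simp add: sg_def)
  have prob_E: "prob (E A) = 1 / 2 ^ n" for A
  proof (cases "n = 0")
    case True
    then show ?thesis
      by (simp add: E_def prob_space)
  next
    case False
    have "prob (\<Inter>k\<in>{1..n}. \<epsilon> k -` {sg A k} \<inter> space M) = (\<Prod>k\<in>{1..n}. prob (\<epsilon> k -` {sg A k} \<inter> space M))"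
      using False indep[of 1] by (intro indep_varsD[where I = "{1..}"]) auto
    also have "(\<Inter>k\<in>{1..n}. \<epsilon> k -` {sg A k} \<inter> space M) = E A"
      using False by (auto simp: E_def)
    also have "(\<Prod>k\<in>{1..n}. prob (\<epsilon> k -` {sg A k} \<inter> space M)) = (\<Prod>k\<in>{1..n}. 1 / 2)"
      by (intro prod.cong refl) (simp add: vimage_def Int_def conj_commute prob_sg)
    finally show ?thesis
      by (simp add: power_divide)
  qed
  have AE_E: "AE u in M. \<exists>A\<in>Pow {1..n}. u \<in> E A"
  proof -
    have "AE u in M. \<epsilon> k u = 1 \<or> \<epsilon> k u = - 1" if "k \<in> {1..n}" for k
    proof -
      have k: "k \<ge> 1"
        using that by simp
      note [measurable] = rv[OF k]
      have "prob {u \<in> space M. \<epsilon> k u = 1 \<or> \<epsilon> k u = - 1}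
          = prob {u \<in> space M. \<epsilon> k u = 1} + prob {u \<in> space M. \<epsilon> k u = - 1}"
        by (subst finite_measure_Union[symmetric]) (auto intro!: arg_cong[where f = prob])
      also have "\<dots> = 1"
        using half[OF k] by simp
      finally show ?thesis
        by (subst (asm) prob_Collect_eq_1) auto
    qed
    then have "AE u in M. \<forall>k\<in>{1..n}. \<epsilon> k u = 1 \<or> \<epsilon> k u = - 1"
      by (subst AE_finite_all) auto
    then show ?thesis
      using AE_space
    proof eventually_elim
      case (elim u)
      then have "u \<in> E {k \<in> {1..n}. \<epsilon> k u = 1}"
        by (auto simp: E_def sg_def)
      then show ?case
        by (intro bexI[of _ "{k \<in> {1..n}. \<epsilon> k u = 1}"]) auto
    qed
  qed
  have disj: "A = B" if "A \<in> Pow {1..n}" "B \<in> Pow {1..n}" "u \<in> E A" "u \<in> E B" for A B u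
  proof -
    have "sg A k = sg B k" if "k \<in> {1..n}" for k
      using \<open>u \<in> E A\<close> \<open>u \<in> E B\<close> that by (simp add: E_def)
    then have "k \<in> A \<longleftrightarrow> k \<in> B" if "k \<in> {1..n}" for k
      using that by (force simp: sg_def split: if_splits)
    with that show ?thesis
      by blast
  qed
  define g where "g t = (norm (\<Sum>k=1..n. t k *\<^sub>R x k))\<^sup>2" for t :: "nat \<Rightarrow> real"
  \<comment> \<open>The variable \<open>\<epsilon> 0\<close> is unconstrained and may fail to be
    measurable. The coordinates outside \<open>{1..n}\<close> are therefore replaced by 0 before the
    sequence is treated as one measurable map into the product space.\<close>
  have coordinate: "(\<lambda>u. if k \<in> {1..n} then \<epsilon> k u else 0) \<in> borel_measurable M" for k
  proof (cases "k \<in> {1..n}")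
    case True
    then show ?thesis
      using rv[of k] by simp
  next
    case False
    then have eq: "(\<lambda>u. if k \<in> {1..n} then \<epsilon> k u else 0) = (\<lambda>u. 0)"
      by auto
    show ?thesis
      unfolding eq by simp
  qed
  have "(\<lambda>u. g (\<lambda>k. if k \<in> {1..n} then \<epsilon> k u else 0)) \<in> borel_measurable M"
  proof (rule measurable_compose[where N = borel and g = g
        and f = "\<lambda>u k. if k \<in> {1..n} then \<epsilon> k u else 0"])
    show "(\<lambda>u k. if k \<in> {1..n} then \<epsilon> k u else 0) \<in> borel_measurable M"
      by (rule measurable_coordinatewise_then_product) (rule coordinate)
    show "g \<in> borel_measurable borel"
      unfolding g_def
      by (intro borel_measurable_continuous_onI continuous_intros continuous_on_product_coordinates)
  qed
  moreover have "(\<lambda>u. g (\<lambda>k. if k \<in> {1..n} then \<epsilon> k u else 0)) = (\<lambda>u. g (\<lambda>k. \<epsilon> k u))"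
    unfolding g_def by (intro ext arg_cong[where f = "\<lambda>v. (norm v)\<^sup>2"] sum.cong) simp_all
  ultimately have meas: "(\<lambda>u. g (\<lambda>k. \<epsilon> k u)) \<in> borel_measurable M"
    by simp
  have "(\<integral>u. g (\<lambda>k. \<epsilon> k u) \<partial>M) = (\<integral>u. (\<Sum>A\<in>Pow {1..n}. indicator (E A) u * g (sg A)) \<partial>M)"
  proof (rule integral_cong_AE)
    show "AE u in M. g (\<lambda>k. \<epsilon> k u) = (\<Sum>A\<in>Pow {1..n}. indicator (E A) u * g (sg A))"
      using AE_E
    proof eventually_elim
      case (elim u)
      then obtain A where A: "A \<in> Pow {1..n}" "u \<in> E A"
        by blast
      have "indicator (E B) u * g (sg B) = (if B = A then g (sg A) else 0)" if "B \<in> Pow {1..n}" for B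
      proof (cases "B = A")
        case False
        then have "u \<notin> E B"
          using disj[OF that A(1)] A(2) by blast
        with False show ?thesis
          by simp
      qed (use A(2) in simp)
      then have "(\<Sum>B\<in>Pow {1..n}. indicator (E B) u * g (sg B)) = (\<Sum>B\<in>Pow {1..n}. if B = A then g (sg A) else 0)"
        by (rule sum.cong[OF refl])
      also have "\<dots> = g (sg A)"
        using A by simp
      also have "g (sg A) = g (\<lambda>k. \<epsilon> k u)"
        unfolding g_def using A(2)
        by (intro arg_cong[where f = "\<lambda>v. (norm v)\<^sup>2"] sum.cong) (simp_all add: E_def)
      finally show ?case
        by (rule sym)
    qed
  qed (rule meas, intro borel_measurable_sum borel_measurable_times borel_measurable_const borel_measurable_indicator E_meas)
  also have "\<dots> = (\<Sum>A\<in>Pow {1..n}. prob (E A) * g (sg A))"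
  proof (subst Bochner_Integration.integral_sum)
    show "integrable M (\<lambda>u. indicator (E A) u * g (sg A))" for A
      using E_meas by (intro integrable_mult_left integrable_real_indicator) (auto simp: emeasure_eq_measure)
    show "(\<Sum>A\<in>Pow {1..n}. \<integral>u. indicator (E A) u * g (sg A) \<partial>M) = (\<Sum>A\<in>Pow {1..n}. prob (E A) * g (sg A))"
      using E_meas by (intro sum.cong) auto
  qed
  also have "\<dots> = (rad {1..n} x)\<^sup>2"
    by (simp add: rad_square prob_E g_def sum_divide_distrib)
  finally show ?thesis
    by (simp add: rad_norm_def g_def)
qed

section \<open>The algebra of bounded complex-linear operators\<close>

lemma bounded_clinear_ops_iff: "T \<in> bounded_clinear_ops \<longleftrightarrow> (\<forall>c x. T (c *\<^sub>C x) = c *\<^sub>C T x)"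
  by (simp add: bounded_clinear_ops_def)

lemma scaleC_blinfun_apply [simp]: "blinfun_apply (c *\<^sub>C T) x = c *\<^sub>C blinfun_apply T x"
  by (simp add: scaleC_blinfun.rep_eq)

lemma scaleC_minus_right: "c *\<^sub>C (- x) = - (c *\<^sub>C x :: 'a::complex_normed_vector)"
  using linear_neg[OF bounded_linear.linear[OF bounded_linear_scaleC[of c]]] .

lemma scaleC_diff_right: "c *\<^sub>C (x - y) = c *\<^sub>C x - (c *\<^sub>C y :: 'a::complex_normed_vector)"
  using linear_diff[OF bounded_linear.linear[OF bounded_linear_scaleC[of c]]] .

lemma scaleC_scaleR_commute: "c *\<^sub>C r *\<^sub>R x = r *\<^sub>R (c *\<^sub>C x :: 'a::complex_normed_vector)"
  using linear_scale[OF bounded_linear.linear[OF bounded_linear_scaleC[of c]]] .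

lemma scaleC_zero_right [simp]: "c *\<^sub>C 0 = (0 :: 'a::complex_normed_vector)"
  using linear_0[OF bounded_linear.linear[OF bounded_linear_scaleC[of c]]] .

lemma scaleC_sum_right: "c *\<^sub>C (\<Sum>i\<in>I. x i) = (\<Sum>i\<in>I. c *\<^sub>C (x i :: 'a::complex_normed_vector))"
  using linear_sum[OF bounded_linear.linear[OF bounded_linear_scaleC[of c]]] .

lemma scaleC_one [simp]: "1 *\<^sub>C x = (x :: 'a::complex_normed_vector)"
  using scaleR_scaleC[of 1 x] by simp

lemma scaleC_zero_left [simp]: "0 *\<^sub>C x = (0 :: 'a::complex_normed_vector)"
  using scaleR_scaleC[of 0 x] by simp

lemma bounded_linear_scaleC_left: "bounded_linear (\<lambda>c. c *\<^sub>C (x :: 'a::complex_normed_vector))"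
  by (rule bounded_linear_intro[where K = "norm x"])
    (simp_all add: scaleC_add_left norm_scaleC scaleR_conv_of_real flip: scaleC_scaleC scaleR_scaleC)

lemma scaleC_minus_left: "(- c) *\<^sub>C x = - (c *\<^sub>C x :: 'a::complex_normed_vector)"
  using linear_neg[OF bounded_linear.linear[OF bounded_linear_scaleC_left[of x]]] .

lemma scaleC_diff_left: "(c - d) *\<^sub>C x = c *\<^sub>C x - d *\<^sub>C (x :: 'a::complex_normed_vector)"
  using linear_diff[OF bounded_linear.linear[OF bounded_linear_scaleC_left[of x]]] .

lemma scaleC_sum_left: "(\<Sum>i\<in>I. c i) *\<^sub>C x = (\<Sum>i\<in>I. c i *\<^sub>C (x :: 'a::complex_normed_vector))"
  using linear_sum[OF bounded_linear.linear[OF bounded_linear_scaleC_left[of x]]] .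

text \<open>As a type of their own the complex-linear operators form a Banach algebra, so powers,
  series and Cauchy products apply to them. The norm of 1 is only known to be at most 1, because the
  space may be trivial.\<close>

typedef (overloaded) 'a cop = "bounded_clinear_ops :: ('a::complex_normed_vector \<Rightarrow>\<^sub>L 'a) set"
  morphisms op_of cop_of
  by (rule exI[of _ 0]) (simp add: bounded_clinear_ops_iff)

abbreviation app :: "'a::complex_normed_vector cop \<Rightarrow> 'a \<Rightarrow> 'a" (infixr "\<star>" 75)
  where "S \<star> x \<equiv> blinfun_apply (op_of S) x"

lemma app_scaleC: "S \<star> (c *\<^sub>C x) = c *\<^sub>C (S \<star> x)"
  using op_of[of S] by (simp add: bounded_clinear_ops_iff)

instantiation cop :: (complex_normed_vector) "{real_normed_algebra, monoid_mult, complex_normed_vector}"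
begin

definition "0 = cop_of 0"
definition "1 = cop_of id_blinfun"
definition "S + T = cop_of (op_of S + op_of T)"
definition "S - T = cop_of (op_of S - op_of T)"
definition "- S = cop_of (- op_of S)"
definition "S * T = cop_of (op_of S o\<^sub>L op_of T)"
definition "r *\<^sub>R S = cop_of (r *\<^sub>R op_of S)"
definition "c *\<^sub>C S = cop_of (c *\<^sub>C op_of S)"
definition "norm S = norm (op_of S)" for S :: "'a cop"
definition "dist S T = norm (S - T)" for S T :: "'a cop"
definition "sgn S = inverse (norm S) *\<^sub>R S" for S :: "'a cop"
definition uniformity_cop_def [code del]:
  "(uniformity :: ('a cop \<times> 'a cop) filter) = (INF e\<in>{0<..}. principal {(x, y). dist x y < e})"
definition open_cop_def [code del]:
  "open (U :: 'a cop set) \<longleftrightarrow> (\<forall>x\<in>U. eventually (\<lambda>(x', y). x' = x \<longrightarrow> y \<in> U) uniformity)"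

lemma op_of_simps [simp]:
  "op_of 0 = (0 :: 'a \<Rightarrow>\<^sub>L 'a)"
  "op_of 1 = (id_blinfun :: 'a \<Rightarrow>\<^sub>L 'a)"
  "op_of (S + T) = op_of S + op_of T"
  "op_of (S - T) = op_of S - op_of T"
  "op_of (- S) = - op_of S"
  "op_of (S * T) = op_of S o\<^sub>L op_of T"
  "op_of (r *\<^sub>R S) = r *\<^sub>R op_of S"
  "op_of (c *\<^sub>C S) = c *\<^sub>C op_of S"
  for S T :: "'a cop"
  unfolding zero_cop_def one_cop_def plus_cop_def minus_cop_def uminus_cop_def times_cop_def
    scaleR_cop_def scaleC_cop_def
  by (subst cop_of_inverse;
      simp add: bounded_clinear_ops_iff app_scaleC scaleC_add_right scaleC_diff_right scaleC_minus_right
        blinfun.bilinear_simps scaleC_scaleR_commute scaleC_scaleC mult.commute)+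

instance
  by standard
    (simp_all add: op_of_inject[symmetric] blinfun_eqI norm_cop_def norm_triangle_ineq norm_blinfun_compose
      scaleC_add_right scaleC_add_left scaleC_scaleC norm_scaleC
      dist_cop_def sgn_cop_def uniformity_cop_def open_cop_def blinfun.bilinear_simps scaleR_add_right
      scaleR_add_left flip: scaleR_scaleC)

end

lemma cop_eqI: "(\<And>x. S \<star> x = T \<star> x) \<Longrightarrow> S = T"
  by (simp add: op_of_inject[symmetric] blinfun_eqI)

lemma norm_app_le: "norm (S \<star> x) \<le> norm S * norm x"
  unfolding norm_cop_def by (rule norm_blinfun)

lemma bounded_linear_op_of: "bounded_linear op_of"
  by (rule bounded_linear_intro[where K = 1]) (simp_all add: norm_cop_def)

lemma bounded_linear_app_left: "bounded_linear (\<lambda>S. S \<star> x)"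
  by (rule bounded_linear_intro[where K = "norm x"])
    (simp_all add: blinfun.bilinear_simps norm_app_le)

lemmas tendsto_app_left = bounded_linear.tendsto[OF bounded_linear_app_left]

instance cop :: ("{complex_normed_vector, banach}") banach
proof
  fix X :: "nat \<Rightarrow> 'a cop"
  assume "Cauchy X"
  then have "Cauchy (\<lambda>n. op_of (X n))"
    by (rule bounded_linear.Cauchy[OF bounded_linear_op_of])
  then obtain L where L: "(\<lambda>n. op_of (X n)) \<longlonglongrightarrow> L"
    using Cauchy_convergent convergent_def by blast
  have "L (c *\<^sub>C x) = c *\<^sub>C L x" for c x
  proof (rule LIMSEQ_unique)
    show "(\<lambda>n. X n \<star> (c *\<^sub>C x)) \<longlonglongrightarrow> L (c *\<^sub>C x)"
      by (intro tendsto_intros L)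
    show "(\<lambda>n. X n \<star> (c *\<^sub>C x)) \<longlonglongrightarrow> c *\<^sub>C L x"
      unfolding app_scaleC by (intro bounded_linear.tendsto[OF bounded_linear_scaleC] tendsto_intros L)
  qed
  then have "op_of (cop_of L) = L"
    by (simp add: cop_of_inverse bounded_clinear_ops_iff)
  with L have "X \<longlonglongrightarrow> cop_of L"
    by (simp add: tendsto_iff dist_norm norm_cop_def)
  then show "convergent X"
    by (auto simp: convergent_def)
qed

lemma scaleC_mult_left: "(c *\<^sub>C S) * T = c *\<^sub>C (S * T :: 'a::complex_normed_vector cop)"
  by (rule cop_eqI) simp

lemma scaleC_mult_right: "S * (c *\<^sub>C T) = c *\<^sub>C (S * T :: 'a::complex_normed_vector cop)"
  by (rule cop_eqI) (simp add: app_scaleC)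

lemma norm_one_cop_le: "norm (1 :: 'a::complex_normed_vector cop) \<le> 1"
  unfolding norm_cop_def by (simp add: norm_blinfun_id_le)

lemma norm_power_cop_le: "norm (S ^ n) \<le> norm (S :: 'a::complex_normed_vector cop) ^ n"
proof (induction n)
  case (Suc n)
  then show ?case
    using norm_mult_ineq[of S "S ^ n"] mult_left_mono[OF Suc norm_ge_zero[of S]] by simp
qed (simp add: norm_one_cop_le)

lemma scaleC_power: "(c *\<^sub>C S) ^ n = c ^ n *\<^sub>C (S ^ n :: 'a::complex_normed_vector cop)"
  by (induction n) (simp_all add: scaleC_mult_left scaleC_mult_right scaleC_scaleC mult_ac)

lemma app_sum_left: "(\<Sum>i\<in>I. S i) \<star> x = (\<Sum>i\<in>I. S i \<star> x)"
  using linear_sum[OF bounded_linear.linear[OF bounded_linear_app_left]] .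

lemma op_of_power: "op_of (S ^ n) = op_power (op_of S) n"
  by (induction n) (simp_all add: op_power_def)


section \<open>R-bounded sets\<close>

text \<open>R-boundedness with its constant exposed and with arbitrary finite index sets, so that
  index sets may be split or restricted inside a proof.\<close>

definition Rbd :: "real \<Rightarrow> 'a::complex_normed_vector cop set \<Rightarrow> bool"
  where "Rbd C F \<longleftrightarrow> 0 \<le> C \<and> (\<forall>(I :: nat set) S x. finite I \<longrightarrow> (\<forall>i\<in>I. S i \<in> F) \<longrightarrow>
    rad I (\<lambda>i. S i \<star> x i) \<le> C * rad I x)"

lemma RbdI:
  assumes "0 \<le> C"
    and "\<And>(I :: nat set) S x. finite I \<Longrightarrow> (\<And>i. i \<in> I \<Longrightarrow> S i \<in> F) \<Longrightarrow> rad I (\<lambda>i. S i \<star> x i) \<le> C * rad I x"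
  shows "Rbd C F"
  using assms unfolding Rbd_def by blast

lemma RbdD:
  fixes I :: "nat set"
  assumes "Rbd C F" "finite I" "\<And>i. i \<in> I \<Longrightarrow> S i \<in> F"
  shows "rad I (\<lambda>i. S i \<star> x i) \<le> C * rad I x"
  using assms unfolding Rbd_def by blast

lemma Rbd_nonneg: "Rbd C F \<Longrightarrow> 0 \<le> C"
  by (simp add: Rbd_def)

lemma Rbd_mono:
  assumes "Rbd C F" "C \<le> D" "G \<subseteq> F"
  shows "Rbd D G"
proof (rule RbdI)
  show "0 \<le> D"
    using assms Rbd_nonneg by force
  fix I :: "nat set" and S x
  assume "finite I" "\<And>i. i \<in> I \<Longrightarrow> S i \<in> G"
  then have "rad I (\<lambda>i. S i \<star> x i) \<le> C * rad I x"
    using assms by (intro RbdD) auto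
  also have "\<dots> \<le> D * rad I x"
    using assms by (intro mult_right_mono) auto
  finally show "rad I (\<lambda>i. S i \<star> x i) \<le> D * rad I x" .
qed

lemma R_bounded_imp_Rbd:
  fixes F :: "'a::complex_normed_vector cop set"
  assumes "rademacher_sequence M \<epsilon>" "R_bounded M \<epsilon> (op_of ` F)"
  shows "\<exists>C. Rbd C F"
proof -
  obtain C where C: "C > 0" "\<And>n (T :: nat \<Rightarrow> 'a \<Rightarrow>\<^sub>L 'a) x. (\<forall>k\<in>{1..n}. T k \<in> op_of ` F) \<Longrightarrow>
       rad {1..n} (\<lambda>k. T k (x k)) \<le> C * rad {1..n} x"
    using assms(2) unfolding R_bounded_def rad_norm_eq_rad[OF assms(1)] by blast
  have "Rbd C F"
  proof (rule RbdI)
    fix I :: "nat set" and S :: "nat \<Rightarrow> 'a cop" and x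
    assume I: "finite I" "\<And>i. i \<in> I \<Longrightarrow> S i \<in> F"
    obtain f where f: "bij_betw f {1..card I} I"
      using ex_bij_betw_nat_finite_1[OF I(1)] by blast
    then have inj: "inj_on f {1..card I}" and im: "f ` {1..card I} = I"
      by (auto simp: bij_betw_def)
    have "rad I (\<lambda>i. S i \<star> x i) = rad {1..card I} (\<lambda>k. S (f k) \<star> x (f k))"
      using rad_reindex[OF inj, of "\<lambda>i. S i \<star> x i"] im by simp
    also have "\<dots> \<le> C * rad {1..card I} (\<lambda>k. x (f k))"
      using I(2) im by (intro C(2)) blast
    also have "rad {1..card I} (\<lambda>k. x (f k)) = rad I x"
      using rad_reindex[OF inj, of x] im by simp
    finally show "rad I (\<lambda>i. S i \<star> x i) \<le> C * rad I x" .
  qed (use C(1) in simp)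
  then show ?thesis
    by blast
qed

lemma rad_app_le: "rad I (\<lambda>i. S \<star> x i) \<le> norm S * rad I x"
proof -
  have "L2_set (\<lambda>A. norm (\<Sum>i\<in>I. sg A i *\<^sub>R (S \<star> x i))) (Pow I)
      \<le> L2_set (\<lambda>A. norm S * norm (\<Sum>i\<in>I. sg A i *\<^sub>R x i)) (Pow I)"
    using norm_app_le[of S] by (intro L2_set_mono) (auto simp: blinfun.bilinear_simps simp flip: blinfun.scaleR_right blinfun.sum_right)
  also have "\<dots> = norm S * L2_set (\<lambda>A. norm (\<Sum>i\<in>I. sg A i *\<^sub>R x i)) (Pow I)"
    by (simp add: L2_set_right_distrib)
  finally show ?thesis
    unfolding rad_def times_divide_eq_right by (rule divide_right_mono) simp
qed

lemma Rbd_singleton: "Rbd (norm S) {S}"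
proof (rule RbdI)
  fix I :: "nat set" and R :: "nat \<Rightarrow> 'a cop" and x
  assume "\<And>i. i \<in> I \<Longrightarrow> R i \<in> {S}"
  then have "rad I (\<lambda>i. R i \<star> x i) = rad I (\<lambda>i. S \<star> x i)"
    by (intro rad_cong) simp
  then show "rad I (\<lambda>i. R i \<star> x i) \<le> norm S * rad I x"
    using rad_app_le[of I S x] by simp
qed simp

lemma Rbd_norm_le:
  assumes "Rbd C F" "S \<in> F"
  shows "norm S \<le> C"
  unfolding norm_cop_def
proof (rule norm_blinfun_bound)
  fix x
  show "norm (S \<star> x) \<le> C * norm x"
    using RbdD[OF assms(1), of "{0}" "\<lambda>_. S" "\<lambda>_. x"] assms(2) by simp
qed (use Rbd_nonneg[OF assms(1)] in simp)

lemma Rbd_mult: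
  assumes "Rbd C F" "Rbd D G"
  shows "Rbd (C * D) {S * T | S T. S \<in> F \<and> T \<in> G}"
proof (rule RbdI)
  show "0 \<le> C * D"
    using assms by (simp add: Rbd_def)
  fix I :: "nat set" and R :: "nat \<Rightarrow> 'a cop" and x
  assume I: "finite I" and "\<And>i. i \<in> I \<Longrightarrow> R i \<in> {S * T | S T. S \<in> F \<and> T \<in> G}"
  then obtain S T where ST: "\<And>i. i \<in> I \<Longrightarrow> R i = S i * T i \<and> S i \<in> F \<and> T i \<in> G"
    by (simp; metis)
  have "rad I (\<lambda>i. R i \<star> x i) = rad I (\<lambda>i. S i \<star> T i \<star> x i)"
    by (rule rad_cong) (simp add: ST)
  also have "\<dots> \<le> C * rad I (\<lambda>i. T i \<star> x i)"
    using I ST by (intro RbdD[OF assms(1)]) auto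
  also have "\<dots> \<le> C * (D * rad I x)"
    using I ST Rbd_nonneg[OF assms(1)] by (intro mult_left_mono RbdD[OF assms(2)]) auto
  finally show "rad I (\<lambda>i. R i \<star> x i) \<le> C * D * rad I x"
    by simp
qed

lemma Rbd_add:
  assumes "Rbd C F" "Rbd D G"
  shows "Rbd (C + D) {S + T | S T. S \<in> F \<and> T \<in> G}"
proof (rule RbdI)
  show "0 \<le> C + D"
    using assms by (simp add: Rbd_def)
  fix I :: "nat set" and R :: "nat \<Rightarrow> 'a cop" and x
  assume I: "finite I" and "\<And>i. i \<in> I \<Longrightarrow> R i \<in> {S + T | S T. S \<in> F \<and> T \<in> G}"
  then obtain S T where ST: "\<And>i. i \<in> I \<Longrightarrow> R i = S i + T i \<and> S i \<in> F \<and> T i \<in> G"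
    by (simp; metis)
  have "rad I (\<lambda>i. R i \<star> x i) = rad I (\<lambda>i. S i \<star> x i + T i \<star> x i)"
    by (rule rad_cong) (simp add: ST blinfun.bilinear_simps)
  also have "\<dots> \<le> rad I (\<lambda>i. S i \<star> x i) + rad I (\<lambda>i. T i \<star> x i)"
    by (rule rad_add)
  also have "\<dots> \<le> C * rad I x + D * rad I x"
    using I ST by (intro add_mono RbdD[OF assms(1)] RbdD[OF assms(2)]) auto
  finally show "rad I (\<lambda>i. R i \<star> x i) \<le> (C + D) * rad I x"
    by (simp add: distrib_right)
qed

lemma Rbd_Un:
  assumes "Rbd C F" "Rbd D G"
  shows "Rbd (C + D) (F \<union> G)"
proof (rule RbdI)
  show CD: "0 \<le> C + D"
    using assms by (simp add: Rbd_def)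
  fix I :: "nat set" and R :: "nat \<Rightarrow> 'a cop" and x
  assume I: "finite I" and R: "\<And>i. i \<in> I \<Longrightarrow> R i \<in> F \<union> G"
  define I1 where "I1 = {i \<in> I. R i \<in> F}"
  define I2 where "I2 = {i \<in> I. R i \<in> G}"
  have fin: "finite I1" "finite I2" and eq: "I = I1 \<union> I2" and sub: "I1 \<subseteq> I" "I2 \<subseteq> I"
    using I R by (auto simp: I1_def I2_def)
  have "rad I (\<lambda>i. R i \<star> x i) \<le> rad I1 (\<lambda>i. R i \<star> x i) + rad I2 (\<lambda>i. R i \<star> x i)"
    using rad_Un[OF fin] eq by simp
  also have "\<dots> \<le> C * rad I1 x + D * rad I2 x"
    by (intro add_mono RbdD[OF assms(1)] RbdD[OF assms(2)] fin) (auto simp: I1_def I2_def)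
  also have "\<dots> \<le> C * rad I x + D * rad I x"
    using Rbd_nonneg assms I sub by (intro add_mono mult_left_mono rad_mono) auto
  finally show "rad I (\<lambda>i. R i \<star> x i) \<le> (C + D) * rad I x"
    by (simp add: distrib_right)
qed

lemma Rbd_scaleC:
  assumes "Rbd C F"
  shows "Rbd (2 * C) {c *\<^sub>C S | c S. cmod c \<le> 1 \<and> S \<in> F}"
proof (rule RbdI)
  show "0 \<le> 2 * C"
    using assms by (simp add: Rbd_def)
  fix I :: "nat set" and R :: "nat \<Rightarrow> 'a cop" and x
  assume I: "finite I" and "\<And>i. i \<in> I \<Longrightarrow> R i \<in> {c *\<^sub>C S | c S. cmod c \<le> 1 \<and> S \<in> F}"
  then obtain c S where cS: "\<And>i. i \<in> I \<Longrightarrow> R i = c i *\<^sub>C S i \<and> cmod (c i) \<le> 1 \<and> S i \<in> F"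
    by (simp; metis)
  have "rad I (\<lambda>i. R i \<star> x i) = rad I (\<lambda>i. c i *\<^sub>C (S i \<star> x i))"
    by (rule rad_cong) (simp add: cS)
  also have "\<dots> \<le> 2 * rad I (\<lambda>i. S i \<star> x i)"
    using I cS by (intro rad_contraction_complex) auto
  also have "\<dots> \<le> 2 * (C * rad I x)"
    using I cS by (intro mult_left_mono RbdD[OF assms]) auto
  finally show "rad I (\<lambda>i. R i \<star> x i) \<le> 2 * C * rad I x"
    by simp
qed

section \<open>Closed convex hulls and absolutely convex combinations\<close>

lemma tendsto_rad:
  assumes "\<And>i. i \<in> I \<Longrightarrow> ((\<lambda>n. x n i) \<longlongrightarrow> y i) G"
  shows "((\<lambda>n. rad I (x n)) \<longlongrightarrow> rad I y) G"
  unfolding rad_def L2_set_def by (intro tendsto_intros assms) auto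

text \<open>Each coordinate of \<open>(S\<^sub>i)\<close> may be replaced separately, because the \<open>S\<^sub>k\<close> satisfying the inequality
  with the others fixed form a closed convex set.\<close>

lemma Rbd_closure_convex_hull:
  assumes "Rbd C F"
  shows "Rbd C (closure (convex hull F))"
proof (rule RbdI)
  show "0 \<le> C"
    using assms by (rule Rbd_nonneg)
  fix I :: "nat set" and S :: "nat \<Rightarrow> 'a cop" and x
  assume I: "finite I" and S: "\<And>i. i \<in> I \<Longrightarrow> S i \<in> closure (convex hull F)"
  let ?H = "closure (convex hull F)"
  have "\<forall>S. (\<forall>i\<in>J. S i \<in> ?H) \<longrightarrow> (\<forall>i\<in>I - J. S i \<in> F) \<longrightarrow> rad I (\<lambda>i. S i \<star> x i) \<le> C * rad I x"
    if "finite J" "J \<subseteq> I" for J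
    using that
  proof (induction J rule: finite_induct)
    case empty
    show ?case
      using RbdD[OF assms I] by simp
  next
    case (insert k J)
    show ?case
    proof (intro allI impI)
      fix S
      assume S: "\<forall>i\<in>insert k J. S i \<in> ?H" "\<forall>i\<in>I - insert k J. S i \<in> F"
      define \<Phi> where "\<Phi> R = rad I (\<lambda>i. (S(k := R)) i \<star> x i)" for R
      define V where "V = {R. \<Phi> R \<le> C * rad I x}"
      have lin: "(\<lambda>i. (S(k := R)) i \<star> x i) = (\<lambda>i. if i = k then R \<star> x k else S i \<star> x i)" for R
        by auto
      have "F \<subseteq> V"
        unfolding V_def \<Phi>_def using insert S by auto
      moreover have "convex V"
      proof (rule convexI)
        fix Q R :: "'a cop" and u v :: real
        assume QR: "Q \<in> V" "R \<in> V" and uv: "0 \<le> u" "0 \<le> v" "u + v = 1"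
        have split: "(if i = k then (u *\<^sub>R Q + v *\<^sub>R R) \<star> x k else S i \<star> x i)
            = u *\<^sub>R (if i = k then Q \<star> x k else S i \<star> x i) + v *\<^sub>R (if i = k then R \<star> x k else S i \<star> x i)" for i
          using uv by (auto simp: blinfun.bilinear_simps simp flip: scaleR_add_left)
        have "\<Phi> (u *\<^sub>R Q + v *\<^sub>R R) \<le> rad I (\<lambda>i. u *\<^sub>R (if i = k then Q \<star> x k else S i \<star> x i))
            + rad I (\<lambda>i. v *\<^sub>R (if i = k then R \<star> x k else S i \<star> x i))"
          unfolding \<Phi>_def lin split by (rule rad_add)
        also have "\<dots> = u * \<Phi> Q + v * \<Phi> R"
          unfolding \<Phi>_def lin rad_scaleR using uv by simp
        also have "\<dots> \<le> u * (C * rad I x) + v * (C * rad I x)"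
          using QR uv unfolding V_def by (intro add_mono mult_left_mono) auto
        also have "\<dots> = C * rad I x"
          using uv by (simp flip: distrib_right)
        finally show "u *\<^sub>R Q + v *\<^sub>R R \<in> V"
          by (simp add: V_def)
      qed
      moreover have "closed V"
        unfolding closed_sequential_limits
      proof (intro allI impI, elim conjE)
        fix X L
        assume X: "\<forall>n. X n \<in> V" "X \<longlonglongrightarrow> L"
        have "(\<lambda>n. \<Phi> (X n)) \<longlonglongrightarrow> \<Phi> L"
          unfolding \<Phi>_def lin using X(2) by (intro tendsto_rad) (auto intro: tendsto_app_left)
        then show "L \<in> V"
          using X(1) unfolding V_def by (auto intro: LIMSEQ_le_const2)
      qed
      ultimately have "?H \<subseteq> V"
        by (intro closure_minimal hull_minimal)
      then have "\<Phi> (S k) \<le> C * rad I x"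
        using S(1) by (auto simp: V_def)
      then show "rad I (\<lambda>i. S i \<star> x i) \<le> C * rad I x"
        by (simp add: \<Phi>_def)
    qed
  qed
  then show "rad I (\<lambda>i. S i \<star> x i) \<le> C * rad I x"
    using I S by blast
qed

text \<open>Membership in \<open>K\<close> times the absolutely convex hull of \<open>F\<close>,
  stated for complex coefficients with total weight at most \<open>K\<close>, the form in which
  quadrature sums and truncated series arise.\<close>

definition acomb :: "real \<Rightarrow> 'a::complex_normed_vector cop set \<Rightarrow> 'a cop \<Rightarrow> bool"
  where "acomb K F X \<longleftrightarrow> (\<exists>(J :: nat set) w G. finite J \<and> (\<forall>j\<in>J. G j \<in> F) \<and>
    (\<Sum>j\<in>J. cmod (w j)) \<le> K \<and> X = (\<Sum>j\<in>J. w j *\<^sub>C G j))"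

lemma acombI:
  fixes J :: "nat set"
  assumes "finite J" "\<And>j. j \<in> J \<Longrightarrow> G j \<in> F" "(\<Sum>j\<in>J. cmod (w j)) \<le> K"
  shows "acomb K F (\<Sum>j\<in>J. w j *\<^sub>C G j)"
  using assms unfolding acomb_def by blast

lemma acomb_in_hull:
  assumes "acomb K F X" "K > 0" "F \<noteq> {}"
  shows "(1 / K) *\<^sub>R X \<in> convex hull {c *\<^sub>C S | c S. cmod c \<le> 1 \<and> S \<in> F}"
proof -
  let ?B = "{c *\<^sub>C S | c S. cmod c \<le> 1 \<and> S \<in> F}"
  obtain J :: "nat set" and w G where J: "finite J" "\<And>j. j \<in> J \<Longrightarrow> G j \<in> F"
    "(\<Sum>j\<in>J. cmod (w j)) \<le> K" and X: "X = (\<Sum>j\<in>J. w j *\<^sub>C G j)"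
    using assms(1) unfolding acomb_def by blast
  define s where "s = (\<Sum>j\<in>J. cmod (w j))"
  have "0 \<in> ?B"
    using assms(3) by (force intro: exI[of _ 0])
  then have zero: "0 \<in> convex hull ?B"
    by (rule hull_inc)
  show ?thesis
  proof (cases "s = 0")
    case True
    then have "w j = 0" if "j \<in> J" for j
      using that J(1) by (simp add: s_def sum_nonneg_eq_0_iff)
    then show ?thesis
      using zero by (simp add: X)
  next
    case False
    then have s: "s > 0"
      by (simp add: s_def less_le sum_nonneg)
    have "(\<Sum>j\<in>J. (cmod (w j) / s) *\<^sub>R ((w j / cmod (w j)) *\<^sub>C G j)) \<in> convex hull ?B"
    proof (rule convex_sum[OF J(1) convex_convex_hull])
      show "(\<Sum>j\<in>J. cmod (w j) / s) = 1"
        using s by (simp add: s_def flip: sum_divide_distrib)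
      show "(w j / cmod (w j)) *\<^sub>C G j \<in> convex hull ?B" if "j \<in> J" for j
        using J(2)[OF that] by (intro hull_inc) (auto simp: norm_divide intro!: exI[of _ "w j / cmod (w j)"] divide_le_eq_1)
    qed (use s in auto)
    also have "(\<Sum>j\<in>J. (cmod (w j) / s) *\<^sub>R ((w j / cmod (w j)) *\<^sub>C G j)) = (1 / s) *\<^sub>R X"
      unfolding X scaleR_sum_right
      by (intro sum.cong) (auto simp: scaleR_scaleC scaleC_scaleC)
    \<comment> \<open>The missing weight \<open>1 - s / K\<close> is given to 0, which belongs to
      the hull as a zero multiple of an element of \<open>F\<close>.\<close>
    finally have "(s / K) *\<^sub>R ((1 / s) *\<^sub>R X) + (1 - s / K) *\<^sub>R 0 \<in> convex hull ?B"
      using zero assms(2) J(3) s by (intro convexD[OF convex_convex_hull]) (auto simp: s_def)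
    then show ?thesis
      using s by simp
  qed
qed

text \<open>The transfer principle of the whole proof: contour integrals and infinite series are
  norm limits of absolutely convex combinations, and only their total weight \<open>K\<close> enters
  the R-bound.\<close>

lemma Rbd_acomb_limit:
  assumes F: "Rbd C F" "F \<noteq> {}" and K: "K > 0"
    and H: "\<And>U. U \<in> H \<Longrightarrow> \<exists>X. (\<forall>\<^sub>F n in sequentially. acomb K F (X n)) \<and> X \<longlonglongrightarrow> U"
  shows "Rbd (2 * C * K) H"
proof -
  let ?A = "closure (convex hull {c *\<^sub>C S | c S. cmod c \<le> 1 \<and> S \<in> F})"
  have A: "Rbd (2 * C) ?A"
    by (intro Rbd_closure_convex_hull Rbd_scaleC F)
  have in_A: "(1 / K) *\<^sub>R U \<in> ?A" if U: "U \<in> H" for U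
  proof -
    obtain X where X: "\<forall>\<^sub>F n in sequentially. acomb K F (X n)" "X \<longlonglongrightarrow> U"
      using H[OF U] by blast
    have "\<forall>\<^sub>F n in sequentially. (1 / K) *\<^sub>R X n \<in> ?A"
      using X(1) by eventually_elim (use acomb_in_hull K F closure_subset in blast)
    moreover have "(\<lambda>n. (1 / K) *\<^sub>R X n) \<longlonglongrightarrow> (1 / K) *\<^sub>R U"
      by (intro tendsto_intros X(2))
    ultimately show ?thesis
      by (intro Lim_in_closed_set[OF closed_closure]) auto
  qed
  show ?thesis
  proof (rule RbdI)
    show "0 \<le> 2 * C * K"
      using K Rbd_nonneg[OF F(1)] by simp
    fix I :: "nat set" and S :: "nat \<Rightarrow> 'a cop" and x
    assume I: "finite I" "\<And>i. i \<in> I \<Longrightarrow> S i \<in> H"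
    have "rad I (\<lambda>i. S i \<star> x i) = rad I (\<lambda>i. K *\<^sub>R (((1 / K) *\<^sub>R S i) \<star> x i))"
      using K by (intro rad_cong) (simp add: blinfun.bilinear_simps)
    also have "\<dots> = K * rad I (\<lambda>i. ((1 / K) *\<^sub>R S i) \<star> x i)"
      unfolding rad_scaleR using K by simp
    also have "\<dots> \<le> K * (2 * C * rad I x)"
      using K I in_A by (intro mult_left_mono RbdD[OF A]) auto
    finally show "rad I (\<lambda>i. S i \<star> x i) \<le> 2 * C * K * rad I x"
      by (simp add: mult_ac)
  qed
qed

lemma Rbd_acomb:
  assumes "Rbd C F" "F \<noteq> {}" "K > 0" "\<And>U. U \<in> H \<Longrightarrow> acomb K F U"
  shows "Rbd (2 * C * K) H"
  using assms by (intro Rbd_acomb_limit) (auto intro!: exI[of _ "\<lambda>n. _"])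

lemma Rbd_scaleC_le:
  assumes "Rbd C F" "K > 0"
  shows "Rbd (2 * C * K) {c *\<^sub>C S | c S. cmod c \<le> K \<and> S \<in> F}"
proof (cases "F = {}")
  case True
  then show ?thesis
    using assms Rbd_nonneg[OF assms(1)] by (auto intro!: RbdI)
next
  case False
  have "acomb K F (c *\<^sub>C S)" if "cmod c \<le> K" "S \<in> F" for c S
    using acombI[of "{0}" "\<lambda>_. S" F "\<lambda>_. c" K] that by simp
  then show ?thesis
    using assms False by (intro Rbd_acomb) auto
qed

section \<open>Averages over roots of unity\<close>

definition unity_root :: "nat \<Rightarrow> nat \<Rightarrow> complex"
  where "unity_root n k = exp (2 * of_real pi * \<i> * of_nat k / of_nat n)"

lemma norm_unity_root [simp]: "cmod (unity_root n k) = 1"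
proof -
  have "unity_root n k = exp (\<i> * of_real (2 * pi * real k / real n))"
    by (simp add: unity_root_def mult_ac)
  then show ?thesis
    by (simp only: norm_exp_i_times)
qed

lemma unity_root_nonzero [simp]: "unity_root n k \<noteq> 0"
  by (simp add: unity_root_def)

lemma unity_root_power: "unity_root n k ^ l = unity_root n (k * l)"
  by (simp add: unity_root_def mult_ac flip: exp_of_nat_mult)

lemma unity_root_power_self:
  assumes "n > 0"
  shows "unity_root n k ^ n = 1"
proof -
  have "unity_root n (k * n) = unity_root n 0"
    unfolding unity_root_def using assms by (subst complex_root_unity_eq) auto
  then show ?thesis
    unfolding unity_root_power by (simp add: unity_root_def)
qed

lemma sum_unity_root:
  assumes "q < n" "l < n"
  shows "(\<Sum>k<n. unity_root n k ^ q / unity_root n k ^ l) = (if q = l then of_nat n else 0)"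
proof (cases "q = l")
  case False
  define u where "u = unity_root n q / unity_root n l"
  have "unity_root n q \<noteq> unity_root n l"
    using complex_root_unity_eq[of n q l] assms False by (simp add: unity_root_def)
  then have "u \<noteq> 1"
    by (simp add: u_def)
  moreover have "u ^ n = 1"
    using assms by (simp add: u_def power_divide unity_root_power_self)
  ultimately have "(\<Sum>k<n. u ^ k) = 0"
    by (simp add: geometric_sum)
  moreover have "unity_root n k ^ q / unity_root n k ^ l = u ^ k" for k
    by (simp add: u_def power_divide unity_root_power mult.commute)
  ultimately show ?thesis
    using False by simp
qed simp

text \<open>The \<open>n\<close>-point quadrature of the mean over the circle of radius
  \<open>r\<close>. Being a finite sum, it is directly an absolutely convex combination, up to its
  weight, of values of the integrand.\<close>

definition circle_mean :: "real \<Rightarrow> nat \<Rightarrow> (complex \<Rightarrow> 'b::real_vector) \<Rightarrow> 'b"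
  where "circle_mean r n h = (1 / real n) *\<^sub>R (\<Sum>k<n. h (of_real r * unity_root n k))"

text \<open>The Laurent expansion at infinity, absolutely convergent on the circle of radius
  \<open>r\<close>.\<close>

definition expands :: "real \<Rightarrow> (complex \<Rightarrow> 'b::complex_normed_vector) \<Rightarrow> (nat \<Rightarrow> 'b) \<Rightarrow> bool"
  where "expands r G g \<longleftrightarrow> summable (\<lambda>l. norm (g l) / r ^ l) \<and>
    (\<forall>z. cmod z = r \<longrightarrow> (\<lambda>l. (1 / z ^ l) *\<^sub>C g l) sums G z)"

text \<open>Cauchy's coefficient formula by quadrature. Among the indices below \<open>n\<close>,
  orthogonality of the roots of unity leaves only the \<open>q\<close>-th coefficient. The aliased
  indices from \<open>n\<close> on contribute at most a tail of the absolutely convergent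
  expansion.\<close>

lemma circle_mean_expands:
  fixes g :: "nat \<Rightarrow> 'b::{complex_normed_vector, banach}"
  assumes r: "r > 0" and G: "expands r G g"
  shows "(\<lambda>n. circle_mean r n (\<lambda>z. z ^ q *\<^sub>C G z)) \<longlonglongrightarrow> g q"
proof (rule LIMSEQ_I)
  fix e :: real
  assume e: "e > 0"
  have sm: "summable (\<lambda>l. norm (g l) / r ^ l)"
    using G by (simp add: expands_def)
  obtain N where N: "\<And>n. n \<ge> N \<Longrightarrow> norm (\<Sum>l. norm (g (l + n)) / r ^ (l + n)) < e / r ^ q"
    using suminf_exist_split[OF _ sm, of "e / r ^ q"] e r by auto
  show "\<exists>N. \<forall>n\<ge>N. norm (circle_mean r n (\<lambda>z. z ^ q *\<^sub>C G z) - g q) < e"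
  proof (intro exI allI impI)
    fix n
    assume "n \<ge> max N (Suc q)"
    then have n: "n \<ge> N" "q < n"
      by auto
    define z where "z k = of_real r * unity_root n k" for k
    have z: "cmod (z k) = r" "z k \<noteq> 0" for k
      using r by (auto simp: z_def norm_mult)
    define c where "c l = (1 / of_nat n) * (\<Sum>k<n. z k ^ q / z k ^ l)" for l
    have "(\<lambda>l. (1 / real n) *\<^sub>R (\<Sum>k<n. z k ^ q *\<^sub>C (1 / z k ^ l) *\<^sub>C g l)) sums
        circle_mean r n (\<lambda>z. z ^ q *\<^sub>C G z)"
      unfolding circle_mean_def z_def[symmetric]
      using G z
      by (intro bounded_linear.sums[OF bounded_linear_scaleR_right] sums_sum
          bounded_linear.sums[OF bounded_linear_scaleC]) (auto simp: expands_def)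
    moreover have "(1 / real n) *\<^sub>R (\<Sum>k<n. z k ^ q *\<^sub>C (1 / z k ^ l) *\<^sub>C g l) = c l *\<^sub>C g l" for l
      by (simp add: c_def scaleR_scaleC scaleC_scaleC flip: scaleC_sum_left)
    ultimately have sums1: "(\<lambda>l. c l *\<^sub>C g l) sums circle_mean r n (\<lambda>z. z ^ q *\<^sub>C G z)"
      by simp
    have c_small: "c l = (if l = q then 1 else 0)" if "l < n" for l
    proof -
      have "c l = (r ^ q / r ^ l) / of_nat n * (\<Sum>k<n. unity_root n k ^ q / unity_root n k ^ l)"
        by (simp add: c_def z_def power_mult_distrib sum_distrib_left sum_divide_distrib mult_ac)
      then show ?thesis
        using r that n(2) by (simp add: sum_unity_root)
    qed
    have c_le: "cmod (c l) \<le> r ^ q / r ^ l" for l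
    proof -
      have "cmod (\<Sum>k<n. z k ^ q / z k ^ l) \<le> (\<Sum>k<n. r ^ q / r ^ l)"
        by (rule sum_norm_le) (simp add: norm_divide norm_power z)
      then show ?thesis
        using n(2) by (simp add: c_def norm_mult norm_divide field_simps)
    qed
    define d where "d l = c l *\<^sub>C g l - (if l = q then g l else 0)" for l
    have "d sums (circle_mean r n (\<lambda>z. z ^ q *\<^sub>C G z) - g q)"
      unfolding d_def by (intro sums_diff sums1 sums_single)
    moreover have "d l = 0" if "l < n" for l
      using c_small[OF that] by (auto simp: d_def)
    ultimately have sums2: "(\<lambda>l. d (l + n)) sums (circle_mean r n (\<lambda>z. z ^ q *\<^sub>C G z) - g q)"
      by (subst sums_zero_iff_shift) auto
    have d_le: "norm (d (l + n)) \<le> r ^ q * (norm (g (l + n)) / r ^ (l + n))" for l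
      using n(2) mult_right_mono[OF c_le[of "l + n"] norm_ge_zero[of "g (l + n)"]]
      by (simp add: d_def norm_scaleC)
    have sm': "summable (\<lambda>l. norm (g (l + n)) / r ^ (l + n))"
      using sm by (subst summable_iff_shift)
    have "norm (circle_mean r n (\<lambda>z. z ^ q *\<^sub>C G z) - g q) = norm (\<Sum>l. d (l + n))"
      using sums_unique[OF sums2] by simp
    also have "\<dots> \<le> (\<Sum>l. r ^ q * (norm (g (l + n)) / r ^ (l + n)))"
      by (rule norm_suminf_le[OF d_le summable_mult[OF sm']])
    also have "\<dots> = r ^ q * (\<Sum>l. norm (g (l + n)) / r ^ (l + n))"
      by (rule suminf_mult[OF sm'])
    also have "\<dots> < r ^ q * (e / r ^ q)"
      using N[OF n(1)] r by (intro mult_strict_left_mono) auto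
    also have "\<dots> = e"
      using r by simp
    finally show "norm (circle_mean r n (\<lambda>z. z ^ q *\<^sub>C G z) - g q) < e" .
  qed
qed

lemma summable_norm_Cauchy_product:
  fixes a b :: "nat \<Rightarrow> 'b::{real_normed_algebra, banach}"
  assumes "summable (\<lambda>k. norm (a k))" "summable (\<lambda>k. norm (b k))"
  shows "summable (\<lambda>k. norm (\<Sum>i\<le>k. a i * b (k - i)))"
proof (rule summable_comparison_test')
  show "summable (\<lambda>k. \<Sum>i\<le>k. norm (a i) * norm (b (k - i)))"
    using assms by (intro summable_Cauchy_product) simp_all
  show "norm (norm (\<Sum>i\<le>k. a i * b (k - i))) \<le> (\<Sum>i\<le>k. norm (a i) * norm (b (k - i)))" if "k \<ge> 0" for k
    by (simp add: order_trans[OF norm_sum] sum_mono norm_mult_ineq)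
qed

lemma expands_mult:
  fixes G H :: "complex \<Rightarrow> 'a::{complex_normed_vector, banach} cop"
  assumes "r > 0" "expands r G g" "expands r H h"
  shows "expands r (\<lambda>z. G z * H z) (\<lambda>l. \<Sum>i\<le>l. g i * h (l - i))"
proof -
  have norm_eq: "norm ((1 / z ^ l) *\<^sub>C f l) = norm (f l) / r ^ l" if "cmod z = r" for z l and f :: "nat \<Rightarrow> 'a cop"
    using that by (simp add: norm_scaleC norm_divide norm_power)
  have prod: "(\<Sum>i\<le>l. (1 / z ^ i) *\<^sub>C g i * (1 / z ^ (l - i)) *\<^sub>C h (l - i))
      = (1 / z ^ l) *\<^sub>C (\<Sum>i\<le>l. g i * h (l - i))" for z l
    unfolding scaleC_sum_right
    by (intro sum.cong) (auto simp: scaleC_mult_left scaleC_mult_right scaleC_scaleC simp flip: power_add)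
  have sg: "summable (\<lambda>l. norm ((1 / z ^ l) *\<^sub>C g l))" and sh: "summable (\<lambda>l. norm ((1 / z ^ l) *\<^sub>C h l))"
    if "cmod z = r" for z
    using assms(2,3) by (simp_all add: norm_eq[OF that] expands_def)
  have "cmod (of_real r) = r"
    using assms(1) by simp
  from summable_norm_Cauchy_product[OF sg[OF this] sh[OF this]]
  have "summable (\<lambda>l. norm (\<Sum>i\<le>l. g i * h (l - i)) / r ^ l)"
    unfolding prod using norm_eq[OF \<open>cmod (of_real r) = r\<close>, of _ "\<lambda>l. \<Sum>i\<le>l. g i * h (l - i)"] by simp
  moreover have "(\<lambda>l. (1 / z ^ l) *\<^sub>C (\<Sum>i\<le>l. g i * h (l - i))) sums (G z * H z)" if "cmod z = r" for z
  proof -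
    have "G z = (\<Sum>l. (1 / z ^ l) *\<^sub>C g l)" "H z = (\<Sum>l. (1 / z ^ l) *\<^sub>C h l)"
      using assms(2,3) that by (auto simp: expands_def intro: sums_unique)
    then show ?thesis
      using Cauchy_product_sums[OF sg[OF that] sh[OF that]] unfolding prod by simp
  qed
  ultimately show ?thesis
    by (simp add: expands_def)
qed

lemma expands_const_mult:
  fixes G :: "complex \<Rightarrow> 'a::{complex_normed_vector, banach} cop"
  assumes "r > 0" "expands r G g"
  shows "expands r (\<lambda>z. P * G z) (\<lambda>l. P * g l)"
proof -
  have "summable (\<lambda>l. norm (P * g l) / r ^ l)"
  proof (rule summable_comparison_test')
    show "summable (\<lambda>l. norm P * (norm (g l) / r ^ l))"
      using assms by (intro summable_mult) (simp add: expands_def)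
    show "norm (norm (P * g l) / r ^ l) \<le> norm P * (norm (g l) / r ^ l)" if "l \<ge> 0" for l
      using norm_mult_ineq[of P "g l"] assms(1) by (simp add: divide_right_mono)
  qed
  moreover have "(\<lambda>l. (1 / z ^ l) *\<^sub>C (P * g l)) sums (P * G z)" if "cmod z = r" for z
    using assms(2) that bounded_linear.sums[OF bounded_linear_mult_right, of "\<lambda>l. (1 / z ^ l) *\<^sub>C g l" "G z" P]
    by (simp add: expands_def scaleC_mult_right)
  ultimately show ?thesis
    by (simp add: expands_def)
qed

text \<open>Since |1 - cnj \<xi> z| = |z - \<xi>|, the integrand times r^2 - 1 is the Poisson
  kernel. That is the real part of (z + \<xi>) / (z - \<xi>), whose expansion at infinity has
  constant coefficient 1.\<close>

lemma circle_mean_poisson: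
  assumes r: "r > 1" and \<xi>: "cmod \<xi> = 1"
  shows "(\<lambda>n. circle_mean r n (\<lambda>z. 1 / (cmod (1 - cnj \<xi> * z))\<^sup>2)) \<longlonglongrightarrow> 1 / (r\<^sup>2 - 1)"
proof -
  define g where "g l = (if l = 0 then 1 else 2 * \<xi> ^ l)" for l :: nat
  define G where "G z = (z + \<xi>) / (z - \<xi>)" for z
  have norm_g: "norm (g l) / r ^ l \<le> 2 * (1 / r) ^ l" for l
    using \<xi> r by (simp add: g_def norm_mult norm_power power_divide)
  have "summable (\<lambda>l. norm (g l) / r ^ l)"
  proof (rule summable_comparison_test')
    show "summable (\<lambda>l. 2 * (1 / r) ^ l)"
      using r by (intro summable_mult summable_geometric) auto
  qed (use norm_g r in auto)
  moreover have "(\<lambda>l. (1 / z ^ l) *\<^sub>C g l) sums G z" if z: "cmod z = r" for z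
  proof -
    have ne: "z \<noteq> 0" "z \<noteq> \<xi>"
      using z r \<xi> by auto
    have "(\<lambda>l. 2 * (\<xi> / z) ^ l) sums (2 * (1 / (1 - \<xi> / z)))"
      using z r \<xi> by (intro sums_mult geometric_sums) (simp add: norm_divide)
    then have "(\<lambda>l. 2 * (\<xi> / z) ^ l - (if l = 0 then 1 else 0)) sums (2 * (1 / (1 - \<xi> / z)) - 1)"
      by (intro sums_diff sums_single[of 0 "\<lambda>_. 1"])
    moreover have "2 * (1 / (1 - \<xi> / z)) - 1 = G z"
      using ne by (simp add: G_def field_simps)
    moreover have "2 * (\<xi> / z) ^ l - (if l = 0 then 1 else 0) = (1 / z ^ l) *\<^sub>C g l" for l
      by (simp add: g_def scaleC_complex_def power_divide)
    ultimately show ?thesis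
      by simp
  qed
  ultimately have "expands r G g"
    by (simp add: expands_def)
  from circle_mean_expands[OF _ this, of 0] r
  have "(\<lambda>n. circle_mean r n G) \<longlonglongrightarrow> 1"
    by (simp add: g_def scaleC_complex_def)
  then have "(\<lambda>n. Re (circle_mean r n G) / (r\<^sup>2 - 1)) \<longlonglongrightarrow> Re 1 / (r\<^sup>2 - 1)"
    using r by (intro tendsto_intros) (auto simp: power2_eq_1_iff)
  moreover have "Re (circle_mean r n G) / (r\<^sup>2 - 1) = circle_mean r n (\<lambda>z. 1 / (cmod (1 - cnj \<xi> * z))\<^sup>2)" for n
  proof -
    have "Re (G z) / (r\<^sup>2 - 1) = 1 / (cmod (1 - cnj \<xi> * z))\<^sup>2" if z: "cmod z = r" for z
    proof -
      have \<xi>2: "\<xi> * cnj \<xi> = 1"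
        using \<xi> by (simp add: complex_norm_square[symmetric])
      have "1 - cnj \<xi> * z = - cnj \<xi> * (z - \<xi>)"
        using \<xi>2 by (simp add: algebra_simps)
      then have "cmod (1 - cnj \<xi> * z) = cmod (z - \<xi>)"
        by (simp only: norm_mult norm_minus_cancel complex_mod_cnj \<xi>)
      moreover have "Re (G z) = (r\<^sup>2 - 1) / (cmod (z - \<xi>))\<^sup>2"
      proof -
        have "(z + \<xi>) * cnj (z - \<xi>) = (z * cnj z - \<xi> * cnj \<xi>) + (\<xi> * cnj z - cnj (\<xi> * cnj z))"
          by (simp add: algebra_simps)
        then have "Re ((z + \<xi>) * cnj (z - \<xi>)) = Re (z * cnj z - \<xi> * cnj \<xi>)"
          by (simp only: plus_complex.sel minus_complex.sel cnj.sel)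
        also have "\<dots> = r\<^sup>2 - 1"
          unfolding complex_norm_square[symmetric] z using \<xi> by simp
        finally show ?thesis
          by (simp only: G_def complex_div_cnj[of "z + \<xi>"] Re_divide_of_real flip: of_real_power)
      qed
      ultimately show ?thesis
        using r by (simp add: power2_eq_1_iff)
    qed
    then have eq: "Re (G (of_real r * unity_root n k)) / (r\<^sup>2 - 1)
        = 1 / (cmod (1 - cnj \<xi> * (of_real r * unity_root n k)))\<^sup>2" for k
      using r by (simp add: norm_mult)
    have "Re (circle_mean r n G) / (r\<^sup>2 - 1)
        = (1 / real n) * (\<Sum>k<n. Re (G (of_real r * unity_root n k)) / (r\<^sup>2 - 1))"
      by (simp add: circle_mean_def flip: sum_divide_distrib)
    then show ?thesis
      unfolding eq by (simp add: circle_mean_def)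
  qed
  ultimately show ?thesis
    by simp
qed

section \<open>Polynomials of an operator\<close>

definition peval :: "'a::complex_normed_vector cop \<Rightarrow> complex poly \<Rightarrow> 'a cop"
  where "peval T p = (\<Sum>i\<le>degree p. coeff p i *\<^sub>C T ^ i)"

lemma peval_bound:
  assumes "degree p \<le> n"
  shows "peval T p = (\<Sum>i\<le>n. coeff p i *\<^sub>C T ^ i)"
  unfolding peval_def using assms by (intro sum.mono_neutral_left) (auto simp: coeff_eq_0)

lemma peval_0 [simp]: "peval T 0 = 0"
  by (simp add: peval_def)

lemma peval_add [simp]: "peval T (p + q) = peval T p + peval T q"
proof -
  define n where "n = max (degree p) (degree q)"
  have "degree (p + q) \<le> n" "degree p \<le> n" "degree q \<le> n"
    by (auto simp: n_def degree_add_le_max)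
  then show ?thesis
    by (simp add: peval_bound[of _ n] scaleC_add_left sum.distrib)
qed

lemma peval_smult [simp]: "peval T (smult c p) = c *\<^sub>C peval T p"
  by (simp add: peval_bound[OF degree_smult_le] peval_def scaleC_sum_right scaleC_scaleC)

lemma peval_pCons [simp]: "peval T (pCons a p) = a *\<^sub>C 1 + T * peval T p"
proof -
  have "peval T (pCons a p) = (\<Sum>i\<le>Suc (degree p). coeff (pCons a p) i *\<^sub>C T ^ i)"
    by (rule peval_bound) (rule degree_pCons_le)
  also have "\<dots> = a *\<^sub>C 1 + (\<Sum>i\<le>degree p. coeff p i *\<^sub>C T ^ Suc i)"
    by (subst sum.atMost_Suc_shift) simp
  also have "(\<Sum>i\<le>degree p. coeff p i *\<^sub>C T ^ Suc i) = T * peval T p"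
    by (simp add: peval_def sum_distrib_left scaleC_mult_right)
  finally show ?thesis .
qed

lemma peval_1 [simp]: "peval T 1 = 1"
  by (simp add: peval_def)

lemma peval_mult: "peval T (p * q) = peval T p * peval T q"
  by (induction p) (simp_all add: scaleC_mult_left distrib_right mult.assoc)

lemma peval_commute: "peval T p * peval T q = peval T q * peval T p"
  by (metis mult.commute peval_mult)

lemma peval_sum: "peval T (\<Sum>i\<in>I. p i) = (\<Sum>i\<in>I. peval T (p i))"
  by (induction I rule: infinite_finite_induct) simp_all

lemma peval_monom: "peval T (monom c n) = c *\<^sub>C T ^ n"
  by (induction n) (simp_all add: monom_Suc scaleC_mult_right monom_0)

lemma peval_commute_T: "T ^ n * peval T p = peval T p * T ^ n"
  using peval_commute[of T "monom 1 n" p] by (simp add: peval_monom)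


section \<open>The powers of an operator with resolvent outside the disc\<close>

definition resolvent_map :: "'a::complex_normed_vector cop \<Rightarrow> (complex \<Rightarrow> 'a cop) \<Rightarrow> bool"
  where "resolvent_map T R \<longleftrightarrow>
    (\<forall>z. 1 < cmod z \<longrightarrow> R z * (z *\<^sub>C 1 - T) = 1 \<and> (z *\<^sub>C 1 - T) * R z = 1)"

lemma resolvent_mapD:
  assumes "resolvent_map T R" "1 < cmod z"
  shows "R z * (z *\<^sub>C 1 - T) = 1" "(z *\<^sub>C 1 - T) * R z = 1"
  using assms by (auto simp: resolvent_map_def)

lemma resolvent_map_diff:
  assumes "resolvent_map T R" "1 < cmod z" "1 < cmod w"
  shows "R z - R w = (w - z) *\<^sub>C (R z * R w)"
proof -
  have "R z - R w = R z * ((w *\<^sub>C 1 - T) * R w) - (R z * (z *\<^sub>C 1 - T)) * R w"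
    by (simp add: resolvent_mapD[OF assms(1,2)] resolvent_mapD[OF assms(1,3)])
  also have "\<dots> = R z * ((w *\<^sub>C 1 - T) - (z *\<^sub>C 1 - T)) * R w"
    by (simp only: left_diff_distrib right_diff_distrib mult.assoc)
  also have "(w *\<^sub>C 1 - T) - (z *\<^sub>C 1 - T) = (w - z) *\<^sub>C 1"
    by (simp add: scaleC_diff_left)
  finally show ?thesis
    by (simp add: scaleC_mult_left scaleC_mult_right)
qed

lemma geometric_sum_cop:
  "(z *\<^sub>C 1 - T) * (\<Sum>l<n. z ^ (n - 1 - l) *\<^sub>C T ^ l) = z ^ n *\<^sub>C 1 - (T :: 'a::complex_normed_vector cop) ^ n"
proof (induction n)
  case (Suc n)
  have "(\<Sum>l<Suc n. z ^ (Suc n - 1 - l) *\<^sub>C T ^ l) = z *\<^sub>C (\<Sum>l<n. z ^ (n - 1 - l) *\<^sub>C T ^ l) + T ^ n"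
  proof -
    have "z ^ (Suc n - 1 - l) *\<^sub>C T ^ l = z *\<^sub>C z ^ (n - 1 - l) *\<^sub>C T ^ l" if "l < n" for l
    proof -
      have "Suc n - 1 - l = Suc (n - 1 - l)"
        using that by simp
      then show ?thesis
        by (simp only: power_Suc scaleC_scaleC)
    qed
    then show ?thesis
      by (simp add: scaleC_sum_right)
  qed
  then have "(z *\<^sub>C 1 - T) * (\<Sum>l<Suc n. z ^ (Suc n - 1 - l) *\<^sub>C T ^ l)
      = z *\<^sub>C (z ^ n *\<^sub>C 1 - T ^ n) + (z *\<^sub>C 1 - T) * T ^ n"
    by (simp only: distrib_left scaleC_mult_right Suc)
  then show ?case
    by (simp add: left_diff_distrib scaleC_diff_right scaleC_scaleC scaleC_mult_left)
qed simp

section \<open>Growth of the powers from bounds on the resolvent\<close>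

definition decays :: "'a::complex_normed_vector cop \<Rightarrow> real \<Rightarrow> bool"
  where "decays T r \<longleftrightarrow> (\<lambda>n. norm (T ^ n) / r ^ n) \<longlonglongrightarrow> 0"

lemma decays_if_bounded:
  assumes "\<forall>\<^sub>F n in sequentially. norm (T ^ n) \<le> K * s ^ n" "0 < s" "s < r"
  shows "decays T r"
  unfolding decays_def
proof (rule tendsto_sandwich[where f = "\<lambda>_. 0" and h = "\<lambda>n. K * (s / r) ^ n"])
  show "(\<lambda>n. K * (s / r) ^ n) \<longlonglongrightarrow> 0"
    using assms by (intro tendsto_mult_right_zero LIMSEQ_power_zero) auto
  show "\<forall>\<^sub>F n in sequentially. norm (T ^ n) / r ^ n \<le> K * (s / r) ^ n"
    using assms(1) by eventually_elim (use assms in \<open>simp add: power_divide divide_right_mono\<close>)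
  show "\<forall>\<^sub>F n in sequentially. 0 \<le> norm (T ^ n) / r ^ n"
    using assms by auto
qed auto

text \<open>Rickart's argument: \<open>(1 - T\<^sup>n / r\<^sup>n)\<^sup>-\<^sup>1\<close> is the mean of \<open>z R(z)\<close> over the \<open>n\<close>-th roots of \<open>r\<^sup>n\<close>,
  hence Lipschitz in \<open>r\<close> uniformly in \<open>n\<close>.\<close>

lemma circle_mean_resolvent:
  assumes "resolvent_map T R" "r > 1" "n > 0"
  shows "circle_mean r n (\<lambda>z. z *\<^sub>C R z) * (1 - (1 / r ^ n) *\<^sub>R T ^ n) = 1"
proof -
  define z where "z k = of_real r * unity_root n k" for k
  have z: "cmod (z k) = r" for k
    using assms by (simp add: z_def norm_mult)
  have zn: "z k ^ n = of_real r ^ n" for k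
    by (simp add: z_def power_mult_distrib unity_root_power_self assms)
  have step: "(z k *\<^sub>C R (z k)) * (of_real r ^ n *\<^sub>C 1 - T ^ n) = (\<Sum>l<n. z k ^ (n - l) *\<^sub>C T ^ l)" for k
  proof -
    have "R (z k) * (z k ^ n *\<^sub>C 1 - T ^ n) = (\<Sum>l<n. z k ^ (n - 1 - l) *\<^sub>C T ^ l)"
      unfolding geometric_sum_cop[symmetric] mult.assoc[symmetric]
      using assms z by (simp add: resolvent_mapD)
    then have "z k *\<^sub>C (R (z k) * (z k ^ n *\<^sub>C 1 - T ^ n)) = (\<Sum>l<n. z k ^ Suc (n - 1 - l) *\<^sub>C T ^ l)"
      by (simp add: scaleC_sum_right scaleC_scaleC)
    also have "\<dots> = (\<Sum>l<n. z k ^ (n - l) *\<^sub>C T ^ l)"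
    proof (intro sum.cong refl)
      fix l assume "l \<in> {..<n}"
      then have "Suc (n - 1 - l) = n - l"
        by auto
      then show "z k ^ Suc (n - 1 - l) *\<^sub>C T ^ l = z k ^ (n - l) *\<^sub>C T ^ l"
        by simp
    qed
    finally show ?thesis
      by (simp only: scaleC_mult_left zn)
  qed
  have coeff: "(\<Sum>k<n. z k ^ (n - l)) = (if l = 0 then of_nat n * of_real r ^ n else 0)" if "l < n" for l
  proof -
    have "z k ^ (n - l) = of_real r ^ (n - l) * (unity_root n k ^ 0 / unity_root n k ^ l)" for k
      using that assms by (simp add: z_def power_mult_distrib power_diff unity_root_power_self)
    then have "(\<Sum>k<n. z k ^ (n - l)) = of_real r ^ (n - l) * (\<Sum>k<n. unity_root n k ^ 0 / unity_root n k ^ l)"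
      by (simp only: sum_distrib_left)
    then show ?thesis
      unfolding sum_unity_root[OF assms(3) that] by auto
  qed
  have "(\<Sum>k<n. z k *\<^sub>C R (z k)) * (of_real r ^ n *\<^sub>C 1 - T ^ n) = (\<Sum>l<n. \<Sum>k<n. z k ^ (n - l) *\<^sub>C T ^ l)"
    by (simp only: sum_distrib_right step) (rule sum.swap)
  also have "\<dots> = (\<Sum>l<n. if l = 0 then (of_nat n * of_real r ^ n) *\<^sub>C 1 else 0)"
    by (intro sum.cong refl) (auto simp: coeff simp flip: scaleC_sum_left)
  also have "\<dots> = (of_nat n * of_real r ^ n) *\<^sub>C 1"
    using assms by simp
  finally have main: "(\<Sum>k<n. z k *\<^sub>C R (z k)) * (of_real r ^ n *\<^sub>C 1 - T ^ n) = (of_nat n * of_real r ^ n) *\<^sub>C 1" .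
  have "1 - (1 / r ^ n) *\<^sub>R T ^ n = (1 / of_real r ^ n) *\<^sub>C (of_real r ^ n *\<^sub>C 1 - T ^ n)"
    using assms by (simp add: scaleC_diff_right scaleC_scaleC scaleR_scaleC)
  then have "circle_mean r n (\<lambda>z. z *\<^sub>C R z) * (1 - (1 / r ^ n) *\<^sub>R T ^ n)
      = (1 / of_nat n) *\<^sub>C (1 / of_real r ^ n) *\<^sub>C ((\<Sum>k<n. z k *\<^sub>C R (z k)) * (of_real r ^ n *\<^sub>C 1 - T ^ n))"
    by (simp add: circle_mean_def scaleR_scaleC scaleC_mult_left scaleC_mult_right scaleC_scaleC mult.commute flip: z_def)
  then show ?thesis
    using assms unfolding main by (simp add: scaleC_scaleC)
qed

lemma norm_circle_mean_le:
  fixes h :: "complex \<Rightarrow> 'b::real_normed_vector"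
  assumes "n > 0" "r \<ge> 0" "\<And>z. cmod z = r \<Longrightarrow> norm (h z) \<le> K"
  shows "norm (circle_mean r n h) \<le> K"
proof -
  have "norm (\<Sum>k<n. h (of_real r * unity_root n k)) \<le> (\<Sum>k<n. K)"
    using assms by (intro sum_norm_le) (simp add: norm_mult)
  then show ?thesis
    using assms(1) by (simp add: circle_mean_def field_simps)
qed

text \<open>Write \<open>f t n\<close> for the inverse of \<open>1 - T ^ n / t ^ n\<close> given by
  \<open>circle_mean_resolvent\<close>. At radius \<open>r\<close> it tends to 1 by assumption, and
  passing from \<open>r\<close> to \<open>s\<close> changes it by at most 1/4, uniformly in
  \<open>n\<close>. So at radius \<open>s\<close> it stays within 1/2 of 1, which bounds its inverse
  and hence \<open>T ^ n / s ^ n\<close>.\<close>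

lemma decays_step:
  fixes T :: "'a::complex_normed_vector cop"
  assumes R: "resolvent_map T R" and a: "1 < a"
    and M: "\<And>z. a \<le> cmod z \<Longrightarrow> cmod z \<le> b \<Longrightarrow> norm (R z) \<le> M"
    and rs: "a \<le> s" "s \<le> r" "r \<le> b" and close: "(M + b * M\<^sup>2) * (r - s) \<le> 1 / 4"
    and r: "decays T r"
  shows "\<forall>\<^sub>F n in sequentially. norm (T ^ n) \<le> 3 * s ^ n"
proof -
  define f where "f r n = circle_mean r n (\<lambda>z. z *\<^sub>C R z)" for r n
  have b: "b \<ge> 1"
    using a rs by simp
  have "norm (R (of_real r)) \<le> M"
    using a rs by (intro M) auto
  then have M0: "0 \<le> M"
    using norm_ge_zero order_trans by blast
  have lip: "norm (f r n - f s n) \<le> 1 / 4" if n: "n > 0" for n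
  proof -
    have "norm ((of_real r * u) *\<^sub>C R (of_real r * u) - (of_real s * u) *\<^sub>C R (of_real s * u)) \<le> 1 / 4"
      if u: "cmod u = 1" for u
    proof -
      define z w where "z = of_real r * u" and "w = of_real s * u"
      have zw: "cmod z = r" "cmod w = s" "cmod (z - w) = r - s"
        using u a rs by (auto simp: z_def w_def norm_mult simp flip: left_diff_distrib of_real_diff)
      have Rz: "norm (R z) \<le> M" "norm (R w) \<le> M"
        using zw rs by (auto intro: M)
      have "z *\<^sub>C R z - w *\<^sub>C R w = (z - w) *\<^sub>C R z + w *\<^sub>C (R z - R w)"
        by (simp add: scaleC_diff_left scaleC_diff_right)
      also have "R z - R w = (w - z) *\<^sub>C (R z * R w)"
        using zw a rs by (intro resolvent_map_diff[OF R]) auto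
      finally have "norm (z *\<^sub>C R z - w *\<^sub>C R w)
          \<le> norm ((z - w) *\<^sub>C R z) + norm (w *\<^sub>C (w - z) *\<^sub>C (R z * R w))"
        by (simp add: norm_triangle_ineq)
      also have "\<dots> \<le> (r - s) * M + b * ((r - s) * (M * M))"
      proof (rule add_mono)
        show "norm ((z - w) *\<^sub>C R z) \<le> (r - s) * M"
          unfolding norm_scaleC zw using Rz rs by (intro mult_left_mono) auto
        have "norm (R z * R w) \<le> M * M"
          using Rz M0 by (intro order_trans[OF norm_mult_ineq] mult_mono) auto
        then show "norm (w *\<^sub>C (w - z) *\<^sub>C (R z * R w)) \<le> b * ((r - s) * (M * M))"
          unfolding norm_scaleC norm_minus_commute[of w z] zw using rs a b
          by (intro mult_mono) auto
      qed
      also have "\<dots> \<le> 1 / 4"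
        using close by (simp add: algebra_simps power2_eq_square)
      finally show ?thesis
        by (simp add: z_def w_def)
    qed
    then have "norm (\<Sum>k<n. (of_real r * unity_root n k) *\<^sub>C R (of_real r * unity_root n k)
        - (of_real s * unity_root n k) *\<^sub>C R (of_real s * unity_root n k)) \<le> (\<Sum>k<n. 1 / 4)"
      by (intro sum_norm_le) simp
    moreover have "f r n - f s n = (1 / real n) *\<^sub>R (\<Sum>k<n. (of_real r * unity_root n k) *\<^sub>C R (of_real r * unity_root n k)
        - (of_real s * unity_root n k) *\<^sub>C R (of_real s * unity_root n k))"
      by (simp only: f_def circle_mean_def scaleR_diff_right sum_subtractf)
    ultimately show ?thesis
      using n by (simp add: divide_le_eq)
  qed
  have bound: "norm (f r n) \<le> b * M" if "n > 0" for n
    unfolding f_def using that a rs M0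
    by (intro norm_circle_mean_le) (auto simp: norm_scaleC intro!: mult_mono M)
  have "\<forall>\<^sub>F n in sequentially. norm (T ^ n) / r ^ n < 1 / (4 * (b * M + 1))"
    using r b M0 unfolding decays_def by (intro order_tendstoD) (auto intro!: add_nonneg_pos)
  then show ?thesis
    using eventually_gt_at_top[of 0]
  proof eventually_elim
    case (elim n)
    have eq: "f t n * (1 - (1 / t ^ n) *\<^sub>R T ^ n) = 1" if "t \<ge> a" for t
      unfolding f_def using that a elim(2) by (intro circle_mean_resolvent[OF R]) auto
    define X where "X = (1 / r ^ n) *\<^sub>R T ^ n"
    have X: "norm X \<le> 1 / (4 * (b * M + 1))"
      using elim(1) a rs by (simp add: X_def)
    have "f r n - 1 = f r n * X"
      using eq[of r] rs by (simp add: X_def right_diff_distrib algebra_simps)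
    then have "norm (f r n - 1) \<le> norm (f r n) * norm X"
      using norm_mult_ineq by metis
    also have "\<dots> \<le> (b * M) * (1 / (4 * (b * M + 1)))"
      using X bound[OF elim(2)] b M0 by (intro mult_mono) auto
    also have "\<dots> \<le> 1 / 4"
    proof -
      have "0 \<le> b * M"
        using b M0 by simp
      then show ?thesis
        by (simp add: divide_le_eq)
    qed
    finally have "norm (f r n - 1) \<le> 1 / 4" .
    then have half: "norm (f s n - 1) \<le> 1 / 2"
      using lip[OF elim(2)] norm_triangle_ineq4[of "f r n - 1" "f r n - f s n"] by simp
    define Y where "Y = (1 / s ^ n) *\<^sub>R T ^ n"
    \<comment> \<open>The unknown norm of \<open>1 - Y\<close> occurs on both sides; the factor 1/2
      on the right lets it be absorbed.\<close>
    have "1 - Y = 1 - (f s n - 1) * (1 - Y)"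
      using eq[of s] rs by (simp add: Y_def left_diff_distrib)
    then have "norm (1 - Y) \<le> norm (1 :: 'a cop) + norm ((f s n - 1) * (1 - Y))"
      using norm_triangle_ineq4[of "1 :: 'a cop" "(f s n - 1) * (1 - Y)"] by simp
    also have "\<dots> \<le> 1 + 1 / 2 * norm (1 - Y)"
      using half norm_one_cop_le by (intro add_mono order_trans[OF norm_mult_ineq] mult_right_mono) auto
    finally have "norm (1 - Y) \<le> 2"
      by simp
    then have "norm Y \<le> 3"
      using norm_triangle_ineq4[of "1 :: 'a cop" "1 - Y"] norm_one_cop_le[where 'a = 'a] by simp
    then show ?case
      using a rs by (simp add: Y_def divide_le_eq)
  qed
qed

text \<open>The spectral radius bound. Decay is clear at a radius \<open>b\<close> above
  \<open>norm T + 1\<close>, and \<open>decays_step\<close> carries it down. The admissible step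
  length depends only on a resolvent bound on the fixed annulus between \<open>a\<close> and
  \<open>b\<close>, so finitely many steps reach \<open>r\<close>.\<close>

lemma decays_outside_disc:
  fixes T :: "'a::complex_normed_vector cop"
  assumes R: "resolvent_map T R"
    and M: "\<And>a b. 1 < a \<Longrightarrow> \<exists>M. \<forall>z. a \<le> cmod z \<and> cmod z \<le> b \<longrightarrow> norm (R z) \<le> M"
    and r: "r > 1"
  shows "decays T r"
proof -
  define a where "a = (1 + r) / 2"
  define b where "b = norm T + 2 + r"
  have a: "1 < a" "a < r" and b: "r < b"
    using r by (auto simp: a_def b_def intro: add_nonneg_pos)
  obtain M where M': "\<And>z. a \<le> cmod z \<Longrightarrow> cmod z \<le> b \<Longrightarrow> norm (R z) \<le> M"
    using M[OF a(1), of b] by blast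
  have "norm (R (of_real r)) \<le> M"
    using a b r by (intro M') auto
  then have M0: "0 \<le> M"
    using norm_ge_zero order_trans by blast
  define L where "L = M + b * M\<^sup>2"
  have L: "L \<ge> 0"
    using M0 b r by (simp add: L_def)
  \<comment> \<open>The first term keeps every radius that occurs above \<open>a\<close>; the second
    makes a step of length \<eta> satisfy the closeness condition of
    \<open>decays_step\<close>.\<close>
  define \<eta> where "\<eta> = min (r - a) (1 / (4 * (L + 1)))"
  have "L * \<eta> \<le> L * (1 / (4 * (L + 1)))"
    using L by (intro mult_left_mono) (auto simp: \<eta>_def)
  also have "\<dots> \<le> 1 / 4"
    using L by (simp add: field_simps)
  finally have \<eta>: "\<eta> > 0" "\<eta> \<le> r - a" "L * \<eta> \<le> 1 / 4"
    using a L by (auto simp: \<eta>_def)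
  have "decays T (max r (b - real j * (\<eta> / 2)))" for j
  proof (induction j)
    case 0
    have "decays T b"
    proof (rule decays_if_bounded[where K = 1 and s = "norm T + 1"])
      have "norm (T ^ n) \<le> 1 * (norm T + 1) ^ n" for n
        using norm_power_cop_le[of T n] power_mono[of "norm T" "norm T + 1" n] by simp
      then show "\<forall>\<^sub>F n in sequentially. norm (T ^ n) \<le> 1 * (norm T + 1) ^ n"
        by simp
    qed (use r in \<open>auto simp: b_def intro: add_nonneg_pos\<close>)
    then show ?case
      using b by simp
  next
    case (Suc j)
    define s where "s = max r (b - real j * (\<eta> / 2))"
    define t where "t = max r (b - real (Suc j) * (\<eta> / 2))"
    have st: "t \<le> s" "s - \<eta> / 2 \<le> t" "r \<le> t" "s \<le> b"
    proof -
      define p where "p = b - real j * (\<eta> / 2)"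
      have "b - real (Suc j) * (\<eta> / 2) = p - \<eta> / 2" "p \<le> b"
        using \<eta> by (simp_all add: p_def algebra_simps)
      then show "t \<le> s" "s - \<eta> / 2 \<le> t" "r \<le> t" "s \<le> b"
        using \<eta> b unfolding s_def t_def p_def[symmetric] by auto
    qed
    \<comment> \<open>The bound is obtained a little below the target \<open>t\<close>, because a
      bound of order \<open>s ^ n\<close> yields decay only at radii larger than
      \<open>s\<close>.\<close>
    have "\<forall>\<^sub>F n in sequentially. norm (T ^ n) \<le> 3 * (t - \<eta> / 4) ^ n"
    proof (rule decays_step[where a = a and b = b and M = M and r = s, OF R a(1)])
      have "L * (s - (t - \<eta> / 4)) \<le> L * \<eta>"
        using st \<eta> L by (intro mult_left_mono) auto
      then show "(M + b * M\<^sup>2) * (s - (t - \<eta> / 4)) \<le> 1 / 4"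
        using \<eta> by (simp add: L_def)
      show "decays T s"
        using Suc by (simp add: s_def)
    qed (use M' st \<eta> in auto)
    then have "decays T t"
      using st \<eta> a by (intro decays_if_bounded[where K = 3 and s = "t - \<eta> / 4"]) auto
    then show ?case
      by (simp add: t_def)
  qed
  moreover obtain j :: nat where "(b - r) / (\<eta> / 2) \<le> real j"
    using real_arch_simple by blast
  then have "max r (b - real j * (\<eta> / 2)) = r"
    using \<eta> by (simp add: field_simps)
  ultimately show ?thesis
    by metis
qed

text \<open>Growth of the powers at an intermediate radius makes the Neumann series converge. Its
  sum is a right inverse of \<open>1 - T / z\<close> and therefore agrees with the left inverse
  \<open>z R(z)\<close>.\<close>

lemma expands_resolvent:
  fixes T :: "'a::{complex_normed_vector, banach} cop"
  assumes R: "resolvent_map T R" and dec: "\<And>r. r > 1 \<Longrightarrow> decays T r" and r: "r > 1"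
  shows "expands r (\<lambda>z. z *\<^sub>C R z) (\<lambda>l. T ^ l)"
proof -
  define s where "s = (1 + r) / 2"
  have s: "1 < s" "s < r"
    using r by (auto simp: s_def)
  have "\<forall>\<^sub>F n in sequentially. norm (T ^ n) / s ^ n < 1"
    using dec[OF s(1)] unfolding decays_def by (intro order_tendstoD) auto
  then have ev: "\<forall>\<^sub>F n in sequentially. norm (norm (T ^ n) / r ^ n) \<le> (s / r) ^ n"
  proof eventually_elim
    case (elim n)
    then have "norm (T ^ n) / r ^ n \<le> s ^ n / r ^ n"
      using s r by (intro divide_right_mono) (auto simp: divide_less_eq)
    then show ?case
      using s by (simp add: power_divide)
  qed
  have sm: "summable (\<lambda>l. norm (T ^ l) / r ^ l)"
    using s by (intro summable_comparison_test_ev[OF ev] summable_geometric) auto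
  moreover have "(\<lambda>l. (1 / z ^ l) *\<^sub>C T ^ l) sums (z *\<^sub>C R z)" if z: "cmod z = r" for z
  proof -
    define S where "S = (1 / z) *\<^sub>C T"
    have S: "S ^ l = (1 / z ^ l) *\<^sub>C T ^ l" for l
      by (simp add: S_def scaleC_power power_divide)
    have "summable (\<lambda>l. norm (S ^ l))"
      using sm z by (simp add: S norm_scaleC norm_divide norm_power)
    then have smS: "summable (\<lambda>l. S ^ l)"
      by (rule summable_norm_cancel)
    have "(\<Sum>l. S ^ Suc l) = (\<Sum>l. S ^ l) - 1"
      using suminf_split_head[OF smS] by simp
    moreover have "(\<Sum>l. S ^ Suc l) = S * (\<Sum>l. S ^ l)"
      using bounded_linear.suminf[OF bounded_linear_mult_right smS] by simp
    ultimately have "S * (\<Sum>l. S ^ l) = (\<Sum>l. S ^ l) - 1"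
      by simp
    then have "(1 - S) * (\<Sum>l. S ^ l) = 1"
      by (simp only: left_diff_distrib mult_1_left) simp
    moreover have "(z *\<^sub>C R z) * (1 - S) = 1"
    proof -
      have "z \<noteq> 0"
        using z r by auto
      then have "z *\<^sub>C (1 - S) = z *\<^sub>C 1 - T"
        by (simp add: S_def scaleC_diff_right scaleC_scaleC)
      then have "R z * (z *\<^sub>C (1 - S)) = 1"
        using resolvent_mapD(1)[OF R, of z] z r by simp
      then show ?thesis
        by (simp add: scaleC_mult_left scaleC_mult_right)
    qed
    ultimately have "(\<Sum>l. S ^ l) = z *\<^sub>C R z"
      by (metis mult.assoc mult_1_left mult_1_right)
    then show ?thesis
      using summable_sums[OF smS] by (simp add: S)
  qed
  ultimately show ?thesis
    by (simp add: expands_def)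
qed

section \<open>Partial fractions and the quadratic mean of 1/p\<close>

lemma partial_fractions:
  fixes a :: "'i \<Rightarrow> complex"
  assumes "finite J" "J \<noteq> {}" "inj_on a J"
  shows "\<exists>c. (\<Sum>j\<in>J. smult (c j) (\<Prod>i\<in>J - {j}. [:1, - a i:])) = 1"
  using assms
proof (induction J rule: finite_ne_induct)
  case (singleton k)
  show ?case
    by (intro exI[of _ "\<lambda>_. 1"]) simp
next
  case (insert k J)
  then obtain c where c: "(\<Sum>j\<in>J. smult (c j) (\<Prod>i\<in>J - {j}. [:1, - a i:])) = 1"
    by auto
  let ?f = "\<lambda>i. [:1, - a i:]"
  have ne: "a j - a k \<noteq> 0" if "j \<in> J" for j
    using insert.prems insert.hyps that by (auto simp: inj_on_def)
  \<comment> \<open>The induction rests on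
    \<open>a j - a k = a j * (1 - a k * X) - a k * (1 - a j * X)\<close>, divided by
    \<open>a j - a k\<close>. The result is an identity of polynomials, so it holds for operators as
    well as for numbers.\<close>
  have split: "smult (c j) (\<Prod>i\<in>J - {j}. ?f i)
      = smult (c j * a j / (a j - a k)) (\<Prod>i\<in>insert k J - {j}. ?f i)
        - smult (c j * a k / (a j - a k)) (\<Prod>i\<in>J. ?f i)" if j: "j \<in> J" for j
  proof -
    have "insert k J - {j} = insert k (J - {j})"
      using j insert.hyps by auto
    then have 1: "(\<Prod>i\<in>insert k J - {j}. ?f i) = ?f k * (\<Prod>i\<in>J - {j}. ?f i)"
      using insert.hyps by simp
    have 2: "(\<Prod>i\<in>J. ?f i) = ?f j * (\<Prod>i\<in>J - {j}. ?f i)"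
      using insert.hyps j by (simp add: prod.remove)
    have "smult (c j * a j / (a j - a k)) (?f k) - smult (c j * a k / (a j - a k)) (?f j) = [:c j:]"
    proof -
      have "c j * a j / (a j - a k) - c j * a k / (a j - a k) = c j"
        using ne[OF j] by (simp flip: diff_divide_distrib right_diff_distrib)
      then show ?thesis
        by (simp add: mult_ac)
    qed
    then have "[:c j:] * (\<Prod>i\<in>J - {j}. ?f i)
        = smult (c j * a j / (a j - a k)) (?f k) * (\<Prod>i\<in>J - {j}. ?f i)
          - smult (c j * a k / (a j - a k)) (?f j) * (\<Prod>i\<in>J - {j}. ?f i)"
      by (simp only: left_diff_distrib[symmetric])
    then show ?thesis
      unfolding 1 2 by (simp only: mult_smult_left) simp
  qed
  define c' where "c' j = (if j = k then - (\<Sum>j\<in>J. c j * a k / (a j - a k)) else c j * a j / (a j - a k))" for j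
  have "(\<Sum>j\<in>insert k J. smult (c' j) (\<Prod>i\<in>insert k J - {j}. ?f i))
      = smult (c' k) (\<Prod>i\<in>J. ?f i) + (\<Sum>j\<in>J. smult (c j * a j / (a j - a k)) (\<Prod>i\<in>insert k J - {j}. ?f i))"
  proof -
    have "(\<Sum>j\<in>J. smult (c' j) (\<Prod>i\<in>insert k J - {j}. ?f i))
        = (\<Sum>j\<in>J. smult (c j * a j / (a j - a k)) (\<Prod>i\<in>insert k J - {j}. ?f i))"
      using insert.hyps by (intro sum.cong) (auto simp: c'_def)
    then show ?thesis
      using insert.hyps by simp
  qed
  also have "smult (c' k) (\<Prod>i\<in>J. ?f i) = - (\<Sum>j\<in>J. smult (c j * a k / (a j - a k)) (\<Prod>i\<in>J. ?f i))"
    by (simp add: c'_def smult_sum)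
  also have "\<dots> + (\<Sum>j\<in>J. smult (c j * a j / (a j - a k)) (\<Prod>i\<in>insert k J - {j}. ?f i))
      = (\<Sum>j\<in>J. smult (c j) (\<Prod>i\<in>J - {j}. ?f i))"
    by (simp add: split sum_subtractf)
  finally show ?case
    using c by (intro exI[of _ c']) simp
qed

lemma circle_mean_mono:
  fixes f g :: "complex \<Rightarrow> real"
  assumes "r \<ge> 0" "\<And>z. cmod z = r \<Longrightarrow> f z \<le> g z"
  shows "circle_mean r n f \<le> circle_mean r n g"
  unfolding circle_mean_def real_scaleR_def using assms
  by (intro mult_left_mono sum_mono) (auto simp: norm_mult)

lemma circle_mean_sum_mult:
  "circle_mean r n (\<lambda>z. \<Sum>j\<in>J. d j * h j z) = (\<Sum>j\<in>J. d j * circle_mean r n (h j) :: real)"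
  unfolding circle_mean_def real_scaleR_def
  by (subst sum.swap) (simp add: sum_distrib_left mult_ac)

text \<open>Partial fractions write 1/p as a combination of the simple poles 1 / (1 - cnj (\<xi> j)
  z). Cauchy-Schwarz passes to the squares, and these are the Poisson kernels of
  \<open>circle_mean_poisson\<close>.\<close>

lemma circle_mean_inverse_poly_le:
  fixes \<xi> :: "'i \<Rightarrow> complex"
  assumes J: "finite J" "J \<noteq> {}" "inj_on \<xi> J" "\<And>j. j \<in> J \<Longrightarrow> cmod (\<xi> j) = 1"
  shows "\<exists>A>0. \<forall>r>1. \<forall>\<^sub>F n in sequentially.
    circle_mean r n (\<lambda>z. 1 / (cmod (poly (\<Prod>j\<in>J. [:1, - cnj (\<xi> j):]) z))\<^sup>2) \<le> A / (r\<^sup>2 - 1)"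
proof -
  let ?p = "\<Prod>j\<in>J. [:1, - cnj (\<xi> j):]"
  have "inj_on (\<lambda>j. cnj (\<xi> j)) J"
    using J(3) by (auto simp: inj_on_def)
  from partial_fractions[OF J(1,2) this] obtain c
    where c: "(\<Sum>j\<in>J. smult (c j) (\<Prod>i\<in>J - {j}. [:1, - cnj (\<xi> i):])) = 1"
    by blast
  define D where "D = real (card J) * (\<Sum>j\<in>J. (cmod (c j))\<^sup>2)"
  have D: "D \<ge> 0"
    by (simp add: D_def sum_nonneg)
  have point: "1 / (cmod (poly ?p z))\<^sup>2
      \<le> (\<Sum>j\<in>J. (real (card J) * (cmod (c j))\<^sup>2) * (1 / (cmod (1 - cnj (\<xi> j) * z))\<^sup>2))"
    if z: "cmod z > 1" for z
  proof -
    have ne: "1 - cnj (\<xi> j) * z \<noteq> 0" if "j \<in> J" for j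
    proof
      assume "1 - cnj (\<xi> j) * z = 0"
      then have "cmod (cnj (\<xi> j) * z) = 1"
        by simp
      then show False
        using J(4)[OF that] z by (simp add: norm_mult)
    qed
    then have p: "poly ?p z \<noteq> 0"
      using J(1) by (simp add: poly_prod mult.commute)
    have "1 = poly (\<Sum>j\<in>J. smult (c j) (\<Prod>i\<in>J - {j}. [:1, - cnj (\<xi> i):])) z"
      by (simp add: c)
    also have "\<dots> = (\<Sum>j\<in>J. c j * (\<Prod>i\<in>J - {j}. 1 - cnj (\<xi> i) * z))"
      by (simp add: poly_sum poly_prod mult.commute)
    also have "\<dots> = (\<Sum>j\<in>J. c j * (poly ?p z / (1 - cnj (\<xi> j) * z)))"
    proof (intro sum.cong refl)
      fix j assume j: "j \<in> J"
      have "poly ?p z = (\<Prod>i\<in>J. 1 - cnj (\<xi> i) * z)"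
        by (simp add: poly_prod mult.commute)
      also have "\<dots> = (1 - cnj (\<xi> j) * z) * (\<Prod>i\<in>J - {j}. 1 - cnj (\<xi> i) * z)"
        by (rule prod.remove[OF J(1) j])
      finally have "poly ?p z = (1 - cnj (\<xi> j) * z) * (\<Prod>i\<in>J - {j}. 1 - cnj (\<xi> i) * z)" .
      then show "c j * (\<Prod>i\<in>J - {j}. 1 - cnj (\<xi> i) * z) = c j * (poly ?p z / (1 - cnj (\<xi> j) * z))"
        using ne[OF j] by simp
    qed
    finally have "1 / poly ?p z = (\<Sum>j\<in>J. c j * (poly ?p z / (1 - cnj (\<xi> j) * z))) / poly ?p z"
      by (rule arg_cong[where f = "\<lambda>v. v / poly ?p z"])
    also have "\<dots> = (\<Sum>j\<in>J. c j / (1 - cnj (\<xi> j) * z))"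
      unfolding sum_divide_distrib using p by (intro sum.cong refl) simp
    finally have "1 / poly ?p z = (\<Sum>j\<in>J. c j / (1 - cnj (\<xi> j) * z))" .
    then have "1 / cmod (poly ?p z) = cmod (\<Sum>j\<in>J. c j / (1 - cnj (\<xi> j) * z))"
      by (metis norm_divide norm_one)
    also have "\<dots> \<le> (\<Sum>j\<in>J. cmod (c j) / cmod (1 - cnj (\<xi> j) * z))"
      by (rule order_trans[OF norm_sum]) (simp add: norm_divide)
    finally have "(1 / cmod (poly ?p z))\<^sup>2 \<le> (\<Sum>j\<in>J. cmod (c j) / cmod (1 - cnj (\<xi> j) * z))\<^sup>2"
      by (intro power_mono) auto
    also have "\<dots> \<le> real (card J) * (\<Sum>j\<in>J. (cmod (c j) / cmod (1 - cnj (\<xi> j) * z))\<^sup>2)"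
      by (rule mean_power2_ge[OF J(1)])
    finally show ?thesis
      by (simp add: power_divide sum_distrib_left)
  qed
  show ?thesis
  proof (intro exI[of _ "D + 1"] conjI allI impI)
    fix r :: real
    assume r: "r > 1"
    have "(\<lambda>n. \<Sum>j\<in>J. (real (card J) * (cmod (c j))\<^sup>2) * circle_mean r n (\<lambda>z. 1 / (cmod (1 - cnj (\<xi> j) * z))\<^sup>2))
        \<longlonglongrightarrow> (\<Sum>j\<in>J. (real (card J) * (cmod (c j))\<^sup>2) * (1 / (r\<^sup>2 - 1)))"
      using J(4) by (intro tendsto_sum tendsto_mult tendsto_const circle_mean_poisson[OF r])
    also have "(\<Sum>j\<in>J. (real (card J) * (cmod (c j))\<^sup>2) * (1 / (r\<^sup>2 - 1))) = D / (r\<^sup>2 - 1)"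
      by (simp add: D_def sum_distrib_left sum_divide_distrib)
    finally have lim: "(\<lambda>n. \<Sum>j\<in>J. (real (card J) * (cmod (c j))\<^sup>2) * circle_mean r n (\<lambda>z. 1 / (cmod (1 - cnj (\<xi> j) * z))\<^sup>2))
        \<longlonglongrightarrow> D / (r\<^sup>2 - 1)" .
    \<comment> \<open>The quadrature of the majorant converges to the left side; the additional 1
      makes the inequality strict, so that it holds for all large \<open>n\<close>.\<close>
    have "D / (r\<^sup>2 - 1) < (D + 1) / (r\<^sup>2 - 1)"
      using r by (intro divide_strict_right_mono) auto
    from order_tendstoD(2)[OF lim this]
    show "\<forall>\<^sub>F n in sequentially. circle_mean r n (\<lambda>z. 1 / (cmod (poly ?p z))\<^sup>2) \<le> (D + 1) / (r\<^sup>2 - 1)"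
    proof eventually_elim
      case (elim n)
      have "circle_mean r n (\<lambda>z. 1 / (cmod (poly ?p z))\<^sup>2)
          \<le> circle_mean r n (\<lambda>z. \<Sum>j\<in>J. (real (card J) * (cmod (c j))\<^sup>2) * (1 / (cmod (1 - cnj (\<xi> j) * z))\<^sup>2))"
        using r by (intro circle_mean_mono point) auto
      also have "\<dots> \<le> (D + 1) / (r\<^sup>2 - 1)"
        unfolding circle_mean_sum_mult using elim by simp
      finally show ?case .
    qed
  qed (use D in simp)
qed

section \<open>R-bounds for the powers from means over circles\<close>

lemma acomb_circle_mean:
  assumes "r \<ge> 0" "\<And>z. cmod z = r \<Longrightarrow> G z \<in> F" "circle_mean r n (\<lambda>z. cmod (w z)) \<le> K"
  shows "acomb K F (circle_mean r n (\<lambda>z. w z *\<^sub>C G z))"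
proof -
  have "acomb K F (\<Sum>k<n. ((1 / of_nat n) * w (of_real r * unity_root n k)) *\<^sub>C G (of_real r * unity_root n k))"
  proof (rule acombI)
    show "(\<Sum>k<n. cmod ((1 / of_nat n) * w (of_real r * unity_root n k))) \<le> K"
      using assms(3) by (simp add: circle_mean_def norm_mult norm_divide sum_distrib_left)
  qed (use assms in \<open>auto simp: norm_mult\<close>)
  then show ?thesis
    by (simp add: circle_mean_def scaleR_scaleC scaleC_sum_right scaleC_scaleC)
qed

text \<open>On the circle of radius r = 1 + 1/m the weight is \<kappa> z^(m + e) / p(z)^2. Here r^m
  \<le> 3 and r^e \<le> 8 give the constant 24. The mean of 1/|p|^2 is at most A / (r^2 - 1) \<le> A
  m / 2, and the factor 2/m allowed for \<kappa> cancels it.\<close>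

lemma Rbd_of_expansions:
  fixes F :: "'a::{complex_normed_vector, banach} cop set"
  assumes F: "Rbd C F" "F \<noteq> {}" and A: "A > 0"
    and p: "\<And>r. r > 1 \<Longrightarrow> \<forall>\<^sub>F n in sequentially. circle_mean r n (\<lambda>z. 1 / (cmod (poly p z))\<^sup>2) \<le> A / (r\<^sup>2 - 1)"
    and H: "\<And>U. U \<in> H \<Longrightarrow> \<exists>m\<ge>1. \<exists>\<Phi> g e \<kappa>. e \<le> 3 \<and> cmod \<kappa> \<le> 2 / real m \<and>
      expands (1 + 1 / real m) \<Phi> g \<and> U = \<kappa> *\<^sub>C g m \<and>
      (\<forall>z. cmod z = 1 + 1 / real m \<longrightarrow> (\<exists>G\<in>F. \<Phi> z = (z ^ e / (poly p z)\<^sup>2) *\<^sub>C G))"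
  shows "Rbd (2 * C * (24 * A)) H"
proof (rule Rbd_acomb_limit[OF F])
  fix U
  assume "U \<in> H"
  then obtain m :: nat and \<Phi> g and e :: nat and \<kappa>
    where m: "m \<ge> 1" and e: "e \<le> 3" and \<kappa>: "cmod \<kappa> \<le> 2 / real m"
      and ex: "expands (1 + 1 / real m) \<Phi> g" and U: "U = \<kappa> *\<^sub>C g m"
      and \<Phi>: "\<forall>z. cmod z = 1 + 1 / real m \<longrightarrow> (\<exists>G\<in>F. \<Phi> z = (z ^ e / (poly p z)\<^sup>2) *\<^sub>C G)"
    using H by blast
  define r where "r = 1 + 1 / real m"
  have r: "r > 1" "r \<le> 2"
    using m by (auto simp: r_def)
  obtain G where G: "\<And>z. cmod z = r \<Longrightarrow> G z \<in> F \<and> \<Phi> z = (z ^ e / (poly p z)\<^sup>2) *\<^sub>C G z"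
    using \<Phi> unfolding r_def[symmetric] by metis
  define w where "w z = \<kappa> * z ^ (m + e) / (poly p z)\<^sup>2" for z
  define X where "X n = circle_mean r n (\<lambda>z. w z *\<^sub>C G z)" for n
  have Xn: "X n = \<kappa> *\<^sub>C circle_mean r n (\<lambda>z. z ^ m *\<^sub>C \<Phi> z)" for n
    using r unfolding X_def circle_mean_def
    by (simp add: G norm_mult w_def scaleC_scaleR_commute scaleC_sum_right scaleC_scaleC power_add mult_ac)
  have "(\<lambda>n. \<kappa> *\<^sub>C circle_mean r n (\<lambda>z. z ^ m *\<^sub>C \<Phi> z)) \<longlonglongrightarrow> \<kappa> *\<^sub>C g m"
    using r ex unfolding r_def[symmetric]
    by (intro bounded_linear.tendsto[OF bounded_linear_scaleC] circle_mean_expands) auto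
  then have "X \<longlonglongrightarrow> U"
    unfolding U Xn[abs_def, symmetric] by simp
  moreover have "\<forall>\<^sub>F n in sequentially. acomb (24 * A) F (X n)"
    using p[OF r(1)]
  proof eventually_elim
    case (elim n)
    have rm: "r ^ (m + e) \<le> 24"
    proof -
      have "r ^ m \<le> exp (1 / real m) ^ m"
        unfolding r_def by (intro power_mono exp_ge_add_one_self) auto
      also have "\<dots> = exp 1"
        using m by (simp flip: exp_of_nat_mult)
      finally have "r ^ m \<le> 3"
        using exp_le by linarith
      moreover have "r ^ e \<le> 2 ^ 3"
        using r e by (intro order_trans[OF power_mono[of r 2] power_increasing]) auto
      ultimately show ?thesis
        using r mult_mono[of "r ^ m" 3 "r ^ e" 8] by (simp add: power_add)
    qed
    have "circle_mean r n (\<lambda>z. cmod (w z)) \<le> circle_mean r n (\<lambda>z. (2 / real m * 24) * (1 / (cmod (poly p z))\<^sup>2))"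
    proof (rule circle_mean_mono)
      fix z assume z: "cmod z = r"
      have "cmod \<kappa> * r ^ (m + e) \<le> 2 / real m * 24"
        using \<kappa> rm r by (intro mult_mono) auto
      then have "cmod \<kappa> * r ^ (m + e) * (1 / (cmod (poly p z))\<^sup>2) \<le> (2 / real m * 24) * (1 / (cmod (poly p z))\<^sup>2)"
        by (rule mult_right_mono) simp
      then show "cmod (w z) \<le> (2 / real m * 24) * (1 / (cmod (poly p z))\<^sup>2)"
        by (simp only: w_def norm_mult norm_divide norm_power z) simp
    qed (use r in simp)
    also have "\<dots> = (2 / real m * 24) * circle_mean r n (\<lambda>z. 1 / (cmod (poly p z))\<^sup>2)"
      using circle_mean_sum_mult[of r n "\<lambda>_. 2 / real m * 24" "\<lambda>_ z. 1 / (cmod (poly p z))\<^sup>2" "{()}"] by simp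
    also have "\<dots> \<le> (2 / real m * 24) * (A / (r\<^sup>2 - 1))"
      using elim by (intro mult_left_mono) auto
    also have "\<dots> \<le> (2 / real m * 24) * (A * (real m / 2))"
    proof (intro mult_left_mono)
      have "2 / real m \<le> r\<^sup>2 - 1"
        by (simp add: r_def power2_eq_square algebra_simps)
      then have "1 / (r\<^sup>2 - 1) \<le> real m / 2"
        using m r by (simp add: field_simps)
      then show "A / (r\<^sup>2 - 1) \<le> A * (real m / 2)"
        using A mult_left_mono[of "1 / (r\<^sup>2 - 1)" "real m / 2" A] by simp
    qed simp
    also have "\<dots> = 24 * A"
      using m by simp
    finally show ?case
      unfolding X_def using G r by (intro acomb_circle_mean) auto
  qed
  ultimately show "\<exists>X. (\<forall>\<^sub>F n in sequentially. acomb (24 * A) F (X n)) \<and> X \<longlonglongrightarrow> U"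
    by blast
qed (use A in simp)

text \<open>The operator is the divided difference (p(z) - p(T)) / (z - T), see
  \<open>peval_synthetic_div\<close>. Horner's recursion gives it, for \<open>pCons a p\<close>, as
  the scalar p(z) plus \<open>T\<close> times the one for \<open>p\<close>, and the scalar is
  bounded on the disc.\<close>

lemma Rbd_synthetic_div:
  fixes T :: "'a::complex_normed_vector cop"
  shows "\<exists>C. Rbd C {peval T (synthetic_div p z) | z. cmod z \<le> 3}"
proof (induction p)
  case 0
  have "{peval T (synthetic_div 0 z) | z. cmod z \<le> 3} \<subseteq> {0}"
    by auto
  then show ?case
    using Rbd_mono[OF Rbd_singleton order_refl] by blast
next
  case (pCons a p)
  then obtain C where C: "Rbd C {peval T (synthetic_div p z) | z. cmod z \<le> 3}"
    by blast
  obtain B where B: "B > 0" "\<And>z. cmod z \<le> 3 \<Longrightarrow> cmod (poly p z) \<le> B"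
    using poly_bound_exists[of 3 p] by blast
  have "{peval T (synthetic_div (pCons a p) z) | z. cmod z \<le> 3}
      \<subseteq> {S + U | S U. S \<in> {c *\<^sub>C S | c S. cmod c \<le> B \<and> S \<in> {1}} \<and>
          U \<in> {S * U | S U. S \<in> {T} \<and> U \<in> {peval T (synthetic_div p z) | z. cmod z \<le> 3}}}"
    using B(2) by (fastforce simp: synthetic_div_pCons)
  then show ?case
    using Rbd_mono[OF Rbd_add[OF Rbd_scaleC_le[OF Rbd_singleton B(1)] Rbd_mult[OF Rbd_singleton C]] order_refl]
    by blast
qed

lemma peval_synthetic_div:
  "poly p z *\<^sub>C 1 - peval T p = (z *\<^sub>C 1 - T) * peval T (synthetic_div p z)"
proof -
  have "peval T p = peval T ([:- z, 1:] * synthetic_div p z + [:poly p z:])"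
    by (simp only: synthetic_div_correct')
  also have "\<dots> = (T - z *\<^sub>C 1) * peval T (synthetic_div p z) + poly p z *\<^sub>C 1"
    unfolding peval_add peval_mult by (simp add: scaleC_minus_left)
  finally show ?thesis
    by (simp add: left_diff_distrib)
qed

text \<open>With V = z R(z), the m-th coefficient of V^2 is (m + 1) T^m and that of V^3 is (m + 1)(m
  + 2) T^m / 2. So T^m comes from V^2, and m T^m P from P V^3, each after multiplication by a scalar
  of order 1/m. Both functions are p^-2 times a power of \<open>z\<close> times an operator from an
  R-bounded set, as \<open>Rbd_of_expansions\<close> requires.\<close>

lemma Rbd_power_bounds:
  fixes T :: "'a::{complex_normed_vector, banach} cop" and \<xi> :: "'i \<Rightarrow> complex"
  assumes R: "resolvent_map T R"
    and J: "finite J" "J \<noteq> {}" "inj_on \<xi> J" "\<And>j. j \<in> J \<Longrightarrow> cmod (\<xi> j) = 1"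
    and p: "p = (\<Prod>j\<in>J. [:1, - cnj (\<xi> j):])"
    and Rbd: "\<And>C. C > 1 \<Longrightarrow> \<exists>D. Rbd D {poly p z *\<^sub>C R z | z. 1 < cmod z \<and> cmod z < C}"
  shows "\<exists>C. Rbd C (range (\<lambda>m. T ^ m))" "\<exists>C. Rbd C (range (\<lambda>m. real m *\<^sub>R (T ^ m * peval T p)))"
proof -
  let ?P = "peval T p"
  have factor_norm: "cmod z - 1 \<le> cmod (1 - cnj (\<xi> j) * z)" if "j \<in> J" for j z
    using norm_triangle_ineq3[of "cnj (\<xi> j) * z" 1] J(4)[OF that]
    by (simp add: norm_mult norm_minus_commute)
  have p_norm: "cmod (poly p z) \<ge> (cmod z - 1) ^ card J" if "cmod z \<ge> 1" for z
  proof -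
    have "(cmod z - 1) ^ card J = (\<Prod>j\<in>J. cmod z - 1)"
      by simp
    also have "\<dots> \<le> (\<Prod>j\<in>J. cmod (1 - cnj (\<xi> j) * z))"
      using that factor_norm by (intro prod_mono) auto
    finally show ?thesis
      by (simp add: p poly_prod norm_mult prod_norm mult.commute)
  qed
  have p_ne: "poly p z \<noteq> 0" if "cmod z > 1" for z
  proof -
    have "0 < (cmod z - 1) ^ card J"
      using that by simp
    then have "0 < cmod (poly p z)"
      using p_norm[of z] that by linarith
    then show ?thesis
      by simp
  qed
  \<comment> \<open>Away from the unit circle the crude lower bound for |p| is enough: only norm
    bounds on closed annuli are needed to control the growth of the powers.\<close>
  have bounded: "\<exists>M. \<forall>z. a \<le> cmod z \<and> cmod z \<le> b \<longrightarrow> norm (R z) \<le> M" if a: "1 < a" for a b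
  proof -
    obtain D where D: "Rbd D {poly p z *\<^sub>C R z | z. 1 < cmod z \<and> cmod z < max 2 (b + 1)}"
      using Rbd[of "max 2 (b + 1)"] by (auto simp: less_max_iff_disj)
    show ?thesis
    proof (intro exI[of _ "D / (a - 1) ^ card J"] allI impI, elim conjE)
      fix z assume z: "a \<le> cmod z" "cmod z \<le> b"
      have "norm (poly p z *\<^sub>C R z) \<le> D"
        using z a by (intro Rbd_norm_le[OF D]) auto
      then have "cmod (poly p z) * norm (R z) \<le> D"
        by (simp add: norm_scaleC)
      moreover have "(a - 1) ^ card J \<le> cmod (poly p z)"
        using z a by (intro order_trans[OF _ p_norm] power_mono) auto
      ultimately have "(a - 1) ^ card J * norm (R z) \<le> D"
        using mult_right_mono[of "(a - 1) ^ card J" "cmod (poly p z)" "norm (R z)"] by simp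
      then show "norm (R z) \<le> D / (a - 1) ^ card J"
        using a by (simp add: pos_le_divide_eq mult.commute)
    qed
  qed
  have decay: "decays T r" if "r > 1" for r
    using decays_outside_disc[OF R bounded that] .
  define V where "V z = z *\<^sub>C R z" for z
  have V: "expands r V (\<lambda>l. T ^ l)" if "r > 1" for r
    unfolding V_def using expands_resolvent[OF R decay that] .
  have V2: "expands r (\<lambda>z. V z * V z) (\<lambda>l. (real l + 1) *\<^sub>R T ^ l)" if "r > 1" for r
  proof -
    have "(\<Sum>i\<le>l. T ^ i * T ^ (l - i)) = (real l + 1) *\<^sub>R T ^ l" for l
      by (simp add: sum_constant_scaleR algebra_simps flip: power_add)
    then show ?thesis
      using expands_mult[OF _ V[OF that] V[OF that]] that by simp
  qed
  have V3: "expands r (\<lambda>z. V z * V z * V z) (\<lambda>l. ((real l + 1) * (real l + 2) / 2) *\<^sub>R T ^ l)" if "r > 1" for r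
  proof -
    have gauss: "(\<Sum>i\<le>l. real i + 1) = (real l + 1) * (real l + 2) / 2" for l :: nat
      by (induction l) (simp_all add: field_simps)
    have "(\<Sum>i\<le>l. ((real i + 1) *\<^sub>R T ^ i) * T ^ (l - i)) = (\<Sum>i\<le>l. (real i + 1) *\<^sub>R T ^ l)" for l
      by (intro sum.cong) (auto simp flip: power_add)
    then have "(\<Sum>i\<le>l. ((real i + 1) *\<^sub>R T ^ i) * T ^ (l - i)) = ((real l + 1) * (real l + 2) / 2) *\<^sub>R T ^ l" for l
      by (simp only: scaleR_sum_left[symmetric] gauss)
    then show ?thesis
      using expands_mult[OF _ V2[OF that] V[OF that]] that by simp
  qed
  obtain C where C: "Rbd C {poly p z *\<^sub>C R z | z. 1 < cmod z \<and> cmod z < 3}"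
    using Rbd[of 3] by auto
  let ?F = "{poly p z *\<^sub>C R z | z. 1 < cmod z \<and> cmod z < 3}"
  let ?F2 = "{S * U | S U. S \<in> ?F \<and> U \<in> ?F}"
  have F2: "Rbd (C * C) ?F2"
    by (rule Rbd_mult[OF C C])
  obtain B where B: "Rbd B {peval T (synthetic_div p z) | z. cmod z \<le> 3}"
    using Rbd_synthetic_div by blast
  let ?Q = "{c *\<^sub>C S | c S. cmod c \<le> 1 \<and> S \<in> {peval T (synthetic_div p z) | z. cmod z \<le> 3}}"
  let ?F3 = "{S + U | S U. S \<in> {S * U | S U. S \<in> ?F2 \<and> U \<in> ?F} \<and> U \<in> {S * U | S U. S \<in> ?Q \<and> U \<in> ?F2}}"
  have F3: "Rbd (C * C * C + 2 * B * (C * C)) ?F3"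
    by (intro Rbd_add Rbd_mult F2 C Rbd_scaleC B)
  obtain A where A: "A > 0" "\<And>r. r > 1 \<Longrightarrow> \<forall>\<^sub>F n in sequentially.
      circle_mean r n (\<lambda>z. 1 / (cmod (poly p z))\<^sup>2) \<le> A / (r\<^sup>2 - 1)"
    using circle_mean_inverse_poly_le[OF J] unfolding p by blast
  have V2_eq: "V z * V z = (z ^ 2 / (poly p z)\<^sup>2) *\<^sub>C ((poly p z *\<^sub>C R z) * (poly p z *\<^sub>C R z))"
    if "cmod z > 1" for z
    using p_ne[OF that]
    by (simp add: V_def scaleC_mult_left scaleC_mult_right scaleC_scaleC power2_eq_square)
  \<comment> \<open>One denominator disappears because \<open>?P * R z\<close> differs from
    \<open>poly p z *\<^sub>C R z\<close> by the synthetic quotient only. It is thus already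
    R-bounded without division by \<open>poly p z\<close>.\<close>
  have V3_eq: "?P * (V z * V z * V z) = (z ^ 3 / (poly p z)\<^sup>2) *\<^sub>C
      (((poly p z *\<^sub>C R z) * (poly p z *\<^sub>C R z)) * (poly p z *\<^sub>C R z)
       + ((- 1) *\<^sub>C peval T (synthetic_div p z)) * ((poly p z *\<^sub>C R z) * (poly p z *\<^sub>C R z)))"
    if z: "cmod z > 1" for z
  proof -
    let ?Qz = "peval T (synthetic_div p z)"
    have comm: "(z *\<^sub>C 1 - T) * ?Qz = ?Qz * (z *\<^sub>C 1 - T)"
      using peval_commute_T[of T 1 "synthetic_div p z"]
      by (simp add: left_diff_distrib right_diff_distrib scaleC_mult_left scaleC_mult_right)
    have "?P * R z = poly p z *\<^sub>C R z - (poly p z *\<^sub>C 1 - ?P) * R z"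
      by (simp add: left_diff_distrib scaleC_mult_left)
    also have "(poly p z *\<^sub>C 1 - ?P) * R z = ?Qz * ((z *\<^sub>C 1 - T) * R z)"
      unfolding peval_synthetic_div comm by (simp add: mult.assoc)
    also have "\<dots> = ?Qz"
      using resolvent_mapD(2)[OF R z] by simp
    finally have PR: "?P * R z = poly p z *\<^sub>C R z - ?Qz" .
    have "?P * (V z * V z * V z) = z ^ 3 *\<^sub>C ((?P * R z) * (R z * R z))"
      by (simp add: V_def scaleC_mult_left scaleC_mult_right scaleC_scaleC power3_eq_cube mult.assoc)
    also have "\<dots> = (z ^ 3 / (poly p z)\<^sup>2) *\<^sub>C ((?P * R z) * ((poly p z *\<^sub>C R z) * (poly p z *\<^sub>C R z)))"
      using p_ne[OF z] by (simp add: scaleC_mult_left scaleC_mult_right scaleC_scaleC power2_eq_square)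
    also have "(?P * R z) * ((poly p z *\<^sub>C R z) * (poly p z *\<^sub>C R z))
        = ((poly p z *\<^sub>C R z) * (poly p z *\<^sub>C R z)) * (poly p z *\<^sub>C R z)
          + ((- 1) *\<^sub>C ?Qz) * ((poly p z *\<^sub>C R z) * (poly p z *\<^sub>C R z))"
      unfolding PR by (simp add: left_diff_distrib mult.assoc scaleC_minus_left)
    finally show ?thesis .
  qed
  have ne: "?F2 \<noteq> {}" "?F3 \<noteq> {}"
  proof -
    have F: "poly p 2 *\<^sub>C R 2 \<in> ?F"
      by (intro CollectI exI[of _ 2]) simp
    then show F2: "?F2 \<noteq> {}"
      by blast
    have Q: "1 *\<^sub>C peval T (synthetic_div p 0) \<in> ?Q"
      by (intro CollectI exI[of _ 1] exI[of _ "peval T (synthetic_div p 0)"] conjI refl exI[of _ 0]) simp_all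
    have "(poly p 2 *\<^sub>C R 2) * (poly p 2 *\<^sub>C R 2) \<in> ?F2"
      using F by blast
    with F Q have "(poly p 2 *\<^sub>C R 2) * (poly p 2 *\<^sub>C R 2) * (poly p 2 *\<^sub>C R 2)
        + 1 *\<^sub>C peval T (synthetic_div p 0) * ((poly p 2 *\<^sub>C R 2) * (poly p 2 *\<^sub>C R 2)) \<in> ?F3"
      by blast
    then show "?F3 \<noteq> {}"
      by blast
  qed
  have radius: "1 < cmod z \<and> cmod z < 3" if "cmod z = 1 + 1 / real m" "m \<ge> 1" for z and m :: nat
  proof -
    have "0 < 1 / real m" "1 / real m \<le> 1"
      using that(2) by auto
    then show ?thesis
      unfolding that(1) by linarith
  qed
  have "Rbd (2 * (C * C) * (24 * A)) {T ^ m | m. m \<ge> 1}"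
  proof (rule Rbd_of_expansions[OF F2 ne(1) A])
    fix U assume "U \<in> {T ^ m | m. m \<ge> 1}"
    then obtain m where m: "m \<ge> 1" "U = T ^ m"
      by blast
    show "\<exists>m\<ge>1. \<exists>\<Phi> g e \<kappa>. e \<le> 3 \<and> cmod \<kappa> \<le> 2 / real m \<and>
      expands (1 + 1 / real m) \<Phi> g \<and> U = \<kappa> *\<^sub>C g m \<and>
      (\<forall>z. cmod z = 1 + 1 / real m \<longrightarrow> (\<exists>G\<in>?F2. \<Phi> z = (z ^ e / (poly p z)\<^sup>2) *\<^sub>C G))"
    proof (rule exI[of _ m], rule conjI[OF m(1)], rule exI[of _ "\<lambda>z. V z * V z"],
        rule exI[of _ "\<lambda>l. (real l + 1) *\<^sub>R T ^ l"], rule exI[of _ 2],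
        rule exI[of _ "of_real (1 / (real m + 1))"], intro conjI allI impI)
      show "cmod (of_real (1 / (real m + 1))) \<le> 2 / real m"
        unfolding norm_of_real using m(1) by (simp add: field_simps)
      show "expands (1 + 1 / real m) (\<lambda>z. V z * V z) (\<lambda>l. (real l + 1) *\<^sub>R T ^ l)"
        using m(1) by (intro V2) simp
      show "U = of_real (1 / (real m + 1)) *\<^sub>C ((real m + 1) *\<^sub>R T ^ m)"
      proof -
        have "1 / (real m + 1) * (real m + 1) = 1"
          by (simp add: add_nonneg_eq_0_iff)
        then show ?thesis
          unfolding scaleR_scaleC[symmetric] scaleR_scaleR m(2) by (simp only: scaleR_one)
      qed
      fix z assume "cmod z = 1 + 1 / real m"
      then have z: "1 < cmod z" "cmod z < 3"
        using radius m(1) by blast+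
      show "\<exists>G\<in>?F2. V z * V z = (z ^ 2 / (poly p z)\<^sup>2) *\<^sub>C G"
        by (rule bexI, rule V2_eq[OF z(1)]) (use z in blast)
    qed simp
  qed
  \<comment> \<open>The circle of radius 1 + 1/m makes sense only for m \<ge> 1, so
    \<open>T ^ 0\<close> is adjoined separately.\<close>
  then have "Rbd (2 * (C * C) * (24 * A) + norm (1 :: 'a cop)) ({T ^ m | m. m \<ge> 1} \<union> {1})"
    by (intro Rbd_Un Rbd_singleton)
  moreover have "range (\<lambda>m. T ^ m) \<subseteq> {T ^ m | m. m \<ge> 1} \<union> {1}"
  proof clarify
    fix m assume "T ^ m \<noteq> 1"
    then have "m \<noteq> 0"
      by (auto intro: ccontr)
    then show "\<exists>k. T ^ m = T ^ k \<and> 1 \<le> k"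
      by (intro exI[of _ m]) simp
  qed
  ultimately show "\<exists>C. Rbd C (range (\<lambda>m. T ^ m))"
    using Rbd_mono by blast
  have "Rbd (2 * (C * C * C + 2 * B * (C * C)) * (24 * A)) {real m *\<^sub>R (T ^ m * ?P) | m. m \<ge> 1}"
  proof (rule Rbd_of_expansions[OF F3 ne(2) A])
    fix U assume "U \<in> {real m *\<^sub>R (T ^ m * ?P) | m. m \<ge> 1}"
    then obtain m where m: "m \<ge> 1" "U = real m *\<^sub>R (T ^ m * ?P)"
      by blast
    show "\<exists>m\<ge>1. \<exists>\<Phi> g e \<kappa>. e \<le> 3 \<and> cmod \<kappa> \<le> 2 / real m \<and>
      expands (1 + 1 / real m) \<Phi> g \<and> U = \<kappa> *\<^sub>C g m \<and>
      (\<forall>z. cmod z = 1 + 1 / real m \<longrightarrow> (\<exists>G\<in>?F3. \<Phi> z = (z ^ e / (poly p z)\<^sup>2) *\<^sub>C G))"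
    proof (rule exI[of _ m], rule conjI[OF m(1)], rule exI[of _ "\<lambda>z. ?P * (V z * V z * V z)"],
        rule exI[of _ "\<lambda>l. ?P * (((real l + 1) * (real l + 2) / 2) *\<^sub>R T ^ l)"], rule exI[of _ 3],
        rule exI[of _ "of_real (2 * real m / ((real m + 1) * (real m + 2)))"], intro conjI allI impI)
      have "2 * real m / ((real m + 1) * (real m + 2)) \<le> 2 * real m / (real m * real m)"
        using m(1) by (intro divide_left_mono mult_mono mult_pos_pos) auto
      also have "\<dots> = 2 / real m"
        by simp
      finally have "2 * real m / ((real m + 1) * (real m + 2)) \<le> 2 / real m" .
      then show "cmod (of_real (2 * real m / ((real m + 1) * (real m + 2)))) \<le> 2 / real m"
        unfolding norm_of_real using m(1) by simp
      show "expands (1 + 1 / real m) (\<lambda>z. ?P * (V z * V z * V z))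
          (\<lambda>l. ?P * (((real l + 1) * (real l + 2) / 2) *\<^sub>R T ^ l))"
        using m(1) by (intro expands_const_mult V3) (auto intro: add_pos_pos)
      have "(2 * real m / ((real m + 1) * (real m + 2))) * ((real m + 1) * (real m + 2) / 2) = real m"
        by (simp add: add_nonneg_eq_0_iff)
      then show "U = of_real (2 * real m / ((real m + 1) * (real m + 2))) *\<^sub>C
          (?P * (((real m + 1) * (real m + 2) / 2) *\<^sub>R T ^ m))"
        unfolding m(2) scaleR_scaleC[symmetric] peval_commute_T mult_scaleR_right scaleR_scaleR by (simp only:)
      fix z assume "cmod z = 1 + 1 / real m"
      then have z: "1 < cmod z" "cmod z < 3"
        using radius m(1) by blast+
      have F: "poly p z *\<^sub>C R z \<in> ?F"
        using z by blast
      moreover have "(- 1) *\<^sub>C peval T (synthetic_div p z) \<in> ?Q"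
        using z by (intro CollectI exI[of _ "- 1"] exI[of _ "peval T (synthetic_div p z)"] conjI refl exI[of _ z]) simp_all
      moreover have "(poly p z *\<^sub>C R z) * (poly p z *\<^sub>C R z) \<in> ?F2"
        using F by blast
      ultimately have "((poly p z *\<^sub>C R z) * (poly p z *\<^sub>C R z)) * (poly p z *\<^sub>C R z)
          + ((- 1) *\<^sub>C peval T (synthetic_div p z)) * ((poly p z *\<^sub>C R z) * (poly p z *\<^sub>C R z)) \<in> ?F3"
        by blast
      then show "\<exists>G\<in>?F3. ?P * (V z * V z * V z) = (z ^ 3 / (poly p z)\<^sup>2) *\<^sub>C G"
        by (rule bexI[rotated]) (rule V3_eq[OF z(1)])
    qed simp
  qed
  then have "Rbd (2 * (C * C * C + 2 * B * (C * C)) * (24 * A) + norm (0 :: 'a cop))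
      ({real m *\<^sub>R (T ^ m * ?P) | m. m \<ge> 1} \<union> {0})"
    by (intro Rbd_Un Rbd_singleton)
  moreover have "range (\<lambda>m. real m *\<^sub>R (T ^ m * ?P)) \<subseteq> {real m *\<^sub>R (T ^ m * ?P) | m. m \<ge> 1} \<union> {0}"
  proof clarify
    fix m assume "real m *\<^sub>R (T ^ m * ?P) \<noteq> 0"
    then have "m \<noteq> 0"
      by (auto intro: ccontr)
    then show "\<exists>k. real m *\<^sub>R (T ^ m * ?P) = real k *\<^sub>R (T ^ k * ?P) \<and> 1 \<le> k"
      by (intro exI[of _ m]) simp
  qed
  ultimately show "\<exists>C. Rbd C (range (\<lambda>m. real m *\<^sub>R (T ^ m * ?P)))"
    using Rbd_mono by blast
qed

section \<open>Dominated approximation for the gauge integral\<close>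

text \<open>For every tagged division the sum of \<open>f - fn n\<close> is dominated by that of
  \<open>\<rho> n\<close>. A gauge adapted to both \<open>fn n\<close> and \<open>\<rho> n\<close>
  therefore serves for \<open>f\<close>, with values in any Banach space.\<close>

lemma integrable_on_cbox_dominated_approximation:
  fixes f :: "'n::euclidean_space \<Rightarrow> 'b::banach"
  assumes fn: "\<And>n. fn n integrable_on cbox a b" and \<rho>: "\<And>n. \<rho> n integrable_on cbox a b"
    and le: "\<And>n x. x \<in> cbox a b \<Longrightarrow> norm (f x - fn n x) \<le> (\<rho> n x :: real)"
    and lim: "(\<lambda>n. integral (cbox a b) (\<rho> n)) \<longlonglongrightarrow> 0"
  shows "f integrable_on cbox a b"
proof -
  define i where "i n = integral (cbox a b) (fn n)" for n
  define r where "r n = integral (cbox a b) (\<rho> n)" for n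
  have diff: "norm (i m - i n) \<le> r m + r n" for m n
  proof -
    have "norm (fn m x - fn n x) \<le> \<rho> m x + \<rho> n x" if "x \<in> cbox a b" for x
      using le[OF that, of m] le[OF that, of n] norm_triangle_ineq4[of "f x - fn n x" "f x - fn m x"]
      by simp
    then have "norm (integral (cbox a b) (\<lambda>x. fn m x - fn n x)) \<le> integral (cbox a b) (\<lambda>x. \<rho> m x + \<rho> n x)"
      by (intro integral_norm_bound_integral integrable_diff integrable_add fn \<rho>)
    then show ?thesis
      by (simp add: i_def r_def integral_diff integral_add fn \<rho>)
  qed
  have "Cauchy i"
  proof (rule metric_CauchyI)
    fix e :: real assume "e > 0"
    then obtain N where N: "\<And>n. n \<ge> N \<Longrightarrow> norm (r n - 0) < e / 2"
      using LIMSEQ_D[OF lim, of "e / 2"] by (auto simp: r_def)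
    have "dist (i m) (i n) < e" if "m \<ge> N" "n \<ge> N" for m n
      using N[OF that(1)] N[OF that(2)] diff[of m n] by (simp add: dist_norm)
    then show "\<exists>N. \<forall>m\<ge>N. \<forall>n\<ge>N. dist (i m) (i n) < e"
      by blast
  qed
  then obtain I where I: "i \<longlonglongrightarrow> I"
    using Cauchy_convergent convergent_def by blast
  have "(f has_integral I) (cbox a b)"
    unfolding has_integral
  proof (intro allI impI)
    fix e :: real assume e: "e > 0"
    obtain N1 where N1: "\<And>n. n \<ge> N1 \<Longrightarrow> norm (r n - 0) < e / 4"
      using LIMSEQ_D[OF lim, of "e / 4"] e by (auto simp: r_def)
    obtain N2 where N2: "\<And>n. n \<ge> N2 \<Longrightarrow> norm (i n - I) < e / 4"
      using LIMSEQ_D[OF I, of "e / 4"] e by auto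
    define n where "n = max N1 N2"
    have n: "r n < e / 4" "norm (i n - I) < e / 4"
      using N1[of n] N2[of n] by (auto simp: n_def)
    obtain \<gamma>1 where \<gamma>1: "gauge \<gamma>1" "\<And>D. D tagged_division_of cbox a b \<Longrightarrow> \<gamma>1 fine D \<Longrightarrow>
        norm ((\<Sum>(x,k)\<in>D. measure lborel k *\<^sub>R fn n x) - i n) < e / 4"
      using has_integralD[OF integrable_integral[OF fn[of n]], of "e / 4"] e unfolding i_def by (metis divide_pos_pos zero_less_numeral)
    obtain \<gamma>2 where \<gamma>2: "gauge \<gamma>2" "\<And>D. D tagged_division_of cbox a b \<Longrightarrow> \<gamma>2 fine D \<Longrightarrow>
        norm ((\<Sum>(x,k)\<in>D. measure lborel k *\<^sub>R \<rho> n x) - r n) < e / 4"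
      using has_integralD[OF integrable_integral[OF \<rho>[of n]], of "e / 4"] e unfolding r_def by (metis divide_pos_pos zero_less_numeral)
    show "\<exists>\<gamma>. gauge \<gamma> \<and> (\<forall>D. D tagged_division_of cbox a b \<and> \<gamma> fine D \<longrightarrow>
        norm ((\<Sum>(x,k)\<in>D. measure lborel k *\<^sub>R f x) - I) < e)"
    proof (intro exI[of _ "\<lambda>x. \<gamma>1 x \<inter> \<gamma>2 x"] conjI allI impI gauge_Int \<gamma>1(1) \<gamma>2(1); elim conjE)
      fix D assume D: "D tagged_division_of cbox a b" "(\<lambda>x. \<gamma>1 x \<inter> \<gamma>2 x) fine D"
      then have fine: "\<gamma>1 fine D" "\<gamma>2 fine D"
        by (auto simp: fine_Int)
      have "norm ((\<Sum>(x,k)\<in>D. measure lborel k *\<^sub>R f x) - (\<Sum>(x,k)\<in>D. measure lborel k *\<^sub>R fn n x))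
          = norm (\<Sum>(x,k)\<in>D. measure lborel k *\<^sub>R (f x - fn n x))"
        by (simp add: sum_subtractf[symmetric] scaleR_diff_right case_prod_unfold)
      also have "\<dots> \<le> (\<Sum>(x,k)\<in>D. measure lborel k *\<^sub>R \<rho> n x)"
        unfolding case_prod_unfold
      proof (rule sum_norm_le)
        fix p assume "p \<in> D"
        then have "fst p \<in> cbox a b"
          using tagged_division_ofD(2,3)[OF D(1), of "fst p" "snd p"] by auto
        then show "norm (measure lborel (snd p) *\<^sub>R (f (fst p) - fn n (fst p))) \<le> measure lborel (snd p) *\<^sub>R \<rho> n (fst p)"
          using le by (simp add: mult_left_mono)
      qed
      finally have 1: "norm ((\<Sum>(x,k)\<in>D. measure lborel k *\<^sub>R f x) - (\<Sum>(x,k)\<in>D. measure lborel k *\<^sub>R fn n x))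
          \<le> (\<Sum>(x,k)\<in>D. measure lborel k *\<^sub>R \<rho> n x)" .
      have 2: "(\<Sum>(x,k)\<in>D. measure lborel k *\<^sub>R \<rho> n x) < r n + e / 4"
        using \<gamma>2(2)[OF D(1) fine(2)] by (simp only: real_norm_def abs_diff_less_iff)
      note 3 = \<gamma>1(2)[OF D(1) fine(1)]
      have tri: "norm (u - w) \<le> norm (u - v) + norm (v - w)" for u v w :: 'b
        using norm_triangle_ineq[of "u - v" "v - w"] by simp
      show "norm ((\<Sum>(x,k)\<in>D. measure lborel k *\<^sub>R f x) - I) < e"
        using tri[of "\<Sum>(x,k)\<in>D. measure lborel k *\<^sub>R f x" I "\<Sum>(x,k)\<in>D. measure lborel k *\<^sub>R fn n x"]
          tri[of "\<Sum>(x,k)\<in>D. measure lborel k *\<^sub>R fn n x" I "i n"] 1 2 3 n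
        by linarith
    qed
  qed
  then show ?thesis
    by blast
qed

text \<open>Termwise integration over an unbounded set. The integrals of \<open>\<rho> n\<close>
  over all boxes are bounded by the single number \<open>r n\<close>, which makes the passage from
  boxes to \<open>S\<close> uniform.\<close>

lemma has_integral_dominated_approximation:
  fixes f :: "'n::euclidean_space \<Rightarrow> 'b::banach"
  assumes fn: "\<And>n. (fn n has_integral i n) S" and \<rho>: "\<And>n. (\<rho> n has_integral r n) S"
    and le: "\<And>n x. x \<in> S \<Longrightarrow> norm (f x - fn n x) \<le> (\<rho> n x :: real)"
    and lim: "r \<longlonglongrightarrow> 0" "i \<longlonglongrightarrow> I"
  shows "(f has_integral I) S"
proof -
  define f' where "f' x = (if x \<in> S then f x else 0)" for x
  define fn' where "fn' n x = (if x \<in> S then fn n x else 0)" for n x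
  define \<rho>' where "\<rho>' n x = (if x \<in> S then \<rho> n x else 0)" for n x
  have \<rho>_nonneg: "0 \<le> \<rho>' n x" for n x
    using order_trans[OF norm_ge_zero le[of x n]] by (simp add: \<rho>'_def)
  have le': "norm (f' x - fn' n x) \<le> \<rho>' n x" for n x
    using le by (simp add: f'_def fn'_def \<rho>'_def)
  have int: "fn' n integrable_on cbox a b" "\<rho>' n integrable_on cbox a b" for n a b
    using fn[of n] \<rho>[of n] unfolding has_integral_alt'[of "fn n"] has_integral_alt'[of "\<rho> n"] fn'_def \<rho>'_def by auto
  have \<rho>_UNIV: "(\<rho>' n has_integral r n) UNIV" for n
    using \<rho>[of n] unfolding \<rho>'_def has_integral_restrict_UNIV .
  have \<rho>_le: "integral (cbox a b) (\<rho>' n) \<le> r n" for n a b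
  proof -
    have "integral (cbox a b) (\<rho>' n) \<le> integral UNIV (\<rho>' n)"
      using \<rho>_UNIV[of n] int(2) \<rho>_nonneg by (intro integral_subset_le) auto
    then show ?thesis
      by (simp only: integral_unique[OF \<rho>_UNIV])
  qed
  have \<rho>_lim: "(\<lambda>n. integral (cbox a b) (\<rho>' n)) \<longlonglongrightarrow> 0" for a b
    by (rule tendsto_sandwich[OF _ _ tendsto_const lim(1)])
      (auto intro!: always_eventually integral_nonneg int \<rho>_nonneg \<rho>_le)
  have f_int: "f' integrable_on cbox a b" for a b
    using integrable_on_cbox_dominated_approximation[OF int(1) int(2) le' \<rho>_lim] .
  show ?thesis
    unfolding has_integral_alt' f'_def[symmetric]
  proof (intro conjI allI impI f_int)
    fix e :: real assume e: "e > 0"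
    obtain N1 where N1: "\<And>n. n \<ge> N1 \<Longrightarrow> norm (r n - 0) < e / 3"
      using LIMSEQ_D[OF lim(1), of "e / 3"] e by auto
    obtain N2 where N2: "\<And>n. n \<ge> N2 \<Longrightarrow> norm (i n - I) < e / 3"
      using LIMSEQ_D[OF lim(2), of "e / 3"] e by auto
    define n where "n = max N1 N2"
    have n: "r n < e / 3" "norm (i n - I) < e / 3"
      using N1[of n] N2[of n] by (auto simp: n_def)
    obtain B where B: "B > 0" "\<And>a b. ball 0 B \<subseteq> cbox a b \<Longrightarrow> norm (integral (cbox a b) (fn' n) - i n) < e / 3"
      using fn[of n] e unfolding has_integral_alt'[of "fn n"] fn'_def
      by (metis divide_pos_pos zero_less_numeral)
    show "\<exists>B>0. \<forall>a b. ball 0 B \<subseteq> cbox a b \<longrightarrow> norm (integral (cbox a b) f' - I) < e"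
    proof (intro exI[of _ B] conjI allI impI B(1))
      fix a b :: 'n assume ab: "ball 0 B \<subseteq> cbox a b"
      have "norm (integral (cbox a b) (\<lambda>x. f' x - fn' n x)) \<le> integral (cbox a b) (\<rho>' n)"
        by (intro integral_norm_bound_integral integrable_diff f_int int le')
      then have "norm (integral (cbox a b) f' - integral (cbox a b) (fn' n)) < e / 3"
        using \<rho>_le[of a b n] n(1) by (simp add: integral_diff f_int int)
      moreover have "norm (integral (cbox a b) (fn' n) - I) < e / 3 + e / 3"
        using norm_triangle_lt[of "integral (cbox a b) (fn' n) - i n" "i n - I" "e / 3 + e / 3"] B(2)[OF ab] n(2)
        by simp
      ultimately show "norm (integral (cbox a b) f' - I) < e"
        using norm_triangle_lt[of "integral (cbox a b) f' - integral (cbox a b) (fn' n)"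
            "integral (cbox a b) (fn' n) - I" e] by simp
    qed
  qed
qed


section \<open>The binomial series\<close>

text \<open>\<open>(1 - x)\<^sup>s = \<Sum> bcoef s k x\<^sup>k\<close>, and \<open>ecoef s\<close> are the partial sums of \<open>bcoef s\<close>.\<close>

definition bcoef :: "real \<Rightarrow> nat \<Rightarrow> real"
  where "bcoef s k = (- 1) ^ k * (s gchoose k)"

definition ecoef :: "real \<Rightarrow> nat \<Rightarrow> real"
  where "ecoef s k = (- 1) ^ k * ((s - 1) gchoose k)"

lemma bcoef_0 [simp]: "bcoef s 0 = 1" and ecoef_0 [simp]: "ecoef s 0 = 1"
  by (simp_all add: bcoef_def ecoef_def)

lemma bcoef_Suc: "bcoef s (Suc k) = ecoef s (Suc k) - ecoef s k"
  unfolding bcoef_def ecoef_def gbinomial_addition_formula[of s] by (simp add: algebra_simps)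

lemma ecoef_pochhammer: "ecoef s k = pochhammer (1 - s) k / fact k"
  by (simp add: ecoef_def gbinomial_pochhammer flip: power_mult_distrib mult.assoc)

lemma ecoef_Suc: "ecoef s (Suc k) = ecoef s k * (1 - s / real (Suc k))"
  by (simp add: ecoef_pochhammer pochhammer_Suc field_simps)

lemma ecoef_pos: "0 < s \<Longrightarrow> s < 1 \<Longrightarrow> 0 < ecoef s k"
proof (induction k)
  case (Suc k)
  then have "s / real (Suc k) < 1"
    by (simp add: divide_less_eq)
  with Suc show ?case
    by (simp add: ecoef_Suc)
qed simp

lemma powr_one_plus_le:
  fixes x s :: real
  assumes "0 < x" "0 < s" "s < 1"
  shows "(1 + x) powr s \<le> 1 + s * x"
proof -
  have "\<exists>z>1. z < 1 + x \<and> (1 + x) powr s - 1 powr s = (1 + x - 1) * (s * z powr (s - 1))"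
    using assms by (intro MVT2) (auto intro!: has_real_derivative_powr)
  then obtain z where z: "z > 1" "(1 + x) powr s = 1 + x * (s * z powr (s - 1))"
    by auto
  have "z powr (s - 1) \<le> 1"
    using z(1) assms powr_mono[of "s - 1" 0 z] by simp
  then have "x * (s * z powr (s - 1)) \<le> x * (s * 1)"
    using assms by (intro mult_left_mono) auto
  then show ?thesis
    using z(2) by (simp add: mult.commute)
qed

text \<open>The ratio of consecutive terms satisfies 1 - s/n \<le> 1 / (1 + s/n) \<le> (1 + 1/n)^-s
  by Bernoulli's inequality, and the last expression is the ratio of consecutive values of
  n^-s.\<close>

lemma ecoef_le:
  assumes "0 < s" "s < 1"
  shows "ecoef s k \<le> real (Suc k) powr (- s)"
proof (induction k)
  case (Suc k)
  define n where "n = real (Suc k)"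
  have n: "n \<ge> 1"
    by (simp add: n_def)
  have "1 - s / n \<le> 1 / (1 + s / n)"
  proof -
    have "(1 - s / n) * (1 + s / n) = 1 - (s / n)\<^sup>2"
      by (simp add: algebra_simps power2_eq_square)
    then have "(1 - s / n) * (1 + s / n) \<le> 1"
      by simp
    moreover have "0 < 1 + s / n"
      using n assms by (simp add: add_pos_pos)
    ultimately show ?thesis
      by (simp add: pos_le_divide_eq)
  qed
  also have "\<dots> \<le> 1 / (1 + 1 / n) powr s"
  proof (rule divide_left_mono)
    show "(1 + 1 / n) powr s \<le> 1 + s / n"
      using powr_one_plus_le[of "1 / n" s] n assms by simp
    have "0 < 1 + s / n" "0 < 1 + 1 / n"
      using n assms by (auto intro!: add_pos_pos)
    then show "0 < (1 + s / n) * (1 + 1 / n) powr s"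
      by simp
  qed simp
  finally have step: "1 - s / n \<le> 1 / (1 + 1 / n) powr s" .
  have "ecoef s (Suc k) = ecoef s k * (1 - s / n)"
    by (simp add: ecoef_Suc n_def)
  also have "\<dots> \<le> n powr (- s) * (1 / (1 + 1 / n) powr s)"
    using Suc step ecoef_pos[OF assms, of k] assms n
    by (intro mult_mono) (auto simp: n_def divide_le_eq)
  also have "\<dots> = (n * (1 + 1 / n)) powr (- s)"
    by (simp add: powr_mult powr_minus divide_inverse)
  also have "n * (1 + 1 / n) = real (Suc (Suc k))"
    using n by (simp add: algebra_simps n_def)
  finally show ?case .
qed simp

lemma ecoef_tendsto_0:
  assumes "0 < s" "s < 1"
  shows "ecoef s \<longlonglongrightarrow> 0"
proof (rule tendsto_sandwich[where f = "\<lambda>_. 0" and h = "\<lambda>k. real (Suc k) powr (- s)"])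
  show "(\<lambda>k. real (Suc k) powr (- s)) \<longlonglongrightarrow> 0"
    using assms by (intro tendsto_neg_powr filterlim_compose[OF filterlim_real_sequentially filterlim_Suc]) auto
qed (use ecoef_le[OF assms] ecoef_pos[OF assms] in \<open>auto intro!: always_eventually less_imp_le\<close>)

lemma bcoef_Suc_nonpos:
  assumes "0 < s" "s < 1"
  shows "bcoef s (Suc k) \<le> 0"
proof -
  have "ecoef s k * (1 - s / real (Suc k)) \<le> ecoef s k * 1"
    using assms ecoef_pos[OF assms, of k] by (intro mult_left_mono) auto
  then show ?thesis
    by (simp add: bcoef_Suc ecoef_Suc)
qed

text \<open>After the index 0 all binomial coefficients here are nonpositive, so their absolute
  values are differences of \<open>ecoef\<close> and telescope.\<close>

lemma sum_abs_bcoef: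
  assumes "0 < s" "s < 1" "m \<le> n"
  shows "(\<Sum>k=Suc m..<Suc n. \<bar>bcoef s k\<bar>) = ecoef s m - ecoef s n"
  using assms(3)
proof (induction n rule: dec_induct)
  case (step n)
  then show ?case
    using bcoef_Suc_nonpos[OF assms(1,2), of n] by (simp add: bcoef_Suc)
qed simp

lemma summable_abs_bcoef:
  assumes "0 < s" "s < 1"
  shows "summable (\<lambda>k. \<bar>bcoef s k\<bar>)"
proof (rule bounded_imp_summable)
  fix n
  have "(\<Sum>k\<le>n. \<bar>bcoef s k\<bar>) = \<bar>bcoef s 0\<bar> + (\<Sum>k=Suc 0..<Suc n. \<bar>bcoef s k\<bar>)"
    using sum.atLeast_Suc_lessThan[of 0 "Suc n" "\<lambda>k. \<bar>bcoef s k\<bar>"]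
    by (simp only: lessThan_Suc_atMost[symmetric] lessThan_atLeast0)
  also have "\<dots> \<le> 2"
    unfolding sum_abs_bcoef[OF assms le0] using ecoef_pos[OF assms, of n] by simp
  finally show "(\<Sum>k\<le>n. \<bar>bcoef s k\<bar>) \<le> 2" .
qed simp

lemma bcoef_convolution: "(\<Sum>i\<le>n. bcoef s i * bcoef t (n - i)) = bcoef (s + t) n"
proof -
  have "(\<Sum>i\<le>n. bcoef s i * bcoef t (n - i)) = (\<Sum>i\<le>n. (- 1) ^ n * ((s gchoose i) * (t gchoose (n - i))))"
  proof (intro sum.cong refl)
    fix i assume "i \<in> {..n}"
    then have "(- 1 :: real) ^ n = (- 1) ^ i * (- 1) ^ (n - i)"
      by (simp flip: power_add)
    then show "bcoef s i * bcoef t (n - i) = (- 1) ^ n * ((s gchoose i) * (t gchoose (n - i)))"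
      by (simp add: bcoef_def mult_ac)
  qed
  also have "\<dots> = bcoef (s + t) n"
    using gbinomial_Vandermonde[of s t n] by (simp add: bcoef_def atMost_atLeast0 flip: sum_distrib_left)
  finally show ?thesis .
qed

lemma bcoef_1: "bcoef 1 n = (if n = 0 then 1 else if n = 1 then - 1 else 0)"
proof -
  have "(1 gchoose n) = real (1 choose n)"
    by (simp add: binomial_gbinomial)
  then show ?thesis
    by (auto simp: bcoef_def binomial_eq_0)
qed

section \<open>Fractional powers of 1 - V for power-bounded V\<close>

definition one_minus_power :: "'a::{complex_normed_vector, banach} cop \<Rightarrow> real \<Rightarrow> 'a cop"
  where "one_minus_power V s = (\<Sum>k. bcoef s k *\<^sub>R V ^ k)"

lemma summable_one_minus_power:
  fixes V :: "'a::{complex_normed_vector, banach} cop"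
  assumes "0 < s" "s < 1" "\<And>k. norm (V ^ k) \<le> K"
  shows "summable (\<lambda>k. norm (bcoef s k *\<^sub>R V ^ k))"
proof (rule summable_comparison_test')
  show "summable (\<lambda>k. \<bar>bcoef s k\<bar> * K)"
    by (intro summable_mult2 summable_abs_bcoef assms)
  show "norm (norm (bcoef s k *\<^sub>R V ^ k)) \<le> \<bar>bcoef s k\<bar> * K" if "k \<ge> 0" for k
    using assms(3)[of k] by (simp add: mult_left_mono)
qed

lemma one_minus_power_sums:
  assumes "0 < s" "s < 1" "\<And>k. norm (V ^ k) \<le> K"
  shows "(\<lambda>k. bcoef s k *\<^sub>R V ^ k) sums one_minus_power V s"
  unfolding one_minus_power_def
  by (rule summable_sums[OF summable_norm_cancel[OF summable_one_minus_power[OF assms]]])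

lemma one_minus_power_mult:
  fixes V :: "'a::{complex_normed_vector, banach} cop"
  assumes s: "0 < s" "s < 1" and V: "\<And>k. norm (V ^ k) \<le> K"
  shows "one_minus_power V s * one_minus_power V (1 - s) = 1 - V"
proof -
  have t: "0 < 1 - s" "1 - s < 1"
    using s by auto
  have "(\<lambda>n. \<Sum>i\<le>n. (bcoef s i *\<^sub>R V ^ i) * (bcoef (1 - s) (n - i) *\<^sub>R V ^ (n - i))) sums
      (one_minus_power V s * one_minus_power V (1 - s))"
    unfolding one_minus_power_def
    by (intro Cauchy_product_sums summable_one_minus_power[OF s V] summable_one_minus_power[OF t V])
  moreover have "(\<Sum>i\<le>n. (bcoef s i *\<^sub>R V ^ i) * (bcoef (1 - s) (n - i) *\<^sub>R V ^ (n - i))) = bcoef 1 n *\<^sub>R V ^ n" for n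
  proof -
    have "(\<Sum>i\<le>n. (bcoef s i *\<^sub>R V ^ i) * (bcoef (1 - s) (n - i) *\<^sub>R V ^ (n - i)))
        = (\<Sum>i\<le>n. (bcoef s i * bcoef (1 - s) (n - i)) *\<^sub>R V ^ n)"
      by (intro sum.cong refl) (simp flip: power_add)
    then show ?thesis
      using bcoef_convolution[of s "1 - s" n] by (simp flip: scaleR_sum_left)
  qed
  ultimately have "(\<lambda>n. bcoef 1 n *\<^sub>R V ^ n) sums (one_minus_power V s * one_minus_power V (1 - s))"
    by simp
  moreover have "(\<lambda>n. bcoef 1 n *\<^sub>R V ^ n) sums (\<Sum>n<2. bcoef 1 n *\<^sub>R V ^ n)"
    by (rule sums_finite) (auto simp: bcoef_1)
  moreover have "(\<Sum>n<2. bcoef 1 n *\<^sub>R V ^ n) = 1 - V"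
    by (simp add: numeral_2_eq_2 bcoef_1)
  ultimately show ?thesis
    by (simp add: sums_unique2)
qed

lemma one_minus_power_commute:
  assumes "0 < s" "s < 1" "\<And>k. norm (V ^ k) \<le> K" "V * B = B * V"
  shows "one_minus_power V s * B = B * one_minus_power V s"
proof -
  have comm: "V ^ k * B = B * V ^ k" for k
    by (induction k) (simp_all add: mult.assoc assms(4), metis assms(4) mult.assoc)
  note sums = one_minus_power_sums[OF assms(1-3)]
  have "(\<lambda>k. (bcoef s k *\<^sub>R V ^ k) * B) sums (one_minus_power V s * B)"
    by (rule bounded_linear.sums[OF bounded_linear_mult_left sums])
  moreover have "(\<lambda>k. B * (bcoef s k *\<^sub>R V ^ k)) sums (B * one_minus_power V s)"
    by (rule bounded_linear.sums[OF bounded_linear_mult_right sums])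
  ultimately show ?thesis
    by (simp add: comm sums_unique2)
qed

section \<open>Balakrishnan's integral as a binomial series\<close>

text \<open>Euler's integral over the unit interval under the substitution x = t / (1 + t).\<close>

lemma has_integral_Beta_half_line:
  fixes a b :: real
  assumes a: "a > 0" and b: "b > 0"
  shows "((\<lambda>t. t powr (a - 1) * (1 + t) powr (- (a + b))) has_integral Beta a b) {0<..}"
proof -
  define f where "f x = x powr (a - 1) * (1 - x) powr (b - 1)" for x :: real
  define g where "g t = t / (1 + t)" for t :: real
  define g' where "g' t = 1 / (1 + t)\<^sup>2" for t :: real
  have image: "g ` {0<..} = {0<..<1}"
  proof
    show "g ` {0<..} \<subseteq> {0<..<1}"
      by (auto simp: g_def)
    show "{0<..<1} \<subseteq> g ` {0<..}"
    proof
      fix y :: real assume y: "y \<in> {0<..<1}"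
      then have "y = g (y / (1 - y))" "y / (1 - y) > 0"
        by (auto simp: g_def field_simps)
      then show "y \<in> g ` {0<..}"
        by blast
    qed
  qed
  have inj: "inj_on g {0<..}"
    by (rule inj_onI) (simp add: g_def field_simps)
  have der: "(g has_field_derivative g' t) (at t within {0<..})" if "t \<in> {0<..}" for t
    unfolding g_def g'_def using that
    by (auto intro!: derivative_eq_intros simp: power2_eq_square divide_simps)
  have f: "(f has_integral Beta a b) {0<..<1}"
    using has_integral_Beta_real[OF a b] unfolding f_def has_integral_Icc_iff_Ioo .
  then have "f absolutely_integrable_on g ` {0<..}"
    unfolding image by (intro nonnegative_absolutely_integrable_1) (auto simp: f_def)
  moreover have "integral (g ` {0<..}) f = Beta a b"
    unfolding image using f by (rule integral_unique)
  ultimately have "(\<lambda>t. \<bar>g' t\<bar> * f (g t)) absolutely_integrable_on {0<..} \<and>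
      integral {0<..} (\<lambda>t. \<bar>g' t\<bar> * f (g t)) = Beta a b"
    using has_absolute_integral_change_of_variables_1'[OF _ der inj, of f "Beta a b"] by simp
  then have "((\<lambda>t. \<bar>g' t\<bar> * f (g t)) has_integral Beta a b) {0<..}"
    using set_lebesgue_integral_eq_integral(1) has_integral_integrable_integral by blast
  then show ?thesis
  proof (rule has_integral_eq[rotated])
    fix t :: real assume "t \<in> {0<..}"
    then have t: "t > 0" "1 + t > 0"
      by auto
    define u where "u = 1 + t"
    have u: "u > 0"
      using t by (simp add: u_def)
    have "1 - t / u = 1 / u"
      using u by (simp add: u_def field_simps)
    then have "\<bar>g' t\<bar> * f (g t) = u powr - 2 * ((t / u) powr (a - 1) * (1 / u) powr (b - 1))"
      using u by (simp add: g'_def f_def g_def powr_minus_divide flip: u_def)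
    also have "\<dots> = t powr (a - 1) * (u powr - 2 * (u powr - (a - 1) * u powr - (b - 1)))"
      by (simp only: powr_minus_divide powr_divide powr_one_eq_one) (simp add: mult_ac)
    also have "u powr - 2 * (u powr - (a - 1) * u powr - (b - 1)) = u powr (- (a + b))"
      by (simp flip: powr_add)
    finally show "\<bar>g' t\<bar> * f (g t) = t powr (a - 1) * (1 + t) powr (- (a + b))"
      by (simp add: u_def)
  qed
qed

lemma Gamma_reflection_real:
  fixes s :: real
  shows "Gamma s * Gamma (1 - s) = pi / sin (pi * s)"
proof -
  have "Gamma (complex_of_real s) * Gamma (complex_of_real (1 - s)) = of_real pi / sin (of_real (pi * s))"
    using Gamma_reflection_complex[of "of_real s"] by simp
  then have "complex_of_real (Gamma s * Gamma (1 - s)) = complex_of_real (pi / sin (pi * s))"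
    unfolding Gamma_complex_of_real sin_of_real by simp
  then show ?thesis
    by (simp only: of_real_eq_iff)
qed

text \<open>The integral is Beta(s, k + 1 - s). Splitting off the Pochhammer symbol leaves Gamma(s)
  Gamma(1 - s), and the reflection formula produces the constant that Balakrishnan's normalisation
  cancels.\<close>

lemma has_integral_ecoef:
  assumes s: "0 < s" "s < 1"
  shows "((\<lambda>t. t powr (s - 1) * (1 / (1 + t) ^ Suc k)) has_integral (pi / sin (pi * s) * ecoef s k)) {0<..}"
proof -
  have "((\<lambda>t. t powr (s - 1) * (1 + t) powr (- (s + (real k + 1 - s)))) has_integral Beta s (real k + 1 - s)) {0<..}"
    using s by (intro has_integral_Beta_half_line) auto
  moreover have "Beta s (real k + 1 - s) = pi / sin (pi * s) * ecoef s k"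
  proof -
    have "1 - s \<notin> \<int>\<^sub>\<le>\<^sub>0"
      using s by (auto elim!: nonpos_Ints_cases)
    then have "pochhammer (1 - s) k * Gamma (1 - s) = Gamma (1 - s + real k)"
      using s by (simp add: pochhammer_Gamma Gamma_eq_zero_iff)
    moreover have "Gamma (1 + real k) = fact k"
      by (rule Gamma_fact)
    ultimately have "Beta s (real k + 1 - s) = Gamma s * Gamma (1 - s) * ecoef s k"
      by (simp add: Beta_def ecoef_pochhammer algebra_simps)
    then show ?thesis
      by (simp add: Gamma_reflection_real)
  qed
  ultimately have "((\<lambda>t. t powr (s - 1) * (1 + t) powr (- (s + (real k + 1 - s)))) has_integral
      (pi / sin (pi * s) * ecoef s k)) {0<..}"
    by simp
  then show ?thesis
  proof (rule has_integral_eq[rotated])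
    fix t :: real assume "t \<in> {0<..}"
    then have "(1 + t) powr (- real (Suc k)) = 1 / (1 + t) ^ Suc k"
      by (simp only: powr_minus_divide powr_realpow greaterThan_iff add_pos_pos zero_less_one)
    then show "t powr (s - 1) * (1 + t) powr (- (s + (real k + 1 - s))) = t powr (s - 1) * (1 / (1 + t) ^ Suc k)"
      by (simp add: add.commute)
  qed
qed

lemma sums_inverse_one_plus:
  fixes t :: real
  assumes "t > 0"
  shows "(\<lambda>k. 1 / (1 + t) ^ Suc k) sums (1 / t)"
proof -
  have "(\<lambda>k. (1 / (1 + t)) * (1 / (1 + t)) ^ k) sums ((1 / (1 + t)) * (1 / (1 - 1 / (1 + t))))"
    using assms by (intro sums_mult geometric_sums) (simp add: divide_less_eq)
  moreover have "(1 / (1 + t)) * (1 / (1 - 1 / (1 + t))) = 1 / t"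
    using assms by (simp add: field_simps)
  ultimately show ?thesis
    by (simp add: power_divide)
qed

text \<open>\<open>Y\<close> is the inverse of \<open>t + (1 - V)\<close>. The bound holds with an
  additional \<open>V ^ j\<close> in front, because all powers of \<open>V\<close> share the bound
  \<open>K\<close>; this controls the remainders below.\<close>

lemma neumann_series:
  fixes V :: "'a::{complex_normed_vector, banach} cop"
  assumes V: "\<And>k. norm (V ^ k) \<le> K" and t: "t > 0"
  defines "Y \<equiv> \<Sum>k. (1 / (1 + t) ^ Suc k) *\<^sub>R V ^ k"
  shows "(1 + t) *\<^sub>R Y = 1 + V * Y" "V * Y = Y * V" "norm (V ^ j * Y) \<le> K / t"
proof -
  have sm: "summable (\<lambda>k. norm ((1 / (1 + t) ^ Suc k) *\<^sub>R V ^ (j + k)))" for j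
  proof (rule summable_comparison_test')
    show "summable (\<lambda>k. 1 / (1 + t) ^ Suc k * K)"
      using sums_inverse_one_plus[OF t] by (intro summable_mult2) (simp add: sums_iff)
    show "norm (norm ((1 / (1 + t) ^ Suc k) *\<^sub>R V ^ (j + k))) \<le> 1 / (1 + t) ^ Suc k * K" if "k \<ge> 0" for k
      using mult_left_mono[OF V[of "j + k"], of "1 / (1 + t) ^ Suc k"] t by simp
  qed
  have Y: "(\<lambda>k. (1 / (1 + t) ^ Suc k) *\<^sub>R V ^ k) sums Y"
    unfolding Y_def using summable_norm_cancel[OF sm[of 0]] by (intro summable_sums) simp
  have VY: "(\<lambda>k. (1 / (1 + t) ^ Suc k) *\<^sub>R V ^ (j + k)) sums (V ^ j * Y)" for j
    using bounded_linear.sums[OF bounded_linear_mult_right Y, of "V ^ j"] by (simp add: power_add)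
  have "(\<lambda>k. (1 / (1 + t) ^ Suc k) *\<^sub>R V ^ Suc k) sums (Y * V)"
    using bounded_linear.sums[OF bounded_linear_mult_left Y, of V] by (simp add: power_commutes)
  with VY[of 1] show "V * Y = Y * V"
    using sums_unique2 by fastforce
  have "(\<lambda>k. (1 / (1 + t) ^ k) *\<^sub>R V ^ k) sums ((1 + t) *\<^sub>R Y)"
    using bounded_linear.sums[OF bounded_linear_scaleR_right Y, of "1 + t"] t by simp
  moreover have "(\<lambda>k. (1 / (1 + t) ^ k) *\<^sub>R V ^ k) sums (V * Y + (1 / (1 + t) ^ 0) *\<^sub>R V ^ 0)"
    using VY[of 1] by (intro sums_Suc) simp
  ultimately show "(1 + t) *\<^sub>R Y = 1 + V * Y"
    using sums_unique2 by fastforce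
  have "norm (V ^ j * Y) \<le> (\<Sum>k. 1 / (1 + t) ^ Suc k * K)"
    unfolding sums_unique[OF VY[of j]]
  proof (rule norm_suminf_le)
    show "norm ((1 / (1 + t) ^ Suc k) *\<^sub>R V ^ (j + k)) \<le> 1 / (1 + t) ^ Suc k * K" for k
      using mult_left_mono[OF V[of "j + k"], of "1 / (1 + t) ^ Suc k"] t by simp
    show "summable (\<lambda>k. 1 / (1 + t) ^ Suc k * K)"
      using sums_inverse_one_plus[OF t] by (intro summable_mult2) (simp add: sums_iff)
  qed
  also have "\<dots> = 1 / t * K"
    using sums_mult2[OF sums_inverse_one_plus[OF t], of K] by (rule sums_unique[symmetric])
  finally show "norm (V ^ j * Y) \<le> K / t"
    by simp
qed

lemma is_op_inverse_op_of:
  assumes "B * Y = 1" "Y * B = 1"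
  shows "is_op_inverse (op_of B) (op_of Y)"
  unfolding is_op_inverse_def using op_of[of Y] assms by (simp flip: op_of_simps)

text \<open>The integrand is expanded in powers of \<open>V\<close>, and the integrals of its
  coefficient functions are the binomial coefficients. Termwise integration is justified because the
  remainder after index \<open>n\<close> has the majorant \<open>K * g n t\<close>, whose integral
  is a multiple of \<open>ecoef s n\<close>.\<close>

lemma balakrishnan_power_one_minus:
  fixes V :: "'a::{complex_normed_vector, banach} cop"
  assumes s: "0 < s" "s < 1" and V: "\<And>k. norm (V ^ k) \<le> K"
  shows "balakrishnan_power (op_of (1 - V)) s = op_of (one_minus_power V s)"
proof -
  define Y where "Y t = (\<Sum>k. (1 / (1 + t) ^ Suc k) *\<^sub>R V ^ k)" for t
  define \<Phi> where "\<Phi> t = t powr (s - 1) *\<^sub>R (Y t * (1 - V))" for t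
  define g where "g k t = t powr (s - 1) * (1 / (1 + t) ^ Suc k)" for k t
  \<comment> \<open>The coefficient of \<open>V ^ k\<close> in \<open>Y t * (1 - V)\<close>, up to
    the factor \<open>t powr (s - 1)\<close>: a difference of consecutive Neumann coefficients, just
    as \<open>bcoef\<close> is a difference of \<open>ecoef\<close>.\<close>
  define w where "w k t = g k t - (if k = 0 then 0 else g (k - 1) t)" for k t
  define G where "G = pi / sin (pi * s)"
  have K: "K \<ge> 0"
    using V[of 0] norm_ge_zero order_trans by blast
  have Y: "(1 + t) *\<^sub>R Y t = 1 + V * Y t" "V * Y t = Y t * V" "norm (V ^ j * Y t) \<le> K / t" if "t > 0" for t j
    unfolding Y_def using neumann_series[OF V that] by blast+
  have inv: "op_inverse (t *\<^sub>R id_blinfun + op_of (1 - V)) = op_of (Y t)" if "t > 0" for t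
  proof -
    have "(t *\<^sub>R 1 + (1 - V)) * Y t = 1" "Y t * (t *\<^sub>R 1 + (1 - V)) = 1"
      using Y(1,2)[OF that] by (simp_all add: algebra_simps)
    from op_inverse_eqI[OF is_op_inverse_op_of[OF this]] show ?thesis
      by simp
  qed
  have w_int: "(w k has_integral G * bcoef s k) {0<..}" for k
  proof (cases k)
    case 0
    then show ?thesis
      using has_integral_ecoef[OF s, of 0] by (simp add: w_def[abs_def] g_def G_def)
  next
    case (Suc j)
    have "((\<lambda>t. g (Suc j) t - g j t) has_integral (G * ecoef s (Suc j) - G * ecoef s j)) {0<..}"
      unfolding g_def G_def by (intro has_integral_diff has_integral_ecoef s)
    then show ?thesis
      by (simp add: Suc w_def[abs_def] bcoef_Suc right_diff_distrib)
  qed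
  \<comment> \<open>The exact remainder. Its factor \<open>t\<close> cancels the singularity of the
    bound \<open>K / t\<close> for \<open>V ^ Suc n * Y t\<close>.\<close>
  have \<Phi>_diff: "\<Phi> t - (\<Sum>k\<le>n. w k t *\<^sub>R V ^ k) = - (g n t * t) *\<^sub>R (V ^ Suc n * Y t)" if t: "t > 0" for t n
  proof (induction n)
    case 0
    have u: "1 + t > 0"
      using t by simp
    have "Y t * (1 - V) = 1 - t *\<^sub>R Y t"
      using Y(1,2)[OF t] by (simp add: algebra_simps)
    moreover have "Y t = (1 / (1 + t)) *\<^sub>R (1 + V * Y t)"
      using u unfolding Y(1)[OF t, symmetric] by simp
    then have "1 - t *\<^sub>R Y t = (1 - t * (1 / (1 + t))) *\<^sub>R 1 - (t * (1 / (1 + t))) *\<^sub>R (V * Y t)"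
      by (metis (no_types, lifting) diff_diff_eq scaleR_left_diff_distrib scaleR_one scaleR_right_distrib scaleR_scaleR)
    moreover have "1 - t * (1 / (1 + t)) = 1 / (1 + t)"
      using u by (simp add: field_simps)
    ultimately show ?case
      by (simp add: \<Phi>_def w_def g_def scaleR_diff_right mult.commute)
  next
    case (Suc n)
    have u: "1 + t > 0"
      using t by simp
    have g_Suc: "g (Suc n) t * (1 + t) = g n t"
      using u by (simp add: g_def)
    have "g n t *\<^sub>R (V ^ Suc n * Y t) = g (Suc n) t *\<^sub>R (V ^ Suc n * ((1 + t) *\<^sub>R Y t))"
      by (simp add: g_Suc[symmetric])
    also have "\<dots> = g (Suc n) t *\<^sub>R (V ^ Suc n + V ^ Suc (Suc n) * Y t)"
      unfolding Y(1)[OF t] by (simp only: distrib_left mult_1_right power_Suc2 mult.assoc)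
    finally have split: "g n t *\<^sub>R (V ^ Suc n * Y t) = g (Suc n) t *\<^sub>R (V ^ Suc n + V ^ Suc (Suc n) * Y t)" .
    have "\<Phi> t - (\<Sum>k\<le>Suc n. w k t *\<^sub>R V ^ k) = - t *\<^sub>R (g n t *\<^sub>R (V ^ Suc n * Y t)) - w (Suc n) t *\<^sub>R V ^ Suc n"
      using Suc by (simp add: mult.commute diff_diff_eq[symmetric])
    also have "w (Suc n) t = - t * g (Suc n) t"
      using g_Suc by (simp add: w_def algebra_simps)
    finally show ?case
      unfolding split by (simp add: scaleR_add_right mult.commute)
  qed
  have "(\<Phi> has_integral (G *\<^sub>R one_minus_power V s)) {0<..}"
  proof (rule has_integral_dominated_approximation)
    show "((\<lambda>t. \<Sum>k\<le>n. w k t *\<^sub>R V ^ k) has_integral (\<Sum>k\<le>n. (G * bcoef s k) *\<^sub>R V ^ k)) {0<..}" for n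
      by (intro has_integral_sum has_integral_scaleR_left w_int) simp
    show "((\<lambda>t. K * g n t) has_integral K * (G * ecoef s n)) {0<..}" for n
      unfolding g_def G_def by (intro has_integral_mult_right has_integral_ecoef s)
    show "norm (\<Phi> t - (\<Sum>k\<le>n. w k t *\<^sub>R V ^ k)) \<le> K * g n t" if "t \<in> {0<..}" for n t
    proof -
      have t: "t > 0"
        using that by simp
      have g0: "g n t \<ge> 0"
        using t by (simp add: g_def)
      have "norm (\<Phi> t - (\<Sum>k\<le>n. w k t *\<^sub>R V ^ k)) = g n t * t * norm (V ^ Suc n * Y t)"
        unfolding \<Phi>_diff[OF t] norm_scaleR using t g0 by (simp add: abs_mult)
      also have "\<dots> \<le> g n t * t * (K / t)"
        using Y(3)[OF t, of "Suc n"] t g0 by (intro mult_left_mono) auto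
      finally show ?thesis
        using t by (simp add: mult.commute)
    qed
    have "(\<lambda>n. K * (G * ecoef s n)) \<longlonglongrightarrow> K * (G * 0)"
      by (intro tendsto_intros ecoef_tendsto_0 s)
    then show "(\<lambda>n. K * (G * ecoef s n)) \<longlonglongrightarrow> 0"
      by simp
    have "(\<lambda>n. G *\<^sub>R (\<Sum>k\<le>n. bcoef s k *\<^sub>R V ^ k)) \<longlonglongrightarrow> G *\<^sub>R one_minus_power V s"
      using one_minus_power_sums[OF s V] by (intro tendsto_intros) (simp add: sums_def_le)
    then show "(\<lambda>n. \<Sum>k\<le>n. (G * bcoef s k) *\<^sub>R V ^ k) \<longlonglongrightarrow> G *\<^sub>R one_minus_power V s"
      by (simp add: scaleR_sum_right)
  qed
  then have "((op_of \<circ> \<Phi>) has_integral op_of (G *\<^sub>R one_minus_power V s)) {0<..}"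
    by (rule has_integral_linear[OF _ bounded_linear_op_of])
  moreover have "(op_of \<circ> \<Phi>) t = t powr (s - 1) *\<^sub>R (op_inverse (t *\<^sub>R id_blinfun + op_of (1 - V)) o\<^sub>L op_of (1 - V))"
    if "t \<in> {0<..}" for t
    using inv[of t] that by (simp add: \<Phi>_def)
  ultimately have "((\<lambda>t. t powr (s - 1) *\<^sub>R (op_inverse (t *\<^sub>R id_blinfun + op_of (1 - V)) o\<^sub>L op_of (1 - V)))
      has_integral op_of (G *\<^sub>R one_minus_power V s)) {0<..}"
    by (rule has_integral_eq[rotated])
  then have "balakrishnan_power (op_of (1 - V)) s = (sin (pi * s) / pi) *\<^sub>R op_of (G *\<^sub>R one_minus_power V s)"
    unfolding balakrishnan_power_def by (simp only: integral_unique)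
  moreover have "sin (pi * s) > 0"
    using s by (intro sin_gt_zero) auto
  ultimately show ?thesis
    by (simp add: G_def)
qed

section \<open>Summation by parts and R-bounds for fractional powers\<close>

lemma one_minus_power_partial_sum:
  fixes V :: "'a::complex_normed_vector cop"
  shows "(\<Sum>k<Suc m. bcoef s k *\<^sub>R V ^ k) = (\<Sum>k<Suc m. ecoef s k *\<^sub>R (V ^ k * (1 - V))) + ecoef s m *\<^sub>R V ^ Suc m"
proof (induction m)
  case (Suc m)
  have "(\<Sum>k<Suc (Suc m). bcoef s k *\<^sub>R V ^ k)
      = (\<Sum>k<Suc m. ecoef s k *\<^sub>R (V ^ k * (1 - V))) + (ecoef s m *\<^sub>R V ^ Suc m + bcoef s (Suc m) *\<^sub>R V ^ Suc m)"
    by (subst sum.lessThan_Suc) (simp only: Suc add.assoc)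
  also have "ecoef s m *\<^sub>R V ^ Suc m + bcoef s (Suc m) *\<^sub>R V ^ Suc m = ecoef s (Suc m) *\<^sub>R V ^ Suc m"
    by (simp add: bcoef_Suc flip: scaleR_add_left)
  also have "ecoef s (Suc m) *\<^sub>R V ^ Suc m
      = ecoef s (Suc m) *\<^sub>R (V ^ Suc m * (1 - V)) + ecoef s (Suc m) *\<^sub>R V ^ Suc (Suc m)"
    by (simp add: right_diff_distrib scaleR_diff_right mult.assoc power_commutes)
  finally show ?case
    by (simp only: sum.lessThan_Suc add.assoc)
qed (simp add: scaleR_diff_right)

text \<open>The binomial series is cut at the index m. Below it, summation by parts creates a factor
  1 - V, which \<open>Q\<close> completes to \<open>P\<close>, and the R-bound for n T^n P gains 1 /
  (m + k). Above it, the coefficients themselves have total size of order m^-s.\<close>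

lemma Rbd_one_minus_power:
  fixes T :: "'a::{complex_normed_vector, banach} cop"
  assumes s: "0 < s" "s < 1" and \<zeta>: "cmod \<zeta> = 1"
    and F0: "\<exists>C. Rbd C (range (\<lambda>m. T ^ m))" and F1: "\<exists>C. Rbd C (range (\<lambda>m. real m *\<^sub>R (T ^ m * P)))"
    and Q: "Q * (1 - \<zeta> *\<^sub>C T) = P" and QT: "Q * T = T * Q"
  shows "\<exists>C. Rbd C {real m powr s *\<^sub>R (T ^ m * (Q * one_minus_power (\<zeta> *\<^sub>C T) s)) | m. m \<ge> 1}"
proof -
  define V where "V = \<zeta> *\<^sub>C T"
  have V_power: "V ^ k = \<zeta> ^ k *\<^sub>C T ^ k" for k
    by (simp add: V_def scaleC_power)
  have QV: "Q * V ^ k = V ^ k * Q" for k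
  proof (induction k)
    case (Suc k)
    have "Q * V = V * Q"
      using QT by (simp add: V_def scaleC_mult_left scaleC_mult_right)
    then show ?case
      by (simp add: mult.assoc[symmetric]) (simp add: mult.assoc Suc)
  qed simp
  obtain C0 where C0: "Rbd C0 (range (\<lambda>m. T ^ m))"
    using F0 by blast
  obtain C1 where C1: "Rbd C1 (range (\<lambda>m. real m *\<^sub>R (T ^ m * P)))"
    using F1 by blast
  have V_bound: "norm (V ^ k) \<le> C0" for k
    using Rbd_norm_le[OF C0, of "T ^ k"] \<zeta> by (simp add: V_power norm_scaleC norm_power)
  define F where "F = range (\<lambda>m. real m *\<^sub>R (T ^ m * P)) \<union> {S * U | S U. S \<in> range (\<lambda>m. T ^ m) \<and> U \<in> {Q}}"
  have F: "Rbd (C1 + C0 * norm Q) F"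
    unfolding F_def by (intro Rbd_Un C1 Rbd_mult C0 Rbd_singleton)
  have in_F: "real m *\<^sub>R (T ^ m * P) \<in> F" "T ^ m * Q \<in> F" for m
    unfolding F_def by blast+
  \<comment> \<open>The three contributions are 1 / (1 - s) from the indices before the cut, 1 from
    the tail and 1 from the boundary term of the summation by parts.\<close>
  define L where "L = 1 / (1 - s) + 2"
  have "Rbd (2 * (C1 + C0 * norm Q) * L) {real m powr s *\<^sub>R (T ^ m * (Q * one_minus_power V s)) | m. m \<ge> 1}"
  proof (rule Rbd_acomb_limit[OF F])
    show "F \<noteq> {}" "L > 0"
      using in_F s by (auto simp: L_def intro: add_pos_pos)
    fix U assume "U \<in> {real m powr s *\<^sub>R (T ^ m * (Q * one_minus_power V s)) | m. m \<ge> 1}"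
    then obtain m' where "m' \<ge> 1" "U = real m' powr s *\<^sub>R (T ^ m' * (Q * one_minus_power V s))"
      by blast
    then obtain m where U: "U = real (Suc m) powr s *\<^sub>R (T ^ Suc m * (Q * one_minus_power V s))"
      by (cases m') auto
    define c where "c = real (Suc m) powr s"
    have c: "c > 0"
      by (simp add: c_def)
    define X where "X n = c *\<^sub>R (T ^ Suc m * (Q * (\<Sum>k<n. bcoef s k *\<^sub>R V ^ k)))" for n
    have "X \<longlonglongrightarrow> U"
      unfolding X_def U c_def[symmetric] using one_minus_power_sums[OF s V_bound]
      by (intro tendsto_intros) (simp add: sums_def)
    moreover have "acomb L F (X n)" if n: "n \<ge> Suc m" for n
    proof -
      \<comment> \<open>The partial sum uses only indices below \<open>n\<close>; the index
        \<open>n\<close> itself carries the boundary term.\<close>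
      define G where "G k = (if k < Suc m then real (Suc m + k) *\<^sub>R (T ^ (Suc m + k) * P)
          else if k < n then T ^ (Suc m + k) * Q else T ^ (Suc m + Suc m) * Q)" for k
      define w where "w k = (if k < Suc m then \<zeta> ^ k * of_real (c * ecoef s k / real (Suc m + k))
          else if k < n then \<zeta> ^ k * of_real (c * bcoef s k) else \<zeta> ^ Suc m * of_real (c * ecoef s m))" for k
      have index: "{..n} = {..<Suc m} \<union> {Suc m..<n} \<union> {n}" "{..<Suc m} \<inter> {Suc m..<n} = {}"
        "({..<Suc m} \<union> {Suc m..<n}) \<inter> {n} = {}"
        using n by auto
      have sum_split: "(\<Sum>k\<in>{..n}. f k) = (\<Sum>k<Suc m. f k) + (\<Sum>k=Suc m..<n. f k) + f n" for f :: "nat \<Rightarrow> 'b::comm_monoid_add"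
        unfolding index(1) using index(2,3) by (simp only: sum.union_disjoint finite_UnI finite_lessThan
            finite_atLeastLessThan finite.emptyI finite.insertI) simp
      have "(\<Sum>k<n. bcoef s k *\<^sub>R V ^ k) = (\<Sum>k<Suc m. bcoef s k *\<^sub>R V ^ k) + (\<Sum>k=Suc m..<n. bcoef s k *\<^sub>R V ^ k)"
        using n by (simp only: lessThan_atLeast0 sum.atLeastLessThan_concat le0)
      also have "\<dots> = (\<Sum>k<Suc m. ecoef s k *\<^sub>R (V ^ k * (1 - V))) + (\<Sum>k=Suc m..<n. bcoef s k *\<^sub>R V ^ k) + ecoef s m *\<^sub>R V ^ Suc m"
        unfolding one_minus_power_partial_sum by (simp only: add_ac)
      finally have partial: "X n = (\<Sum>k<Suc m. c *\<^sub>R (T ^ Suc m * (Q * (ecoef s k *\<^sub>R (V ^ k * (1 - V))))))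
          + (\<Sum>k=Suc m..<n. c *\<^sub>R (T ^ Suc m * (Q * (bcoef s k *\<^sub>R V ^ k))))
          + c *\<^sub>R (T ^ Suc m * (Q * (ecoef s m *\<^sub>R V ^ Suc m)))"
        unfolding X_def by (simp only: distrib_left sum_distrib_left scaleR_add_right scaleR_sum_right)
      have QVT: "T ^ Suc m * (Q * (b *\<^sub>R V ^ k)) = (\<zeta> ^ k * of_real b) *\<^sub>C (T ^ (Suc m + k) * Q)" for b k
      proof -
        have "T ^ Suc m * (Q * (b *\<^sub>R V ^ k)) = b *\<^sub>R (T ^ Suc m * V ^ k * Q)"
          by (simp only: mult_scaleR_right QV mult.assoc)
        then show ?thesis
          by (simp only: V_power scaleC_mult_left scaleC_mult_right scaleR_scaleC scaleC_scaleC power_add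
              mult.commute[of "\<zeta> ^ k"])
      qed
      have term1: "c *\<^sub>R (T ^ Suc m * (Q * (ecoef s k *\<^sub>R (V ^ k * (1 - V))))) = w k *\<^sub>C G k" if k: "k < Suc m" for k
      proof -
        have "Q * (V ^ k * (1 - V)) = V ^ k * P"
          unfolding mult.assoc[symmetric] QV unfolding mult.assoc Q[folded V_def] ..
        then have "c *\<^sub>R (T ^ Suc m * (Q * (ecoef s k *\<^sub>R (V ^ k * (1 - V)))))
            = (c * ecoef s k) *\<^sub>R (T ^ Suc m * (V ^ k * P))"
          by (simp only: mult_scaleR_right scaleR_scaleR)
        also have "\<dots> = (\<zeta> ^ k * of_real (c * ecoef s k)) *\<^sub>C (T ^ (Suc m + k) * P)"
          by (simp only: V_power scaleC_mult_left scaleC_mult_right scaleR_scaleC scaleC_scaleC power_add mult.assoc mult.commute[of "\<zeta> ^ k"])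
        also have "\<dots> = w k *\<^sub>C G k"
          using k by (simp add: w_def G_def scaleR_scaleC scaleC_scaleC del: of_nat_Suc of_nat_add)
        finally show ?thesis .
      qed
      have term2: "c *\<^sub>R (T ^ Suc m * (Q * (bcoef s k *\<^sub>R V ^ k))) = w k *\<^sub>C G k" if "Suc m \<le> k" "k < n" for k
        unfolding QVT using that by (simp add: w_def G_def scaleR_scaleC scaleC_scaleC mult_ac)
      have term3: "c *\<^sub>R (T ^ Suc m * (Q * (ecoef s m *\<^sub>R V ^ Suc m))) = w n *\<^sub>C G n"
        unfolding QVT using n by (simp add: w_def G_def scaleR_scaleC scaleC_scaleC mult_ac)
      have X: "X n = (\<Sum>k\<in>{..n}. w k *\<^sub>C G k)"
        unfolding partial sum_split term3 using term1 term2 by (intro arg_cong2[where f = "(+)"] refl sum.cong) auto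
      \<comment> \<open>With the power \<open>T ^ Suc m\<close> and the cut at \<open>Suc m\<close>,
        the factor \<open>c\<close> is exactly the reciprocal of the bound for
        \<open>ecoef s m\<close>.\<close>
      have e_m: "c * ecoef s m \<le> 1"
      proof -
        have "c * ecoef s m \<le> c * real (Suc m) powr - s"
          using c ecoef_le[OF s, of m] by (intro mult_left_mono) auto
        also have "\<dots> = 1"
          by (simp add: c_def flip: powr_add)
        finally show ?thesis .
      qed
      have "(\<Sum>k<Suc m. cmod (w k)) \<le> (\<Sum>k<Suc m. c / real (Suc m) * real (Suc k) powr - s)"
      proof (rule sum_mono)
        fix k assume "k \<in> {..<Suc m}"
        then have "cmod (w k) = c * ecoef s k / real (Suc m + k)"
          using c ecoef_pos[OF s, of k] \<zeta> by (simp add: w_def norm_mult norm_power norm_divide del: of_nat_Suc of_nat_add)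
        also have "\<dots> \<le> c * ecoef s k / real (Suc m)"
          using c ecoef_pos[OF s, of k] by (intro divide_left_mono) auto
        also have "\<dots> \<le> c * real (Suc k) powr - s / real (Suc m)"
          using c ecoef_le[OF s, of k] by (intro divide_right_mono mult_left_mono) auto
        finally show "cmod (w k) \<le> c / real (Suc m) * real (Suc k) powr - s"
          by simp
      qed
      also have "\<dots> = c / real (Suc m) * (\<Sum>k=1..Suc m. real k powr (1 - s - 1))"
        by (simp only: sum_distrib_left[symmetric]) (simp add: sum.atLeast1_atMost_eq)
      also have "\<dots> \<le> c / real (Suc m) * (real (Suc m) powr (1 - s) / (1 - s))"
        using c s by (intro mult_left_mono sum_powr_le) auto
      also have "\<dots> = 1 / (1 - s)"
      proof -
        have "c * real (Suc m) powr (1 - s) = real (Suc m)"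
          by (simp add: c_def flip: powr_add)
        then show ?thesis
          using s by (simp add: field_simps del: of_nat_Suc)
      qed
      finally have 1: "(\<Sum>k<Suc m. cmod (w k)) \<le> 1 / (1 - s)" .
      have "(\<Sum>k=Suc m..<n. cmod (w k)) = c * (\<Sum>k=Suc m..<n. \<bar>bcoef s k\<bar>)"
        unfolding sum_distrib_left using c \<zeta> by (intro sum.cong refl) (auto simp: w_def norm_mult norm_power abs_mult)
      also have "(\<Sum>k=Suc m..<n. \<bar>bcoef s k\<bar>) = ecoef s m - ecoef s (n - 1)"
        using sum_abs_bcoef[OF s, of m "n - 1"] n by (cases n) auto
      also have "c * (ecoef s m - ecoef s (n - 1)) \<le> c * ecoef s m"
        using c ecoef_pos[OF s, of "n - 1"] by (intro mult_left_mono) auto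
      finally have 2: "(\<Sum>k=Suc m..<n. cmod (w k)) \<le> 1"
        using e_m by simp
      have 3: "cmod (w n) \<le> 1"
        using n \<zeta> c ecoef_pos[OF s, of m] e_m by (simp add: w_def norm_mult norm_power)
      have "(\<Sum>k\<in>{..n}. cmod (w k)) \<le> L"
        unfolding sum_split L_def using 1 2 3 by simp
      moreover have "G k \<in> F" for k
        by (cases "k < Suc m"; cases "k < n") (simp_all only: G_def if_True if_False in_F)
      ultimately show ?thesis
        unfolding X by (intro acombI) auto
    qed
    then have "\<forall>\<^sub>F n in sequentially. acomb L F (X n)"
      by (rule eventually_sequentiallyI)
    ultimately show "\<exists>X. (\<forall>\<^sub>F n in sequentially. acomb L F (X n)) \<and> X \<longlonglongrightarrow> U"
      by blast
  qed
  then show ?thesis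
    unfolding V_def by blast
qed

section \<open>Ordered products of commuting operators\<close>

lemma op_prod_op_of: "op_prod (\<lambda>j. op_of (S j)) N = op_of (prod_list (map S [1..<Suc N]))"
proof -
  have "foldr (\<lambda>j R. op_of (S j) o\<^sub>L R) xs id_blinfun = op_of (prod_list (map S xs))" for xs
    by (induction xs) simp_all
  then show ?thesis
    by (simp only: op_prod_def)
qed

lemma op_prod_cong:
  assumes "\<And>j. j \<in> {1..N} \<Longrightarrow> A j = A' j"
  shows "op_prod A N = op_prod A' N"
  unfolding op_prod_def by (rule foldr_cong) (use assms in auto)

lemma commute_prod_list:
  fixes U :: "'b::monoid_mult"
  assumes "\<And>S. S \<in> set Ss \<Longrightarrow> U * S = S * U"
  shows "U * prod_list Ss = prod_list Ss * U"
  using assms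
proof (induction Ss)
  case (Cons S Ss)
  have "U * (S * prod_list Ss) = S * (U * prod_list Ss)"
    using Cons.prems[of S] by (simp flip: mult.assoc)
  also have "\<dots> = S * prod_list Ss * U"
    using Cons by (simp add: mult.assoc)
  finally show ?case
    by simp
qed simp

lemma prod_list_map_mult:
  fixes F G :: "'i \<Rightarrow> 'b::monoid_mult"
  assumes "\<And>i j. i \<in> set xs \<Longrightarrow> j \<in> set xs \<Longrightarrow> F i * G j = G j * F i"
  shows "prod_list (map (\<lambda>j. F j * G j) xs) = prod_list (map F xs) * prod_list (map G xs)"
  using assms
proof (induction xs)
  case (Cons x xs)
  have comm: "G x * prod_list (map F xs) = prod_list (map F xs) * G x"
    using Cons.prems by (intro commute_prod_list) auto
  have "F x * G x * (prod_list (map F xs) * prod_list (map G xs))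
      = F x * (G x * prod_list (map F xs)) * prod_list (map G xs)"
    by (simp only: mult.assoc)
  also have "\<dots> = F x * prod_list (map F xs) * (G x * prod_list (map G xs))"
    unfolding comm by (simp only: mult.assoc)
  finally show ?case
    using Cons by simp
qed simp

lemma prod_list_extract:
  fixes F :: "'i \<Rightarrow> 'b::monoid_mult"
  assumes "j \<in> set xs" "\<And>i. i \<in> set xs \<Longrightarrow> F i * F j = F j * F i"
  shows "\<exists>D. prod_list (map F xs) = F j * D"
  using assms
proof (induction xs)
  case (Cons x xs)
  show ?case
  proof (cases "x = j")
    case False
    then obtain D where D: "prod_list (map F xs) = F j * D"
      using Cons by auto
    have "F x * (F j * D) = F j * (F x * D)"
      using Cons.prems(2)[of x] by (simp flip: mult.assoc)
    then show ?thesis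
      using D by auto
  qed auto
qed simp

lemma Rbd_sum:
  fixes F :: "'i \<Rightarrow> 'a::complex_normed_vector cop set"
  assumes "finite J" "\<And>j. j \<in> J \<Longrightarrow> \<exists>C. Rbd C (F j)"
  shows "\<exists>C. Rbd C {\<Sum>j\<in>J. S j | S. \<forall>j\<in>J. S j \<in> F j}"
  using assms
proof (induction J rule: finite_induct)
  case empty
  show ?case
    using Rbd_singleton[of 0] by (intro exI[of _ "norm (0 :: 'a cop)"]) (rule Rbd_mono, auto)
next
  case (insert k J)
  from insert.prems[of k] obtain C where C: "Rbd C (F k)"
    by auto
  from insert.IH insert.prems obtain D where D: "Rbd D {\<Sum>j\<in>J. S j | S. \<forall>j\<in>J. S j \<in> F j}"
    by (meson insertCI)
  have "{\<Sum>j\<in>insert k J. S j | S. \<forall>j\<in>insert k J. S j \<in> F j}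
      \<subseteq> {S + U | S U. S \<in> F k \<and> U \<in> {\<Sum>j\<in>J. S j | S. \<forall>j\<in>J. S j \<in> F j}}"
  proof clarify
    fix S assume S: "\<forall>j\<in>insert k J. S j \<in> F j"
    show "\<exists>S' U. (\<Sum>j\<in>insert k J. S j) = S' + U \<and> S' \<in> F k \<and> U \<in> {\<Sum>j\<in>J. S j | S. \<forall>j\<in>J. S j \<in> F j}"
      using S insert.hyps by (intro exI[of _ "S k"] exI[of _ "\<Sum>j\<in>J. S j"]) auto
  qed
  then show ?case
    using Rbd_mono[OF Rbd_add[OF C D] order_refl] by blast
qed


section \<open>Comparison of the square functions\<close>

text \<open>The Ritt condition enters the comparison of square functions through the two R-bounds on
  the powers.\<close>

locale ritt_products =
  fixes T :: "'a::{complex_normed_vector, banach} cop" and \<xi> :: "nat \<Rightarrow> complex" and N :: nat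
  assumes N: "N \<ge> 1" and inj: "inj_on \<xi> {1..N}" and unit: "\<And>j. j \<in> {1..N} \<Longrightarrow> cmod (\<xi> j) = 1"
    and powers: "\<exists>C. Rbd C (range (\<lambda>m. T ^ m))"
    and powers_P: "\<exists>C. Rbd C (range (\<lambda>m. real m *\<^sub>R (T ^ m * peval T (\<Prod>j\<in>{1..N}. [:1, - cnj (\<xi> j):]))))"
begin

definition V :: "nat \<Rightarrow> 'a cop"
  where "V j = cnj (\<xi> j) *\<^sub>C T"

definition P :: "'a cop"
  where "P = peval T (\<Prod>j\<in>{1..N}. [:1, - cnj (\<xi> j):])"

text \<open>Mirrors the split of \<open>frac_power\<close> into integer and fractional part, with
  the binomial series in place of Balakrishnan's integral.\<close>

definition fp :: "nat \<Rightarrow> real \<Rightarrow> 'a cop"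
  where "fp j \<alpha> = (1 - V j) ^ nat \<lfloor>\<alpha>\<rfloor> * (if frac \<alpha> = 0 then 1 else one_minus_power (V j) (frac \<alpha>))"

definition B :: "real \<Rightarrow> 'a cop"
  where "B \<alpha> = prod_list (map (\<lambda>j. fp j \<alpha>) [1..<Suc N])"

lemma V_bound: "\<exists>K. \<forall>j\<in>{1..N}. \<forall>k. norm (V j ^ k) \<le> K"
proof -
  obtain C where C: "Rbd C (range (\<lambda>m. T ^ m))"
    using powers by blast
  have "norm (V j ^ k) \<le> C" if "j \<in> {1..N}" for j k
    using Rbd_norm_le[OF C, of "T ^ k"] unit[OF that]
    by (simp add: V_def scaleC_power norm_scaleC norm_power)
  then show ?thesis
    by blast
qed

lemma frac_strict: "frac \<alpha> \<noteq> 0 \<Longrightarrow> 0 < frac \<alpha> \<and> frac \<alpha> < 1" for \<alpha> :: real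
  using frac_ge_0[of \<alpha>] frac_lt_1[of \<alpha>] by linarith

lemma commute_fp:
  assumes j: "j \<in> {1..N}" and U: "T * U = U * T"
  shows "fp j \<alpha> * U = U * fp j \<alpha>"
proof -
  have VU: "V j * U = U * V j"
    using U by (simp add: V_def scaleC_mult_left scaleC_mult_right)
  then have "(1 - V j) * U = U * (1 - V j)"
    by (simp add: left_diff_distrib right_diff_distrib)
  then have 1: "(1 - V j) ^ n * U = U * (1 - V j) ^ n" for n
    by (rule power_commuting_commutes)
  obtain K where K: "\<And>k. norm (V j ^ k) \<le> K"
    using V_bound j by blast
  have 2: "(if frac \<alpha> = 0 then 1 else one_minus_power (V j) (frac \<alpha>)) * U
      = U * (if frac \<alpha> = 0 then 1 else one_minus_power (V j) (frac \<alpha>))"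
    using one_minus_power_commute[OF _ _ K VU] frac_strict[of \<alpha>] by auto
  have "fp j \<alpha> * U = (1 - V j) ^ nat \<lfloor>\<alpha>\<rfloor> * (U * (if frac \<alpha> = 0 then 1 else one_minus_power (V j) (frac \<alpha>)))"
    unfolding fp_def mult.assoc 2 ..
  also have "\<dots> = U * fp j \<alpha>"
    unfolding fp_def mult.assoc[symmetric] 1 ..
  finally show ?thesis .
qed

lemma commute_T_fp: "j \<in> {1..N} \<Longrightarrow> T * fp j \<alpha> = fp j \<alpha> * T"
  using commute_fp[of j T \<alpha>] by simp

lemma commute_fp_fp: "i \<in> {1..N} \<Longrightarrow> j \<in> {1..N} \<Longrightarrow> fp i \<alpha> * fp j \<beta> = fp j \<beta> * fp i \<alpha>"
  using commute_fp[of i "fp j \<beta>" \<alpha>] commute_T_fp[of j \<beta>] by simp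

lemma commute_T_B: "T * B \<alpha> = B \<alpha> * T"
  unfolding B_def by (rule commute_prod_list) (auto intro!: commute_T_fp)

lemma commute_power_B: "T ^ n * B \<alpha> = B \<alpha> * T ^ n"
  by (rule power_commuting_commutes[OF commute_T_B])

lemma B_commute: "B \<alpha> * B \<beta> = B \<beta> * B \<alpha>"
proof -
  have "fp j \<alpha> * B \<beta> = B \<beta> * fp j \<alpha>" if "j \<in> {1..N}" for j
    using commute_fp[OF that commute_T_B] .
  then have "B \<beta> * B \<alpha> = B \<alpha> * B \<beta>"
    unfolding B_def[of \<alpha>] by (intro commute_prod_list) auto
  then show ?thesis
    by (rule sym)
qed

lemma B_mult:
  assumes "\<And>j. j \<in> {1..N} \<Longrightarrow> fp j \<gamma> = fp j \<alpha> * fp j \<beta>"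
  shows "B \<gamma> = B \<alpha> * B \<beta>"
proof -
  have "map (\<lambda>j. fp j \<gamma>) [1..<Suc N] = map (\<lambda>j. fp j \<alpha> * fp j \<beta>) [1..<Suc N]"
    using assms by (intro map_cong refl) auto
  then show ?thesis
    unfolding B_def by (simp only:) (rule prod_list_map_mult, rule commute_fp_fp, auto)
qed

lemma fp_1: "fp j 1 = 1 - V j"
  by (simp add: fp_def)

lemma B_add_1:
  assumes "\<alpha> \<ge> 0"
  shows "B (\<alpha> + 1) = B \<alpha> * B 1"
proof (rule B_mult)
  fix j assume j: "j \<in> {1..N}"
  have "nat \<lfloor>\<alpha> + 1\<rfloor> = Suc (nat \<lfloor>\<alpha>\<rfloor>)" "frac (\<alpha> + 1) = frac \<alpha>"
    using assms by (auto simp: frac_def nat_add_distrib)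
  then have "fp j (\<alpha> + 1) = (1 - V j) * fp j \<alpha>"
    by (simp add: fp_def mult.assoc)
  then show "fp j (\<alpha> + 1) = fp j \<alpha> * fp j 1"
    using commute_fp_fp[OF j j, of 1 \<alpha>] by (simp add: fp_1)
qed

lemma fp_small: "0 < s \<Longrightarrow> s < 1 \<Longrightarrow> fp j s = one_minus_power (V j) s"
  by (simp add: fp_def frac_eq[THEN iffD2] floor_eq_iff)

lemma B_complement:
  assumes "0 < s" "s < 1"
  shows "B 1 = B (1 - s) * B s"
proof (rule B_mult)
  fix j assume j: "j \<in> {1..N}"
  obtain K where K: "\<And>k. norm (V j ^ k) \<le> K"
    using V_bound j by blast
  show "fp j 1 = fp j (1 - s) * fp j s"
    using one_minus_power_mult[of "1 - s" "V j", OF _ _ K] assms by (simp add: fp_small fp_1)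
qed

lemma B_1: "B 1 = P"
proof -
  have "1 - V j = peval T [:1, - cnj (\<xi> j):]" for j
    by (simp add: V_def scaleC_mult_right scaleC_minus_left)
  moreover have "prod_list (map (\<lambda>j. peval T (q j)) xs) = peval T (prod_list (map q xs))" for q and xs :: "nat list"
    by (induction xs) (simp_all add: peval_mult)
  moreover have "(\<Prod>j\<in>{1..N}. q j) = prod_list (map q [1..<Suc N])" for q :: "nat \<Rightarrow> complex poly"
    using prod.distinct_set_conv_list[of "[1..<Suc N]" q] by (simp only: set_upt distinct_upt atLeastLessThanSuc_atLeastAtMost)
  ultimately show ?thesis
    by (simp only: B_def P_def fp_1)
qed

text \<open>The operators of the partial fraction decomposition: \<open>Q j\<close> supplies the
  factors of \<open>P\<close> other than \<open>1 - V j\<close>, and by \<open>Q_sum\<close>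
  suitable multiples add up to the identity.\<close>

definition Q :: "nat \<Rightarrow> 'a cop"
  where "Q j = peval T (\<Prod>i\<in>{1..N} - {j}. [:1, - cnj (\<xi> i):])"

lemma Q_sum: "\<exists>c. (\<Sum>j\<in>{1..N}. c j *\<^sub>C Q j) = 1"
proof -
  have "inj_on (\<lambda>j. cnj (\<xi> j)) {1..N}"
    using inj unfolding inj_on_def complex_cnj_cancel_iff .
  moreover have "{1..N} \<noteq> {}"
    using N by simp
  ultimately obtain c where "(\<Sum>j\<in>{1..N}. smult (c j) (\<Prod>i\<in>{1..N} - {j}. [:1, - cnj (\<xi> i):])) = 1"
    using partial_fractions[OF finite_atLeastAtMost] by blast
  then have "peval T (\<Sum>j\<in>{1..N}. smult (c j) (\<Prod>i\<in>{1..N} - {j}. [:1, - cnj (\<xi> i):])) = 1"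
    by simp
  then have "(\<Sum>j\<in>{1..N}. c j *\<^sub>C Q j) = 1"
    unfolding peval_sum peval_smult Q_def .
  then show ?thesis
    by blast
qed

lemma Q_mult: "j \<in> {1..N} \<Longrightarrow> Q j * (1 - V j) = P"
proof -
  assume j: "j \<in> {1..N}"
  have "1 - V j = peval T [:1, - cnj (\<xi> j):]"
    by (simp add: V_def scaleC_mult_right scaleC_minus_left)
  then have "Q j * (1 - V j) = peval T ([:1, - cnj (\<xi> j):] * (\<Prod>i\<in>{1..N} - {j}. [:1, - cnj (\<xi> i):]))"
    unfolding Q_def by (simp only: peval_mult[symmetric] mult.commute)
  then show ?thesis
    unfolding P_def by (simp only: prod.remove[OF finite_atLeastAtMost j])
qed

lemma Q_commute: "Q j * T = T * Q j"
  using peval_commute_T[of T 1] by (simp add: Q_def)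

text \<open>The R-bounds for fractional powers concern one point \<xi> j at a time and need the
  factor \<open>Q j\<close>. Inserting the identity as the sum of \<open>c j *\<^sub>C Q j\<close>
  localises at each point. In the j-th summand only the factor \<open>fp j \<delta>\<close> has to
  provide decay, and the rest of \<open>B \<delta>\<close> is a fixed bounded operator.\<close>

lemma Rbd_B:
  assumes "0 < \<delta>" "\<delta> \<le> 1"
  shows "\<exists>C. Rbd C {real m powr \<delta> *\<^sub>R (T ^ m * B \<delta>) | m. m \<ge> 1}"
proof (cases "\<delta> = 1")
  case True
  obtain C where "Rbd C (range (\<lambda>m. real m *\<^sub>R (T ^ m * P)))"
    using powers_P unfolding P_def by blast
  then have "Rbd C {real m powr \<delta> *\<^sub>R (T ^ m * B \<delta>) | m. m \<ge> 1}"
    by (rule Rbd_mono) (auto simp: True B_1)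
  then show ?thesis
    by blast
next
  case False
  with assms have \<delta>: "0 < \<delta>" "\<delta> < 1"
    by auto
  obtain c where c: "(\<Sum>j\<in>{1..N}. c j *\<^sub>C Q j) = 1"
    using Q_sum by blast
  have "\<exists>D. B \<delta> = fp j \<delta> * D" if "j \<in> {1..N}" for j
    unfolding B_def using that by (intro prod_list_extract commute_fp_fp) auto
  then obtain D where D: "\<And>j. j \<in> {1..N} \<Longrightarrow> B \<delta> = fp j \<delta> * D j"
    by metis
  define F where "F j = {S * U | S U. S \<in> {real m powr \<delta> *\<^sub>R (T ^ m * (Q j * one_minus_power (V j) \<delta>)) | m. m \<ge> 1}
    \<and> U \<in> {c j *\<^sub>C D j}}" for j
  have "\<exists>C. Rbd C (F j)" if j: "j \<in> {1..N}" for j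
  proof -
    have "\<exists>C. Rbd C {real m powr \<delta> *\<^sub>R (T ^ m * (Q j * one_minus_power (V j) \<delta>)) | m. m \<ge> 1}"
      unfolding V_def
    proof (rule Rbd_one_minus_power[OF \<delta> _ powers])
      show "cmod (cnj (\<xi> j)) = 1"
        using unit[OF j] by simp
      show "\<exists>C. Rbd C (range (\<lambda>m. real m *\<^sub>R (T ^ m * P)))"
        using powers_P unfolding P_def .
      show "Q j * (1 - cnj (\<xi> j) *\<^sub>C T) = P"
        using Q_mult[OF j] unfolding V_def .
    qed (rule Q_commute)
    then show ?thesis
      unfolding F_def using Rbd_mult[OF _ Rbd_singleton] by blast
  qed
  then obtain C where C: "Rbd C {\<Sum>j\<in>{1..N}. S j | S. \<forall>j\<in>{1..N}. S j \<in> F j}"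
    using Rbd_sum[of "{1..N}" F] by auto
  have "{real m powr \<delta> *\<^sub>R (T ^ m * B \<delta>) | m. m \<ge> 1} \<subseteq> {\<Sum>j\<in>{1..N}. S j | S. \<forall>j\<in>{1..N}. S j \<in> F j}"
  proof clarify
    fix m :: nat assume m: "1 \<le> m"
    have "real m powr \<delta> *\<^sub>R (T ^ m * B \<delta>) = real m powr \<delta> *\<^sub>R (T ^ m * ((\<Sum>j\<in>{1..N}. c j *\<^sub>C Q j) * B \<delta>))"
      by (simp only: c mult_1_left)
    also have "\<dots> = (\<Sum>j\<in>{1..N}. real m powr \<delta> *\<^sub>R (T ^ m * ((c j *\<^sub>C Q j) * B \<delta>)))"
      by (simp only: sum_distrib_left sum_distrib_right scaleR_sum_right)
    also have "\<dots> = (\<Sum>j\<in>{1..N}. (real m powr \<delta> *\<^sub>R (T ^ m * (Q j * one_minus_power (V j) \<delta>))) * (c j *\<^sub>C D j))"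
      by (intro sum.cong refl) (simp add: D fp_small[OF \<delta>] scaleC_mult_left scaleC_mult_right mult.assoc scaleC_scaleR_commute)
    finally show "\<exists>S. real m powr \<delta> *\<^sub>R (T ^ m * B \<delta>) = (\<Sum>j\<in>{1..N}. S j) \<and> (\<forall>j\<in>{1..N}. S j \<in> F j)"
      using m unfolding F_def by (intro exI conjI) (assumption, blast)
  qed
  then show ?thesis
    using Rbd_mono[OF C order_refl] by blast
qed

lemma B_decay_small:
  assumes "0 < \<delta>" "\<delta> \<le> 1"
  shows "(\<lambda>n. T ^ n * B \<delta>) \<longlonglongrightarrow> 0"
proof -
  obtain C where C: "Rbd C {real m powr \<delta> *\<^sub>R (T ^ m * B \<delta>) | m. m \<ge> 1}"
    using Rbd_B[OF assms] by blast
  have "norm (T ^ n * B \<delta>) \<le> C * real n powr - \<delta>" if "n \<ge> 1" for n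
  proof -
    have "norm (real n powr \<delta> *\<^sub>R (T ^ n * B \<delta>)) \<le> C"
      using that by (intro Rbd_norm_le[OF C]) blast
    then show ?thesis
      using that by (simp add: powr_minus_divide pos_le_divide_eq mult.commute)
  qed
  then have "\<forall>\<^sub>F n in sequentially. norm (T ^ n * B \<delta>) \<le> C * real n powr - \<delta>"
    by (intro eventually_sequentiallyI[of 1]) auto
  moreover have "(\<lambda>n. C * real n powr - \<delta>) \<longlonglongrightarrow> 0"
    using assms by (intro tendsto_mult_right_zero tendsto_neg_powr filterlim_real_sequentially) auto
  ultimately show ?thesis
    by (rule Lim_null_comparison)
qed

lemma B_decay:
  assumes "\<alpha> > 0"
  shows "(\<lambda>n. T ^ n * B \<alpha>) \<longlonglongrightarrow> 0"
proof (cases "\<alpha> \<le> 1")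
  case False
  have "B \<alpha> = B (\<alpha> - 1) * B 1"
    using B_add_1[of "\<alpha> - 1"] False by simp
  then have "T ^ n * B \<alpha> = B (\<alpha> - 1) * (T ^ n * B 1)" for n
    by (simp add: commute_power_B flip: mult.assoc) (simp add: commute_power_B mult.assoc)
  moreover have "(\<lambda>n. B (\<alpha> - 1) * (T ^ n * B 1)) \<longlonglongrightarrow> B (\<alpha> - 1) * 0"
    by (intro tendsto_intros B_decay_small) auto
  ultimately show ?thesis
    by simp
qed (use assms in \<open>auto intro: B_decay_small\<close>)

section \<open>Square functions as suprema and their comparison\<close>

definition xs :: "real \<Rightarrow> 'a \<Rightarrow> nat \<Rightarrow> 'a"
  where "xs \<alpha> x k = real k powr (\<alpha> - 1 / 2) *\<^sub>R ((T ^ (k - 1) * B \<alpha>) \<star> x)"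

definition SF :: "real \<Rightarrow> 'a \<Rightarrow> ennreal"
  where "SF \<alpha> x = (SUP n. ennreal (rad {1..n} (xs \<alpha> x)))"

definition dominated :: "real \<Rightarrow> real \<Rightarrow> bool"
  where "dominated \<alpha> \<beta> \<longleftrightarrow> (\<exists>C>0. \<forall>x. SF \<alpha> x \<le> ennreal C * SF \<beta> x)"

lemma SF_upper: "ennreal (rad {1..n} (xs \<alpha> x)) \<le> SF \<alpha> x"
  unfolding SF_def by (rule SUP_upper) simp

lemma dominated_trans:
  assumes "dominated \<alpha> \<beta>" "dominated \<beta> \<gamma>"
  shows "dominated \<alpha> \<gamma>"
proof -
  obtain C D where CD: "C > 0" "D > 0" "\<And>x. SF \<alpha> x \<le> ennreal C * SF \<beta> x" "\<And>x. SF \<beta> x \<le> ennreal D * SF \<gamma> x"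
    using assms unfolding dominated_def by blast
  have "SF \<alpha> x \<le> ennreal (C * D) * SF \<gamma> x" for x
  proof -
    have "SF \<alpha> x \<le> ennreal C * (ennreal D * SF \<gamma> x)"
      using CD(3,4) by (meson mult_left_mono order_trans zero_le)
    then show ?thesis
      using CD by (simp add: ennreal_mult mult.assoc)
  qed
  then show ?thesis
    using CD unfolding dominated_def by (intro exI[of _ "C * D"]) auto
qed

text \<open>The bound \<open>b\<close> is assumed for all \<open>K\<close> at once, because
  \<open>n\<close> terms of one sequence may depend on arbitrarily many terms of the other.\<close>

lemma dominatedI:
  assumes "C > 0"
    and "\<And>x n b. (\<And>K. rad {1..K} (xs \<beta> x) \<le> b) \<Longrightarrow> rad {1..n} (xs \<alpha> x) \<le> C * b"
  shows "dominated \<alpha> \<beta>"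
  unfolding dominated_def
proof (intro exI[of _ C] conjI allI assms(1))
  fix x
  show "SF \<alpha> x \<le> ennreal C * SF \<beta> x"
  proof (cases "SF \<beta> x")
    case (real b)
    then have "rad {1..K} (xs \<beta> x) \<le> b" for K
      using SF_upper[of K \<beta> x] by (simp add: ennreal_le_iff)
    then have "rad {1..n} (xs \<alpha> x) \<le> C * b" for n
      using assms(2) by blast
    then show ?thesis
      unfolding SF_def[of \<alpha>] using real assms(1)
      by (intro SUP_least) (simp add: ennreal_leI flip: ennreal_mult)
  next
    case top
    then show ?thesis
      using assms(1) by (simp add: ennreal_mult_top)
  qed
qed

text \<open>Term \<open>m\<close> for the larger exponent is an operator from an R-bounded set
  applied to term \<open>h m\<close>, about \<open>m / 2\<close>, of the other sequence. The map
  \<open>h\<close> takes each value twice, so even and odd \<open>m\<close> are treated separately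
  to keep the signs independent.\<close>

lemma dominated_down:
  assumes \<alpha>: "\<alpha> > 0" and \<delta>: "0 < \<delta>" "\<delta> \<le> 1" and mult: "B (\<alpha> + \<delta>) = B \<delta> * B \<alpha>"
  shows "dominated (\<alpha> + \<delta>) \<alpha>"
proof -
  obtain C where C: "Rbd C {real m powr \<delta> *\<^sub>R (T ^ m * B \<delta>) | m. m \<ge> 1}"
    using Rbd_B[OF \<delta>] by blast
  define F where "F = {real m powr \<delta> *\<^sub>R (T ^ m * B \<delta>) | m. m \<ge> 1} \<union> {B \<delta>}"
  have F: "Rbd (C + norm (B \<delta>)) F"
    unfolding F_def by (intro Rbd_Un C Rbd_singleton)
  \<comment> \<open>\<open>2 powr \<alpha>\<close> bounds the ratio of the weights at
    \<open>m\<close> and \<open>h m\<close>, as \<open>h m \<le> m \<le> 2 * h m\<close>; the factor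
    3 bounds \<open>(m / k) powr \<delta>\<close>, as \<open>m \<le> 3 * k\<close> for
    \<open>k = m div 2\<close> positive.\<close>
  define L where "L = 2 powr \<alpha> * 3"
  define H where "H = {c *\<^sub>C S | c S. cmod c \<le> L \<and> S \<in> F}"
  define D where "D = 2 * (C + norm (B \<delta>)) * L"
  have "L > 0"
    by (simp add: L_def)
  then have H: "Rbd D H"
    unfolding D_def H_def by (intro Rbd_scaleC_le F)
  define h where "h m = (m + 1) div 2" for m :: nat
  have h_bounds: "1 \<le> h m" "h m \<le> m" if "m \<ge> 1" for m
    using that by (auto simp: h_def)
  have step: "\<exists>S\<in>H. xs (\<alpha> + \<delta>) x m = S \<star> xs \<alpha> x (h m)" if m: "m \<ge> 1" for m x
  proof -
    define k where "k = m div 2"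
    have hk: "h m \<ge> 1" "m - 1 = k + (h m - 1)" "h m \<le> m" "m \<le> 2 * h m" "k \<ge> 1 \<Longrightarrow> m \<le> 3 * k" "k = 0 \<Longrightarrow> m = 1"
      using m by (auto simp: h_def k_def)
    have ratio: "real m powr (\<alpha> - 1 / 2) \<le> 2 powr \<alpha> * real (h m) powr (\<alpha> - 1 / 2)"
    proof (cases "\<alpha> \<ge> 1 / 2")
      case True
      have "real m powr (\<alpha> - 1 / 2) \<le> (2 * real (h m)) powr (\<alpha> - 1 / 2)"
        using hk(4) True by (intro powr_mono2) auto
      also have "\<dots> = 2 powr (\<alpha> - 1 / 2) * real (h m) powr (\<alpha> - 1 / 2)"
        by (rule powr_mult)
      also have "\<dots> \<le> 2 powr \<alpha> * real (h m) powr (\<alpha> - 1 / 2)"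
        by (intro mult_right_mono powr_mono) auto
      finally show ?thesis .
    next
      case False
      have "real m powr (\<alpha> - 1 / 2) \<le> 1 * real (h m) powr (\<alpha> - 1 / 2)"
        using hk(1,3) False by (simp add: powr_mono2')
      also have "\<dots> \<le> 2 powr \<alpha> * real (h m) powr (\<alpha> - 1 / 2)"
        using \<alpha> by (intro mult_right_mono ge_one_powr_ge_zero) auto
      finally show ?thesis .
    qed
    \<comment> \<open>For \<open>m = 1\<close> the first half is empty and no decay is available;
      this is why \<open>B \<delta>\<close> was adjoined to \<open>F\<close>.\<close>
    define G where "G = (if k = 0 then B \<delta> else real k powr \<delta> *\<^sub>R (T ^ k * B \<delta>))"
    define r where "r = (if k = 0 then 1 else (real m / real k) powr \<delta>)"
    have G: "G \<in> F"
      by (auto simp: G_def F_def)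
    have r: "0 \<le> r" "r \<le> 3"
    proof -
      have "(real m / real k) powr \<delta> \<le> 3 powr \<delta>" if "k \<noteq> 0"
        using hk(5) that \<delta> by (intro powr_mono2) (auto simp: divide_le_eq)
      also have "3 powr \<delta> \<le> (3 :: real)"
        using powr_mono[of \<delta> 1 3] \<delta> by simp
      finally show "r \<le> 3"
        by (simp add: r_def)
    qed (simp add: r_def)
    have rG: "real m powr \<delta> *\<^sub>R (T ^ k * B \<delta>) = r *\<^sub>R G"
    proof (cases "k = 0")
      case True
      then show ?thesis
        using hk(6) by (simp add: r_def G_def)
    next
      case False
      then have "(real m / real k) powr \<delta> * real k powr \<delta> = real m powr \<delta>"
        by (simp flip: powr_mult)
      then show ?thesis
        using False by (simp add: r_def G_def)
    qed
    define q where "q = real m powr (\<alpha> - 1 / 2) / real (h m) powr (\<alpha> - 1 / 2)"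
    have q: "0 \<le> q" "q \<le> 2 powr \<alpha>" "q * real (h m) powr (\<alpha> - 1 / 2) = real m powr (\<alpha> - 1 / 2)"
      using ratio hk(1) by (auto simp: q_def divide_le_eq)
    have qr: "q * r \<le> L"
      unfolding L_def using q r by (intro mult_mono) auto
    define S where "S = of_real (q * r) *\<^sub>C G"
    have "cmod (of_real (q * r)) \<le> L"
      unfolding norm_of_real using qr q(1) r(1) by simp
    then have "S \<in> H"
      unfolding H_def S_def using G by blast
    moreover have "xs (\<alpha> + \<delta>) x m = S \<star> xs \<alpha> x (h m)"
    proof -
      have "T ^ (m - 1) * B (\<alpha> + \<delta>) = (T ^ k * B \<delta>) * (T ^ (h m - 1) * B \<alpha>)"
        unfolding hk(2) mult power_add by (metis commute_power_B mult.assoc)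
      moreover have "real m powr (\<alpha> + \<delta> - 1 / 2) = real m powr (\<alpha> - 1 / 2) * real m powr \<delta>"
        by (simp only: powr_add[symmetric]) (simp add: algebra_simps)
      ultimately have "xs (\<alpha> + \<delta>) x m
          = real m powr (\<alpha> - 1 / 2) *\<^sub>R ((real m powr \<delta> *\<^sub>R (T ^ k * B \<delta>)) \<star> (T ^ (h m - 1) * B \<alpha>) \<star> x)"
        by (simp add: xs_def blinfun.bilinear_simps)
      also have "\<dots> = S \<star> xs \<alpha> x (h m)"
        unfolding rG q(3)[symmetric] S_def scaleR_scaleC[symmetric]
        by (simp add: xs_def blinfun.bilinear_simps mult_ac)
      finally show ?thesis .
    qed
    ultimately show ?thesis
      by blast
  qed
  have half: "rad I (xs (\<alpha> + \<delta>) x) \<le> D * b"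
    if I: "I \<subseteq> {1..n}" "inj_on h I" and b: "\<And>K. rad {1..K} (xs \<alpha> x) \<le> b" for I n x b
  proof -
    have fin: "finite I"
      using I(1) by (rule finite_subset) simp
    have "\<forall>m\<in>I. \<exists>S\<in>H. xs (\<alpha> + \<delta>) x m = S \<star> xs \<alpha> x (h m)"
      using step I by auto
    then obtain S where S: "\<And>m. m \<in> I \<Longrightarrow> S m \<in> H \<and> xs (\<alpha> + \<delta>) x m = S m \<star> xs \<alpha> x (h m)"
      by metis
    have "rad I (xs (\<alpha> + \<delta>) x) = rad I (\<lambda>m. S m \<star> xs \<alpha> x (h m))"
      using S by (intro rad_cong) auto
    also have "\<dots> \<le> D * rad I (\<lambda>m. xs \<alpha> x (h m))"
      using S fin by (intro RbdD[OF H]) auto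
    also have "rad I (\<lambda>m. xs \<alpha> x (h m)) = rad (h ` I) (xs \<alpha> x)"
      by (rule rad_reindex[OF I(2) fin, symmetric])
    also have "D * rad (h ` I) (xs \<alpha> x) \<le> D * rad {1..n} (xs \<alpha> x)"
    proof (intro mult_left_mono rad_mono)
      show "h ` I \<subseteq> {1..n}"
      proof clarify
        fix m assume "m \<in> I"
        then have "1 \<le> m" "m \<le> n"
          using I(1) by auto
        then show "h m \<in> {1..n}"
          using h_bounds[of m] by simp
      qed
    qed (use Rbd_nonneg[OF H] in auto)
    also have "\<dots> \<le> D * b"
      using b Rbd_nonneg[OF H] by (intro mult_left_mono) auto
    finally show ?thesis .
  qed
  show ?thesis
  proof (rule dominatedI[where C = "2 * D + 1"])
    fix x and n :: nat and b assume b: "\<And>K. rad {1..K} (xs \<alpha> x) \<le> b"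
    define I J where "I = {m \<in> {1..n}. even m}" and "J = {m \<in> {1..n}. odd m}"
    have IJ: "{1..n} = I \<union> J" "I \<subseteq> {1..n}" "J \<subseteq> {1..n}" "finite I" "finite J"
      by (auto simp: I_def J_def)
    have injs: "inj_on h I" "inj_on h J"
    proof -
      have "m = m'" if "even m = even m'" "(m + 1) div 2 = (m' + 1) div 2" for m m' :: nat
        using that by presburger
      then show "inj_on h I" "inj_on h J"
        unfolding I_def J_def h_def by (blast intro: inj_onI)+
    qed
    have "rad {1..n} (xs (\<alpha> + \<delta>) x) \<le> rad I (xs (\<alpha> + \<delta>) x) + rad J (xs (\<alpha> + \<delta>) x)"
      unfolding IJ(1) by (rule rad_Un[OF IJ(4,5)])
    also have "\<dots> \<le> D * b + D * b"
      using half[OF IJ(2) injs(1) b] half[OF IJ(3) injs(2) b] by (rule add_mono)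
    \<comment> \<open>The empty sum at \<open>K = 0\<close> shows \<open>b \<ge> 0\<close>; the
      added 1 only makes the constant positive.\<close>
    also have "\<dots> \<le> (2 * D + 1) * b"
      using b[of 0] by (simp add: algebra_simps)
    finally show "rad {1..n} (xs (\<alpha> + \<delta>) x) \<le> (2 * D + 1) * b" .
  qed (use Rbd_nonneg[OF H] in simp)
qed

text \<open>From \<open>I = \<Sum>c\<^sub>j Q\<^sub>j\<close> and the telescoping \<open>Q\<^sub>j = \<Sum>\<^sub>i\<^sub><\<^sub>n V\<^sub>j\<^sup>i P + V\<^sub>j\<^sup>n Q\<^sub>j\<close> one expands \<open>T\<^sup>m\<close> in the
  \<open>T\<^sup>m\<^sup>+\<^sup>i P\<close> with bounded scalar coefficients; in terms of the square function sequences this is a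
  Hilbert type kernel.\<close>

lemma dominated_up:
  assumes \<alpha>: "\<alpha> > 0"
  shows "dominated \<alpha> (\<alpha> + 1)"
proof -
  obtain c where c: "(\<Sum>j\<in>{1..N}. c j *\<^sub>C Q j) = 1"
    using Q_sum by blast
  define d where "d i = (\<Sum>j\<in>{1..N}. c j * cnj (\<xi> j) ^ i)" for i :: nat
  define A where "A = (\<Sum>j\<in>{1..N}. cmod (c j))"
  have A: "A \<ge> 0"
    by (simp add: A_def sum_nonneg)
  have d_le: "cmod (d i) \<le> A" for i
    unfolding d_def A_def by (rule order_trans[OF norm_sum], rule sum_mono) (simp add: norm_mult norm_power unit)
  \<comment> \<open>The remainder after \<open>n\<close> telescoping steps, bounded uniformly in
    \<open>n\<close> because the points \<xi> j have modulus 1.\<close>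
  define W where "W n = (\<Sum>j\<in>{1..N}. (c j * cnj (\<xi> j) ^ n) *\<^sub>C Q j)" for n
  define A' where "A' = (\<Sum>j\<in>{1..N}. cmod (c j) * norm (Q j))"
  have W_le: "norm (W n) \<le> A'" for n
    unfolding W_def A'_def by (rule order_trans[OF norm_sum], rule sum_mono) (simp add: norm_scaleC norm_mult norm_power unit)
  have expand: "1 = (\<Sum>i<n. d i *\<^sub>C (T ^ i * P)) + T ^ n * W n" for n
  proof (induction n)
    case 0
    then show ?case
      using c by (simp add: W_def)
  next
    case (Suc n)
    have Qj: "Q j = P + cnj (\<xi> j) *\<^sub>C (T * Q j)" if "j \<in> {1..N}" for j
      using Q_mult[OF that] by (simp add: V_def right_diff_distrib scaleC_mult_right Q_commute algebra_simps)
    have "W n = (\<Sum>j\<in>{1..N}. (c j * cnj (\<xi> j) ^ n) *\<^sub>C (P + cnj (\<xi> j) *\<^sub>C (T * Q j)))"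
      unfolding W_def using Qj by (intro sum.cong refl) auto
    also have "\<dots> = d n *\<^sub>C P + T * W (Suc n)"
      by (simp add: W_def d_def scaleC_add_right sum.distrib scaleC_sum_left scaleC_scaleC sum_distrib_left
          scaleC_mult_right mult_ac)
    finally have "T ^ n * W n = d n *\<^sub>C (T ^ n * P) + T ^ Suc n * W (Suc n)"
      by (simp add: distrib_left scaleC_mult_right power_Suc2 mult.assoc del: power_Suc)
    then show ?case
      using Suc by (simp add: add.assoc)
  qed
  \<comment> \<open>\<open>rad_kernel_le\<close> requires a nonpositive exponent. As
    \<open>m \<le> k\<close>, lowering the exponent of \<open>m / k\<close> only enlarges the
    kernel, so exponents above 1/2 may be treated like 1/2.\<close>
  define a where "a = min (\<alpha> - 1 / 2) 0"
  have a: "- 1 / 2 < a" "a \<le> 0" "a \<le> \<alpha> - 1 / 2"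
    using \<alpha> by (auto simp: a_def)
  \<comment> \<open>The factor in \<open>m\<close> is the weight of \<open>xs \<alpha>\<close>; the
    factor in \<open>k\<close> undoes the weight of \<open>xs (\<alpha> + 1)\<close>.\<close>
  define \<tau> where "\<tau> m k = of_real (real m powr (\<alpha> - 1 / 2) * real k powr (- \<alpha> - 1 / 2)) * d (k - m)" for m k
  have \<tau>_le: "cmod (\<tau> m k) \<le> A * (real m powr a * real k powr (- a - 1))" if mk: "1 \<le> m" "m \<le> k" for m k
  proof -
    have ratio: "real m powr e * real k powr (- e - 1) = (real m / real k) powr e * real k powr - 1" for e
    proof -
      have "(real m / real k) powr e = real m powr e * real k powr - e"
        by (simp only: powr_divide powr_minus_divide) simp
      moreover have "real k powr - e * real k powr - 1 = real k powr (- e - 1)"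
        by (simp only: powr_add[symmetric]) simp
      ultimately show ?thesis
        by (simp only: mult.assoc)
    qed
    have "real m powr (\<alpha> - 1 / 2) * real k powr (- \<alpha> - 1 / 2)
        = (real m / real k) powr (\<alpha> - 1 / 2) * real k powr - 1"
    proof -
      have "- (\<alpha> - 1 / 2) - 1 = - \<alpha> - 1 / 2"
        by simp
      then show ?thesis
        using ratio[of "\<alpha> - 1 / 2"] by (simp only:)
    qed
    also have "\<dots> \<le> (real m / real k) powr a * real k powr - 1"
      using mk a by (intro mult_right_mono powr_mono') auto
    also have "\<dots> = real m powr a * real k powr (- a - 1)"
      by (rule ratio[symmetric])
    finally have le: "real m powr (\<alpha> - 1 / 2) * real k powr (- \<alpha> - 1 / 2) \<le> real m powr a * real k powr (- a - 1)" .
    have "cmod (\<tau> m k) = real m powr (\<alpha> - 1 / 2) * real k powr (- \<alpha> - 1 / 2) * cmod (d (k - m))"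
      by (simp only: \<tau>_def norm_mult norm_of_real abs_mult abs_of_nonneg powr_ge_zero)
    also have "\<dots> \<le> real m powr a * real k powr (- a - 1) * A"
      by (rule mult_mono[OF le d_le]) simp_all
    finally show ?thesis
      by (simp only: mult.commute)
  qed
  define C where "C = 8 * A / (a + 1 / 2)"
  have C: "C \<ge> 0"
    using A a by (simp add: C_def)
  have split: "xs \<alpha> x m = (\<Sum>k=m..K. \<tau> m k *\<^sub>C xs (\<alpha> + 1) x k)
      + real m powr (\<alpha> - 1 / 2) *\<^sub>R ((W (Suc K - m) * (T ^ K * B \<alpha>)) \<star> x)" if m: "1 \<le> m" "m \<le> K" for m K x
  proof -
    define n where "n = Suc K - m"
    have term_P: "T ^ (m - 1) * (T ^ i * P * B \<alpha>) = T ^ (m + i - 1) * B (\<alpha> + 1)" for i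
    proof -
      have "P * B \<alpha> = B (\<alpha> + 1)"
        using B_add_1[of \<alpha>] \<alpha> B_commute[of 1 \<alpha>] by (simp add: B_1)
      then have "T ^ (m - 1) * (T ^ i * P * B \<alpha>) = T ^ (m - 1 + i) * B (\<alpha> + 1)"
        by (simp only: mult.assoc power_add)
      then show ?thesis
        using m by simp
    qed
    have term_W: "T ^ (m - 1) * (T ^ n * W n * B \<alpha>) = W n * (T ^ K * B \<alpha>)"
    proof -
      have comm: "T ^ i * W n = W n * T ^ i" for i
        by (simp add: W_def sum_distrib_left sum_distrib_right scaleC_mult_left scaleC_mult_right Q_def peval_commute_T)
      have "T ^ (m - 1) * T ^ n = T ^ K"
        using m by (simp add: n_def flip: power_add)
      then have "T ^ (m - 1) * (T ^ n * W n * B \<alpha>) = T ^ K * W n * B \<alpha>"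
        by (simp only: mult.assoc[symmetric])
      then show ?thesis
        by (simp only: comm mult.assoc)
    qed
    have "1 * B \<alpha> = (\<Sum>i<n. d i *\<^sub>C (T ^ i * P * B \<alpha>)) + T ^ n * W n * B \<alpha>"
      by (subst expand[of n]) (simp only: distrib_right sum_distrib_right scaleC_mult_left)
    then have "T ^ (m - 1) * B \<alpha>
        = T ^ (m - 1) * ((\<Sum>i<n. d i *\<^sub>C (T ^ i * P * B \<alpha>)) + T ^ n * W n * B \<alpha>)"
      by (simp only: mult_1_left)
    also have "\<dots> = (\<Sum>i<n. d i *\<^sub>C (T ^ (m - 1) * (T ^ i * P * B \<alpha>))) + T ^ (m - 1) * (T ^ n * W n * B \<alpha>)"
      by (simp only: distrib_left sum_distrib_left scaleC_mult_right)
    also have "\<dots> = (\<Sum>i<n. d i *\<^sub>C (T ^ (m + i - 1) * B (\<alpha> + 1))) + W n * (T ^ K * B \<alpha>)"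
      by (simp only: term_P term_W)
    finally have expansion: "T ^ (m - 1) * B \<alpha>
        = (\<Sum>i<n. d i *\<^sub>C (T ^ (m + i - 1) * B (\<alpha> + 1))) + W n * (T ^ K * B \<alpha>)" .
    have "xs \<alpha> x m = (\<Sum>i<n. real m powr (\<alpha> - 1 / 2) *\<^sub>R (d i *\<^sub>C ((T ^ (m + i - 1) * B (\<alpha> + 1)) \<star> x)))
        + real m powr (\<alpha> - 1 / 2) *\<^sub>R ((W n * (T ^ K * B \<alpha>)) \<star> x)"
      unfolding xs_def expansion
      by (simp only: op_of_simps(3) blinfun.add_left app_sum_left op_of_simps(8) scaleC_blinfun_apply
          scaleR_add_right scaleR_sum_right)
    also have "(\<Sum>i<n. real m powr (\<alpha> - 1 / 2) *\<^sub>R (d i *\<^sub>C ((T ^ (m + i - 1) * B (\<alpha> + 1)) \<star> x)))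
        = (\<Sum>k=m..K. \<tau> m k *\<^sub>C xs (\<alpha> + 1) x k)"
    proof (rule sum.reindex_bij_witness[of _ "\<lambda>k. k - m" "\<lambda>i. m + i"])
      fix i assume i: "i \<in> {..<n}"
      have "real (m + i) powr (- \<alpha> - 1 / 2) * real (m + i) powr (\<alpha> + 1 - 1 / 2) = 1"
        using m by (simp flip: powr_add)
      then have "(real m powr (\<alpha> - 1 / 2) * real (m + i) powr (- \<alpha> - 1 / 2)) * real (m + i) powr (\<alpha> + 1 - 1 / 2)
          = real m powr (\<alpha> - 1 / 2)"
        by (simp only: mult.assoc mult_1_right)
      moreover have "of_real (r * s) * d i * of_real e = of_real (r * s * e) * d i" for r s e :: real
        by (simp only: of_real_mult mult_ac)
      ultimately have coefficient: "of_real (real m powr (\<alpha> - 1 / 2) * real (m + i) powr (- \<alpha> - 1 / 2)) * d i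
          * of_real (real (m + i) powr (\<alpha> + 1 - 1 / 2)) = of_real (real m powr (\<alpha> - 1 / 2)) * d i"
        by (simp only:)
      show "\<tau> m (m + i) *\<^sub>C xs (\<alpha> + 1) x (m + i)
          = real m powr (\<alpha> - 1 / 2) *\<^sub>R (d i *\<^sub>C ((T ^ (m + i - 1) * B (\<alpha> + 1)) \<star> x))"
        by (simp only: \<tau>_def xs_def scaleR_scaleC scaleC_scaleC add_diff_cancel_left' coefficient)
    qed (auto simp: n_def)
    finally show ?thesis
      by (simp only: n_def)
  qed
  show ?thesis
  proof (rule dominatedI[where C = "C + 1"])
    fix x and n :: nat and b assume b: "\<And>K. rad {1..K} (xs (\<alpha> + 1) x) \<le> b"
    define R where "R K m = real m powr (\<alpha> - 1 / 2) *\<^sub>R ((W (Suc K - m) * (T ^ K * B \<alpha>)) \<star> x)" for K m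
    have R_lim: "(\<lambda>K. norm (R K m)) \<longlonglongrightarrow> 0" for m
    proof (rule tendsto_sandwich[OF _ _ tendsto_const])
      show "(\<lambda>K. real m powr (\<alpha> - 1 / 2) * (A' * norm (T ^ K * B \<alpha>) * norm x)) \<longlonglongrightarrow> 0"
        using tendsto_norm_zero[OF B_decay[OF \<alpha>]]
        by (intro tendsto_mult_right_zero tendsto_mult_left_zero)
      have "norm (R K m) \<le> real m powr (\<alpha> - 1 / 2) * (A' * norm (T ^ K * B \<alpha>) * norm x)" for K
      proof -
        have "norm ((W (Suc K - m) * (T ^ K * B \<alpha>)) \<star> x) \<le> norm (W (Suc K - m) * (T ^ K * B \<alpha>)) * norm x"
          by (rule norm_app_le)
        also have "\<dots> \<le> (A' * norm (T ^ K * B \<alpha>)) * norm x"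
          using W_le by (intro mult_right_mono order_trans[OF norm_mult_ineq]) auto
        finally show ?thesis
          unfolding R_def norm_scaleR by (intro mult_mono) auto
      qed
      then show "\<forall>\<^sub>F K in sequentially. norm (R K m) \<le> real m powr (\<alpha> - 1 / 2) * (A' * norm (T ^ K * B \<alpha>) * norm x)"
        by simp
    qed simp
    have "rad {1..n} (xs \<alpha> x) \<le> C * b + (\<Sum>m=1..n. norm (R K m))" if K: "K \<ge> n" for K
    proof -
      have "rad {1..n} (xs \<alpha> x) = rad {1..n} (\<lambda>m. (\<Sum>k=m..K. \<tau> m k *\<^sub>C xs (\<alpha> + 1) x k) + R K m)"
        using split K by (intro rad_cong) (auto simp: R_def)
      also have "\<dots> \<le> rad {1..n} (\<lambda>m. \<Sum>k=m..K. \<tau> m k *\<^sub>C xs (\<alpha> + 1) x k) + rad {1..n} (R K)"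
        by (rule rad_add)
      \<comment> \<open>The remainder is estimated crudely by a sum of norms. This suffices since
        \<open>n\<close> stays fixed while \<open>K\<close> tends to infinity, and each term tends
        to 0 by \<open>B_decay\<close>.\<close>
      also have "\<dots> \<le> C * rad {1..K} (xs (\<alpha> + 1) x) + (\<Sum>m=1..n. norm (R K m))"
        unfolding C_def by (intro add_mono rad_kernel_le a A \<tau>_le rad_le_sum_norm) auto
      also have "\<dots> \<le> C * b + (\<Sum>m=1..n. norm (R K m))"
        using b C by (intro add_mono mult_left_mono) auto
      finally show ?thesis .
    qed
    moreover have "(\<lambda>K. C * b + (\<Sum>m=1..n. norm (R K m))) \<longlonglongrightarrow> C * b + (\<Sum>m=1..n. 0)"
      by (intro tendsto_intros R_lim)
    ultimately have "rad {1..n} (xs \<alpha> x) \<le> C * b + (\<Sum>m=1..n. 0)"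
      by (intro LIMSEQ_le_const) auto
    also have "\<dots> \<le> (C + 1) * b"
      using b[of 0] by (simp add: algebra_simps)
    finally show "rad {1..n} (xs \<alpha> x) \<le> (C + 1) * b" .
  qed (use C in simp)
qed

text \<open>For \<open>0 < s < 1\<close> one direction passes through \<open>s + 1\<close>, which is
  compared with 1 by adding \<open>s\<close> to 1; the other reaches 1 from \<open>s\<close> by
  adding \<open>1 - s\<close>. Larger exponents are brought below 1 by unit steps.\<close>

lemma dominated_one:
  assumes "\<alpha> > 0"
  shows "dominated \<alpha> 1 \<and> dominated 1 \<alpha>"
proof -
  have up: "dominated \<alpha> (\<alpha> + 1)" and down: "dominated (\<alpha> + 1) \<alpha>" if "\<alpha> > 0" for \<alpha>
  proof -
    show "dominated \<alpha> (\<alpha> + 1)"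
      using that by (rule dominated_up)
    have "B (\<alpha> + 1) = B 1 * B \<alpha>"
      using B_add_1[of \<alpha>] that B_commute by simp
    then show "dominated (\<alpha> + 1) \<alpha>"
      using that by (intro dominated_down) auto
  qed
  have small: "dominated s 1 \<and> dominated 1 s" if s: "0 < s" "s < 1" for s
  proof
    have "dominated (1 + s) 1"
      using s B_add_1[of s] by (intro dominated_down) (auto simp: add.commute)
    then show "dominated s 1"
      using dominated_trans[OF up[OF s(1)]] by (simp add: add.commute)
    show "dominated 1 s"
      using dominated_down[of s "1 - s"] B_complement[OF s] s by simp
  qed
  have refl: "dominated 1 1"
    unfolding dominated_def by (intro exI[of _ 1]) simp
  have "0 < \<beta> \<Longrightarrow> \<beta> \<le> real n \<Longrightarrow> dominated \<beta> 1 \<and> dominated 1 \<beta>" for n \<beta>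
  proof (induction n arbitrary: \<beta>)
    case (Suc n)
    consider "\<beta> < 1" | "\<beta> = 1" | "\<beta> > 1"
      by linarith
    then show ?case
    proof cases
      case 3
      then have "dominated (\<beta> - 1) 1 \<and> dominated 1 (\<beta> - 1)"
        using Suc by (intro Suc.IH) auto
      moreover have "dominated \<beta> (\<beta> - 1)" "dominated (\<beta> - 1) \<beta>"
        using up[of "\<beta> - 1"] down[of "\<beta> - 1"] 3 by simp_all
      ultimately show ?thesis
        using dominated_trans by blast
    qed (use small refl Suc in auto)
  qed simp
  then show ?thesis
    using assms real_arch_simple by blast
qed

section \<open>Identification with the square functions of the statement\<close>

lemma frac_power_eq_fp:
  assumes j: "j \<in> {1..N}"
  shows "frac_power (id_blinfun - cnj (\<xi> j) *\<^sub>C op_of T) \<alpha> = op_of (fp j \<alpha>)"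
proof -
  obtain K where K: "\<And>k. norm (V j ^ k) \<le> K"
    using V_bound j by blast
  have "id_blinfun - cnj (\<xi> j) *\<^sub>C op_of T = op_of (1 - V j)"
    by (simp add: V_def)
  moreover have "balakrishnan_power (op_of (1 - V j)) (frac \<alpha>) = op_of (one_minus_power (V j) (frac \<alpha>))"
    if "frac \<alpha> \<noteq> 0"
    using frac_strict[OF that] by (intro balakrishnan_power_one_minus[OF _ _ K]) auto
  ultimately show ?thesis
    by (simp add: frac_power_def fp_def op_of_power)
qed

lemma square_function_eq_SF:
  assumes "rademacher_sequence M \<epsilon>"
  shows "square_function M \<epsilon> N \<xi> (op_of T) \<alpha> x = SF \<alpha> x"
proof -
  have "op_prod (\<lambda>j. frac_power (id_blinfun - cnj (\<xi> j) *\<^sub>C op_of T) \<alpha>) N = op_prod (\<lambda>j. op_of (fp j \<alpha>)) N"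
    by (rule op_prod_cong) (rule frac_power_eq_fp)
  also have "\<dots> = op_of (B \<alpha>)"
    by (simp only: op_prod_op_of B_def)
  finally have "square_function M \<epsilon> N \<xi> (op_of T) \<alpha> x = lim (\<lambda>n. ennreal (rad {1..n} (xs \<alpha> x)))"
    by (simp add: square_function_def rad_norm_eq_rad[OF assms] xs_def[abs_def] flip: op_of_power)
  also have "\<dots> = SF \<alpha> x"
    unfolding SF_def
  proof (intro limI LIMSEQ_SUP)
    show "incseq (\<lambda>n. ennreal (rad {1..n} (xs \<alpha> x)))"
      by (intro incseq_SucI ennreal_leI rad_mono) auto
  qed
  finally show ?thesis .
qed

end

theorem theorem7p2:
  fixes M :: "'w measure"
    and \<epsilon> :: "nat \<Rightarrow> 'w \<Rightarrow> real"
    and N :: nat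
    and \<xi> :: "nat \<Rightarrow> complex"
    and T :: "'a::{complex_normed_vector, banach} \<Rightarrow>\<^sub>L 'a"
    and \<alpha> \<beta> :: real
  assumes "rademacher_sequence M \<epsilon>"
    and "N \<ge> 1"
    and "inj_on \<xi> {1..N}"
    and "\<xi> ` {1..N} \<subseteq> sphere 0 1"
    and "reflexive_space TYPE('a)"
    and "finite_cotype M \<epsilon> TYPE('a)"
    and "R_Ritt M \<epsilon> N \<xi> T"
    and "\<alpha> > 0" and "\<beta> > 0"
  shows "\<exists>C::real. C \<ge> 1 \<and> (\<forall>x.
    ennreal (inverse C) * square_function M \<epsilon> N \<xi> T \<beta> x \<le> square_function M \<epsilon> N \<xi> T \<alpha> x \<and>
    square_function M \<epsilon> N \<xi> T \<alpha> x \<le> ennreal C * square_function M \<epsilon> N \<xi> T \<beta> x)"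
proof -
  define S where "S = cop_of T"
  have S: "op_of S = T"
    using assms(7) by (simp add: S_def cop_of_inverse R_Ritt_def)
  define R where "R z = cop_of (resolvent z T)" for z
  have inv: "is_op_inverse (z *\<^sub>C id_blinfun - T) (resolvent z T)" if z: "1 < cmod z" for z
  proof -
    have "z \<notin> spectrum T"
      using assms(7) z by (auto simp: R_Ritt_def)
    then obtain U where "is_op_inverse (z *\<^sub>C id_blinfun - T) U"
      by (auto simp: spectrum_def)
    then show ?thesis
      by (simp add: resolvent_def op_inverse_eqI)
  qed
  have R: "op_of (R z) = resolvent z T" if "1 < cmod z" for z
    using inv[OF that] by (simp add: R_def cop_of_inverse is_op_inverse_def)
  have res: "resolvent_map S R"
    unfolding resolvent_map_def
  proof (intro allI impI)
    fix z :: complex assume "1 < cmod z"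
    then show "R z * (z *\<^sub>C 1 - S) = 1 \<and> (z *\<^sub>C 1 - S) * R z = 1"
      using inv[of z] R[of z] S by (simp add: op_of_inject[symmetric] is_op_inverse_def)
  qed
  define p where "p = (\<Prod>j\<in>{1..N}. [:1, - cnj (\<xi> j):])"
  have unit: "cmod (\<xi> j) = 1" if "j \<in> {1..N}" for j
    using assms(4) that by (simp add: image_subset_iff)
  have "\<exists>D. Rbd D {poly p z *\<^sub>C R z | z. 1 < cmod z \<and> cmod z < C}" if C: "C > 1" for C
  proof (rule R_bounded_imp_Rbd[OF assms(1)])
    let ?D = "{z. 1 < cmod z \<and> cmod z < C}"
    have p_eq: "poly p z = (\<Prod>j=1..N. 1 - cnj (\<xi> j) * z)" for z
      by (simp add: p_def poly_prod mult.commute)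
    have "op_of ` {poly p z *\<^sub>C R z | z. 1 < cmod z \<and> cmod z < C} = (\<lambda>z. op_of (poly p z *\<^sub>C R z)) ` ?D"
      by (simp only: setcompr_eq_image image_image)
    also have "\<dots> = (\<lambda>z. (\<Prod>j=1..N. 1 - cnj (\<xi> j) * z) *\<^sub>C resolvent z T) ` ?D"
      by (intro image_cong refl) (simp only: mem_Collect_eq op_of_simps R p_eq)
    also have "\<dots> = {(\<Prod>j=1..N. 1 - cnj (\<xi> j) * z) *\<^sub>C resolvent z T | z. 1 < cmod z \<and> cmod z < C}"
      by (simp only: setcompr_eq_image)
    finally have "op_of ` {poly p z *\<^sub>C R z | z. 1 < cmod z \<and> cmod z < C}
        = {(\<Prod>j=1..N. 1 - cnj (\<xi> j) * z) *\<^sub>C resolvent z T | z. 1 < cmod z \<and> cmod z < C}" .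
    then show "R_bounded M \<epsilon> (op_of ` {poly p z *\<^sub>C R z | z. 1 < cmod z \<and> cmod z < C})"
      using assms(7) C by (simp add: R_Ritt_def)
  qed
  note bounds = Rbd_power_bounds[OF res finite_atLeastAtMost _ assms(3) unit p_def this]
  have nonempty: "{1..N} \<noteq> {}"
    using assms(2) by simp
  interpret ritt_products S \<xi> N
    using assms(2,3) unit bounds(1)[OF nonempty] bounds(2)[OF nonempty, unfolded p_def]
    by unfold_locales blast+
  have "dominated \<alpha> \<beta>" "dominated \<beta> \<alpha>"
    using dominated_one[OF assms(8)] dominated_one[OF assms(9)] dominated_trans by blast+
  then obtain C D where CD: "C > 0" "D > 0" "\<And>x. SF \<alpha> x \<le> ennreal C * SF \<beta> x" "\<And>x. SF \<beta> x \<le> ennreal D * SF \<alpha> x"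
    unfolding dominated_def by blast
  define L where "L = max 1 (max C D)"
  have L: "L \<ge> 1" "C \<le> L" "D \<le> L"
    by (auto simp: L_def)
  show ?thesis
  proof (intro exI[of _ L] conjI allI L(1))
    fix x
    have SF: "square_function M \<epsilon> N \<xi> T \<gamma> x = SF \<gamma> x" for \<gamma>
      using square_function_eq_SF[OF assms(1), of \<gamma> x] by (simp only: S)
    show "square_function M \<epsilon> N \<xi> T \<alpha> x \<le> ennreal L * square_function M \<epsilon> N \<xi> T \<beta> x"
      unfolding SF using CD(3)[of x] L(2) by (meson ennreal_leI mult_right_mono order_trans zero_le)
    have "SF \<beta> x \<le> ennreal L * SF \<alpha> x"
      using CD(4)[of x] L(3) by (meson ennreal_leI mult_right_mono order_trans zero_le)
    then have "ennreal (inverse L) * SF \<beta> x \<le> ennreal (inverse L) * (ennreal L * SF \<alpha> x)"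
      by (intro mult_left_mono) auto
    also have "\<dots> = SF \<alpha> x"
      using L(1) by (simp add: mult.assoc[symmetric] flip: ennreal_mult)
    finally show "ennreal (inverse L) * square_function M \<epsilon> N \<xi> T \<beta> x \<le> square_function M \<epsilon> N \<xi> T \<alpha> x"
      unfolding SF .
  qed
qed

end
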